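(* Consider the infinite-mode exact-integration Galerkin (I–EIG) system in $H$-orthogonalized form on each element, with notation as in the context and $U^{(o)}\ne0$ on each element. Let $\Omega$ and $\Omega_f$ be neighbouring elements sharing the interface $\partial\Omega^f$, let $n_f$ be the outward unit normal of $\Omega$ on $\partial\Omega^f$, and put $G_{n_f}(u):=G_k(u)n_{f,k}$. For each mode $\alpha$ of $\Omega$ and mode $\gamma$ of $\Omega_f$ define $$P^f_{\alpha,[\Omega_f]\gamma}:=-\tfrac12\int_{\partial\Omega^f}\big(\Phi^{(o)}_\alpha U^{(o)}_\alpha\big)^\top G_{n_f}(u)\big(\Phi^{(o)}_{[\Omega_f]\gamma}U^{(o)}_{[\Omega_f]\gamma}\big)\,dS ,$$ and define $P^f_{[\Omega_f]\gamma,\alpha}$ by the same formula with the roles of the elements exchanged, i.e. viewed from $\Omega_f$ with its outward normal $-n_f$. Then $$\mathcal B^f_\alpha=\sum_\gamma P^f_{\alpha,[\Omega_f]\gamma},\qquad \mathcal B^f_{[\Omega_f]\gamma}=\sum_\alpha P^f_{[\Omega_f]\gamma,\alpha},\qquad P^f_{[\Omega_f]\gamma,\alpha}=-P^f_{\alpha,[\Omega_f]\gamma}.$$ Consequently $$\sum_\alpha\mathcal B^f_\alpha+\sum_\gamma\mathcal B^f_{[\Omega_f]\gamma}=0$$ on every internal interface. Hence for any target domain $\mathcal D$ formed by a union of elements, $$\frac{d}{dt}\sum_{\Omega\subset\mathcal D}\sum_\alpha E_{\Omega,\alpha}=\mathcal B_{\partial\mathcal D},$$ where $\mathcal B_{\partial\mathcal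 D}$ denotes the total contribution from the external boundary $\partial\mathcal D$, i.e. the sum of all $\mathcal B_\alpha^f$ over the element faces $f$ lying on $\partial\mathcal D$ and all modes $\alpha$ of the corresponding elements of $\mathcal D$.
   Context: Physical setting. Repeated spatial indices $k$ are summed over $1,\dots,d$. The system is $\partial_tu+A_k(u)\partial_{x_k}u=0$, $x\in\mathbb R^d$, $u\in\mathbb R^m$ with values in an admissible set $\mathcal U$, $A_k=\partial_uF_k$ the Jacobian of a smooth flux. A smooth energy pair $(e,g_k)$ satisfies $\nabla_ue^\top A_k=\nabla_ug_k^\top$. On $\mathcal U$, $e>0$ and $\mathcal H_e=\nabla_u^2e$ is symmetric positive definite (SPD). Put $H(u)=\frac{2e(u)}{u^\top\mathcal H_e(u)u}\mathcal H_e(u)$, so $e=\tfrac12u^\top Hu$. Let $G_k(u)$ be a smooth symmetric matrix field with $g_k=\tfrac12u^\top G_ku$, and define $\Delta A_k$ by $G_k=H(A_k+\Delta A_k)$. All eigenvalues of $H$ lie in a fixed interval $[c_H,C_H]$, $0<c_H\le C_H<\infty$. Modal setting. On each element $\Omega$, let $\{\phi_\alpha\}_{\alpha\in\mathbb N}$ be a time-independent $L^2(\Omega)$-orthonormal polynomial basis (spanning polynomials of all degrees) and $\Phi_\alpha=\phi_\alpha I_m$, $\Phi=[\Phi_1\ \Phi_2\ \cdots]$. In the I–EIG system the state $u=\sum_\alpha\Phi_\alpha U_\alpha$, $U_\alpha(t)\in\mathbb R^m$, is a smooth solution of the PDE, all integrals are exact, and the trace of $u$ is single-valued on each internal interface.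 With $(M_H)_{\alpha\beta}=\int_\Omega\Phi_\alpha^\top H(u)\Phi_\beta\,dV$ and $(N_H)_{\alpha\beta}=\int_\Omega\Phi_\alpha^\top H(u)A_k(u)\partial_{x_k}\Phi_\beta\,dV$, the coefficients satisfy $\sum_\beta (M_H)_{\alpha\beta}\dot U_\beta+\sum_\beta (N_H)_{\alpha\beta}U_\beta=0$ for all $\alpha$. Let $M_H=R^\top R$ with $R$ the upper triangular Cholesky factor, and set $U^{(o)}:=RU$, $\Phi^{(o)}:=\Phi R^{-1}$ with blocks $\Phi^{(o)}_\alpha$, so $u=\sum_\alpha\Phi^{(o)}_\alpha U^{(o)}_\alpha$. The modal energy is $E_{\Omega,\alpha}:=\tfrac12\|U_\alpha^{(o)}\|_2^2$. Face terms. For each face $f$ of $\Omega$ with outward unit normal $n_f$, let $$(B^{(o),f}_{H(G)})_{\alpha\beta}:=\int_{\partial\Omega^f}(\Phi^{(o)}_\alpha)^\top H(u)\big(A_k(u)+\Delta A_k(u)\big)\Phi^{(o)}_\beta n_{f,k}\,dS,\qquad \mathcal B^f_\alpha:=-\tfrac12\sum_\beta (U^{(o)}_\alpha)^\top (B^{(o),f}_{H(G)})_{\alpha\beta}U^{(o)}_\beta .$$ Unbracketed quantities are viewed from $\Omega$; quantities with subscript $[\Omega_f]$ are the same quantities viewed from $\Omega_f$ (its own basis, Cholesky factor, coefficients and outward normal $n_{f[\Omega_f]}=-n_f$), so $\mathcal B^f_{[\Omega_f]\gamma}:=-\tfrac12\sum_\beta (U^{(o)}_{[\Omega_f]\gamma})^\top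 (B^{(o),f}_{H(G)[\Omega_f]})_{\gamma\beta}U^{(o)}_{[\Omega_f]\beta}$. Convention: infinite matrices, their Cholesky factors, products and sums are taken to be well defined and convergent, and series may be rearranged, differentiated termwise and interchanged with integration. *)

theory Defs
  imports "HOL-Analysis.Analysis"
begin

section \<open>Smooth functions and partial derivatives\<close>

primrec Ck_on :: "nat \<Rightarrow> 'a::real_normed_vector set \<Rightarrow> ('a \<Rightarrow> 'b::real_normed_vector) \<Rightarrow> bool" where
  "Ck_on 0 S f \<longleftrightarrow> continuous_on S f"
| "Ck_on (Suc k) S f \<longleftrightarrow>
     (\<forall>x\<in>S. f differentiable (at x)) \<and> (\<forall>v. Ck_on k S (\<lambda>x. frechet_derivative f (at x) v))"

text \<open>On a closed cell this means smooth up to the boundary; on an open set it is plain smoothness.\<close>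

definition smooth_near :: "'a::real_normed_vector set \<Rightarrow> ('a \<Rightarrow> 'b::real_normed_vector) \<Rightarrow> bool" where
  "smooth_near S f \<longleftrightarrow> (\<exists>W. open W \<and> S \<subseteq> W \<and> (\<forall>k. Ck_on k W f))"

definition partial :: "'n::finite \<Rightarrow> (real^'n \<Rightarrow> 'b::real_normed_vector) \<Rightarrow> real^'n \<Rightarrow> 'b" where
  "partial k f x = frechet_derivative f (at x) (axis k 1)"

definition gradient :: "(real^'n::finite \<Rightarrow> real) \<Rightarrow> real^'n \<Rightarrow> real^'n" where
  "gradient f x = (\<chi> i. partial i f x)"

definition hessian :: "(real^'n::finite \<Rightarrow> real) \<Rightarrow> real^'n \<Rightarrow> real^'n^'n" where
  "hessian f x = (\<chi> i j. partial i (partial j f) x)"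

definition divergence :: "(real^'n::finite \<Rightarrow> real^'n) \<Rightarrow> real^'n \<Rightarrow> real" where
  "divergence \<psi> x = (\<Sum>k\<in>UNIV. partial k \<psi> x $ k)"


section \<open>Surface measure, elements and meshes\<close>

text \<open>
  Hausdorff outer measure, normalised to agree with Lebesgue measure on flat \<open>s\<close>-dimensional
  pieces. Nonempty sets of diameter 0 count \<open>0 ^ 0 = 1\<close> for \<open>s = 0\<close>, which gives the counting
  measure. It is a metric outer measure, hence countably additive on the Borel sets, so that
  \<open>measure_of\<close> below does not collapse to the zero measure.
\<close>

definition hausdorff_pre :: "nat \<Rightarrow> real \<Rightarrow> 'a::metric_space set \<Rightarrow> ennreal" where
  "hausdorff_pre s \<delta> A =
     (INF C \<in> {C :: nat \<Rightarrow> 'a set. A \<subseteq> (\<Union>i. C i) \<and> (\<forall>i. bounded (C i) \<and> diameter (C i) \<le> \<delta>)}.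
        (\<Sum>i. if C i = {} then 0
             else ennreal (unit_ball_vol (real s) * (diameter (C i) / 2) ^ s)))"

definition hausdorff_measure :: "nat \<Rightarrow> 'a::metric_space measure" where
  "hausdorff_measure s =
     measure_of UNIV (sets borel) (\<lambda>A. SUP \<delta>\<in>{0<..}. hausdorff_pre s \<delta> A)"

definition surface_measure :: "(real^'d::finite) measure" where
  "surface_measure = hausdorff_measure (CARD('d) - 1)"

text \<open>
  De Giorgi's definition of the outward unit normal of a bounded set of finite perimeter: the Borel
  unit field on the boundary that satisfies the Gauss-Green formula for all compactly supported
  \<open>C\<^sup>1\<close> vector fields. Polytopes and curved cells with piecewise \<open>C\<^sup>1\<close> boundary are covered, with their
  usual normals. The boundary is cut into faces \<open>f\<close>, and \<open>n f\<close> is the normal on the face \<open>f\<close>, so that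
  it may have different values from the different faces at an edge.
\<close>

definition outward_unit_normal ::
  "(real^'d::finite) set \<Rightarrow> (real^'d) set set \<Rightarrow> ((real^'d) set \<Rightarrow> real^'d \<Rightarrow> real^'d) \<Rightarrow> bool" where
  "outward_unit_normal \<Omega> \<F> n \<longleftrightarrow>
     (\<forall>f\<in>\<F>. n f \<in> borel_measurable borel \<and> (\<forall>x\<in>f. norm (n f x) = 1)) \<and>
     (\<forall>\<psi> :: real^'d \<Rightarrow> real^'d. Ck_on 1 UNIV \<psi> \<and> (\<exists>K. compact K \<and> (\<forall>x. x \<notin> K \<longrightarrow> \<psi> x = 0)) \<longrightarrow>
        (LINT x:\<Omega>|lborel. divergence \<psi> x) = (\<Sum>f\<in>\<F>. LINT x:f|surface_measure. \<psi> x \<bullet> n f x))"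

text \<open>Elements are closed cells.\<close>

definition mesh_element ::
  "(real^'d::finite) set \<Rightarrow> (real^'d) set set \<Rightarrow> ((real^'d) set \<Rightarrow> real^'d \<Rightarrow> real^'d) \<Rightarrow> bool" where
  "mesh_element \<Omega> \<F> n \<longleftrightarrow>
     compact \<Omega> \<and> \<Omega> \<noteq> {} \<and> closure (interior \<Omega>) = \<Omega> \<and>
     finite \<F> \<and> \<Union>\<F> = frontier \<Omega> \<and> (\<forall>f\<in>\<F>. compact f \<and> f \<noteq> {}) \<and>
     (\<forall>f\<in>\<F>. \<forall>f'\<in>\<F>. f \<noteq> f' \<longrightarrow> emeasure surface_measure (f \<inter> f') = 0) \<and>
     emeasure surface_measure (frontier \<Omega>) < \<infinity> \<and>
     outward_unit_normal \<Omega> \<F> n"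

text \<open>
  Every face is either shared with another element or lies on the boundary of the meshed region.
  Hanging nodes are admitted, since a geometric side may be listed as several faces.
\<close>

definition is_mesh ::
  "(real^'d::finite) set set \<Rightarrow> ((real^'d) set \<Rightarrow> (real^'d) set set)
     \<Rightarrow> ((real^'d) set \<Rightarrow> (real^'d) set \<Rightarrow> real^'d \<Rightarrow> real^'d) \<Rightarrow> bool" where
  "is_mesh \<T> faces n \<longleftrightarrow>
     (\<forall>\<Omega>\<in>\<T>. mesh_element \<Omega> (faces \<Omega>) (n \<Omega>)) \<and>
     (\<forall>\<Omega>\<in>\<T>. \<forall>\<Omega>'\<in>\<T>. \<Omega> \<noteq> \<Omega>' \<longrightarrow> interior \<Omega> \<inter> interior \<Omega>' = {}) \<and>
     (\<forall>\<Omega>\<in>\<T>. \<forall>f\<in>faces \<Omega>. f \<subseteq> frontier (\<Union>\<T>) \<or> (\<exists>\<Omega>'\<in>\<T>. \<Omega>' \<noteq> \<Omega> \<and> f \<in> faces \<Omega>')) \<and>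
     (\<forall>\<Omega>\<in>\<T>. \<forall>\<Omega>'\<in>\<T>. \<Omega> \<noteq> \<Omega>' \<longrightarrow>
        (\<forall>f\<in>faces \<Omega> \<inter> faces \<Omega>'. \<forall>x\<in>f. n \<Omega>' f x = - n \<Omega> f x))"


section \<open>The system of conservation laws and its energy\<close>

definition flux_jacobian :: "('d \<Rightarrow> real^'m::finite \<Rightarrow> real^'m) \<Rightarrow> 'd \<Rightarrow> real^'m \<Rightarrow> real^'m^'m" where
  "flux_jacobian F k u = jacobian (F k) (at u)"

definition energy_matrix :: "(real^'m::finite \<Rightarrow> real) \<Rightarrow> real^'m \<Rightarrow> real^'m^'m" where
  "energy_matrix e u = (2 * e u / (u \<bullet> (hessian e u *v u))) *\<^sub>R hessian e u"

text \<open>The solution of \<open>G\<^sub>k = H (A\<^sub>k + \<Delta>A\<^sub>k)\<close>.\<close>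

definition delta_jacobian ::
  "('d \<Rightarrow> real^'m::finite \<Rightarrow> real^'m) \<Rightarrow> (real^'m \<Rightarrow> real) \<Rightarrow> ('d \<Rightarrow> real^'m \<Rightarrow> real^'m^'m)
     \<Rightarrow> 'd \<Rightarrow> real^'m \<Rightarrow> real^'m^'m" where
  "delta_jacobian F e G k u = matrix_inv (energy_matrix e u) ** G k u - flux_jacobian F k u"

definition spd :: "real^'m^'m::finite \<Rightarrow> bool" where
  "spd S \<longleftrightarrow> transpose S = S \<and> (\<forall>v. v \<noteq> 0 \<longrightarrow> 0 < v \<bullet> (S *v v))"

text \<open>
  The eigenvalue bound with \<open>0 < c\<^sub>H\<close> forces \<open>0 \<notin> \<U>\<close>, because \<open>energy_matrix e 0 = 0\<close> by the
  convention \<open>x / 0 = 0\<close>.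
\<close>

definition energy_system ::
  "(real^'m::finite) set \<Rightarrow> ('d::finite \<Rightarrow> real^'m \<Rightarrow> real^'m) \<Rightarrow> (real^'m \<Rightarrow> real)
     \<Rightarrow> ('d \<Rightarrow> real^'m \<Rightarrow> real) \<Rightarrow> ('d \<Rightarrow> real^'m \<Rightarrow> real^'m^'m) \<Rightarrow> real \<Rightarrow> real \<Rightarrow> bool" where
  "energy_system \<U> F e g G c\<^sub>H C\<^sub>H \<longleftrightarrow>
     (\<forall>k. smooth_near \<U> (F k)) \<and> smooth_near \<U> e \<and> (\<forall>k. smooth_near \<U> (g k)) \<and>
     (\<forall>k. \<forall>u\<in>\<U>. gradient e u v* flux_jacobian F k u = gradient (g k) u) \<and>
     (\<forall>u\<in>\<U>. 0 < e u \<and> spd (hessian e u)) \<and>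
     (\<forall>k. smooth_near \<U> (G k)) \<and>
     (\<forall>k. \<forall>u\<in>\<U>. transpose (G k u) = G k u \<and> g k u = 1/2 * (u \<bullet> (G k u *v u))) \<and>
     0 < c\<^sub>H \<and> c\<^sub>H \<le> C\<^sub>H \<and>
     (\<forall>u\<in>\<U>. \<forall>\<mu> v. v \<noteq> 0 \<and> energy_matrix e u *v v = \<mu> *\<^sub>R v \<longrightarrow> c\<^sub>H \<le> \<mu> \<and> \<mu> \<le> C\<^sub>H)"

text \<open>\<open>u\<close> is given as \<open>u t x\<close>, for \<open>t\<close> in the time interval \<open>I\<close> and \<open>x\<close> in the closed cell \<open>\<Omega>\<close>.\<close>

definition smooth_solution ::
  "(real^'m::finite) set \<Rightarrow> ('d::finite \<Rightarrow> real^'m \<Rightarrow> real^'m) \<Rightarrow> real set \<Rightarrow> (real^'d) set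
     \<Rightarrow> (real \<Rightarrow> real^'d \<Rightarrow> real^'m) \<Rightarrow> bool" where
  "smooth_solution \<U> F I \<Omega> u \<longleftrightarrow>
     smooth_near (I \<times> \<Omega>) (\<lambda>(t, x). u t x) \<and>
     (\<forall>t\<in>I. \<forall>x\<in>\<Omega>. u t x \<in> \<U>) \<and>
     (\<forall>t\<in>I. \<forall>x\<in>interior \<Omega>.
        vector_derivative (\<lambda>s. u s x) (at t)
          + (\<Sum>k\<in>UNIV. flux_jacobian F k (u t x) *v partial k (u t) x) = 0)"


section \<open>Modal expansions\<close>

definition modal_basis :: "(real^'d::finite) set \<Rightarrow> (nat \<Rightarrow> real^'d \<Rightarrow> real) \<Rightarrow> bool" where
  "modal_basis \<Omega> \<phi> \<longleftrightarrow>
     (\<forall>\<alpha>. real_polynomial_function (\<phi> \<alpha>)) \<and>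
     (\<forall>\<alpha> \<beta>. (LINT x:\<Omega>|lborel. \<phi> \<alpha> x * \<phi> \<beta> x) = (if \<alpha> = \<beta> then 1 else 0)) \<and>
     (\<forall>p. real_polynomial_function p \<longrightarrow> (\<exists>c N. \<forall>x. p x = (\<Sum>\<alpha><N. c \<alpha> * \<phi> \<alpha> x)))"

definition basis_block :: "(nat \<Rightarrow> real^'d \<Rightarrow> real) \<Rightarrow> nat \<Rightarrow> real^'d \<Rightarrow> real^'m^'m::finite" where
  "basis_block \<phi> \<alpha> x = mat (\<phi> \<alpha> x)"

text \<open>
  Unconditional convergence of a series of vector fields in \<open>L\<^sup>2(S)\<close>. This is the sense in which
  modal series represent fields and may be rearranged and integrated termwise against bounded weights.
\<close>

definition l2_has_sum ::
  "'a measure \<Rightarrow> 'a set \<Rightarrow> (nat \<Rightarrow> 'a \<Rightarrow> 'b::real_normed_vector) \<Rightarrow> ('a \<Rightarrow> 'b) \<Rightarrow> bool" where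
  "l2_has_sum M S s v \<longleftrightarrow>
     ((\<lambda>J. \<integral>\<^sup>+x\<in>S. ennreal ((norm (v x - (\<Sum>\<alpha>\<in>J. s \<alpha> x)))\<^sup>2) \<partial>M) \<longlongrightarrow> 0)
       (finite_subsets_at_top UNIV)"


section \<open>Infinite block matrices\<close>

type_synonym 'm state = "real^'m"
type_synonym 'm state_matrix = "real^'m^'m"
type_synonym 'm block_matrix = "nat \<Rightarrow> nat \<Rightarrow> real^'m^'m"

definition bmat_mult :: "'m::finite block_matrix \<Rightarrow> 'm block_matrix \<Rightarrow> 'm block_matrix" where
  "bmat_mult A B \<alpha> \<beta> = (\<Sum>\<^sub>\<infinity>\<gamma>. A \<alpha> \<gamma> ** B \<gamma> \<beta>)"

definition bmat_transpose :: "'m::finite block_matrix \<Rightarrow> 'm block_matrix" where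
  "bmat_transpose A \<alpha> \<beta> = transpose (A \<beta> \<alpha>)"

definition bmat_one :: "'m::finite block_matrix" where
  "bmat_one \<alpha> \<beta> = (if \<alpha> = \<beta> then mat 1 else 0)"

text \<open>Upper triangular as a scalar matrix, for the lexicographic order of the indices \<open>(\<alpha>, i)\<close>.\<close>

definition upper_triangular_bmat :: "'m::{finite,linorder} block_matrix \<Rightarrow> bool" where
  "upper_triangular_bmat A \<longleftrightarrow>
     (\<forall>\<alpha> \<beta>. \<beta> < \<alpha> \<longrightarrow> A \<alpha> \<beta> = 0) \<and> (\<forall>\<alpha> i j. j < i \<longrightarrow> A \<alpha> \<alpha> $ i $ j = 0)"

definition cholesky_factor :: "'m::{finite,linorder} block_matrix \<Rightarrow> 'm block_matrix \<Rightarrow> bool" where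
  "cholesky_factor M R \<longleftrightarrow>
     upper_triangular_bmat R \<and> (\<forall>\<alpha> i. 0 < R \<alpha> \<alpha> $ i $ i) \<and> M = bmat_mult (bmat_transpose R) R"

text \<open>Among infinite matrices, only the upper triangular inverse is unique.\<close>

definition bmat_inverse :: "'m::{finite,linorder} block_matrix \<Rightarrow> 'm block_matrix" where
  "bmat_inverse R =
     (THE T. upper_triangular_bmat T \<and> bmat_mult R T = bmat_one \<and> bmat_mult T R = bmat_one)"


section \<open>The Galerkin system and its orthogonalized form\<close>

text \<open>In this section \<open>v\<close> is the state on one element at one time.\<close>

definition mass_matrix ::
  "(real^'m::finite \<Rightarrow> real) \<Rightarrow> (real^'d::finite) set \<Rightarrow> (nat \<Rightarrow> real^'d \<Rightarrow> real)
     \<Rightarrow> (real^'d \<Rightarrow> real^'m) \<Rightarrow> 'm block_matrix" where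
  "mass_matrix e \<Omega> \<phi> v \<alpha> \<beta> =
     (LINT x:\<Omega>|lborel. transpose (basis_block \<phi> \<alpha> x) ** energy_matrix e (v x) ** basis_block \<phi> \<beta> x)"

definition convection_matrix ::
  "('d::finite \<Rightarrow> real^'m::finite \<Rightarrow> real^'m) \<Rightarrow> (real^'m \<Rightarrow> real) \<Rightarrow> (real^'d) set
     \<Rightarrow> (nat \<Rightarrow> real^'d \<Rightarrow> real) \<Rightarrow> (real^'d \<Rightarrow> real^'m) \<Rightarrow> 'm block_matrix" where
  "convection_matrix F e \<Omega> \<phi> v \<alpha> \<beta> =
     (LINT x:\<Omega>|lborel. \<Sum>k\<in>UNIV. transpose (basis_block \<phi> \<alpha> x) ** energy_matrix e (v x)
        ** flux_jacobian F k (v x) ** partial k (basis_block \<phi> \<beta>) x)"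

definition galerkin_system ::
  "('d::finite \<Rightarrow> real^'m::finite \<Rightarrow> real^'m) \<Rightarrow> (real^'m \<Rightarrow> real) \<Rightarrow> real set \<Rightarrow> (real^'d) set
     \<Rightarrow> (nat \<Rightarrow> real^'d \<Rightarrow> real) \<Rightarrow> (real \<Rightarrow> real^'d \<Rightarrow> real^'m) \<Rightarrow> (real \<Rightarrow> nat \<Rightarrow> real^'m) \<Rightarrow> bool" where
  "galerkin_system F e I \<Omega> \<phi> u U \<longleftrightarrow>
     (\<forall>t\<in>I. (\<forall>\<beta>. (\<lambda>s. U s \<beta>) differentiable (at t)) \<and>
       (\<forall>\<alpha>. let mass = (\<lambda>\<beta>. mass_matrix e \<Omega> \<phi> (u t) \<alpha> \<beta> *v vector_derivative (\<lambda>s. U s \<beta>) (at t));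
                conv = (\<lambda>\<beta>. convection_matrix F e \<Omega> \<phi> (u t) \<alpha> \<beta> *v U t \<beta>)
            in mass summable_on UNIV \<and> conv summable_on UNIV \<and>
               (\<Sum>\<^sub>\<infinity>\<beta>. mass \<beta>) + (\<Sum>\<^sub>\<infinity>\<beta>. conv \<beta>) = 0))"

text \<open>\<open>U\<^sup>(\<^sup>o\<^sup>) = R U\<close> and \<open>\<Phi>\<^sup>(\<^sup>o\<^sup>) = \<Phi> R\<^sup>-\<^sup>1\<close>.\<close>

definition orth_coeff :: "'m::finite block_matrix \<Rightarrow> (nat \<Rightarrow> real^'m) \<Rightarrow> nat \<Rightarrow> real^'m" where
  "orth_coeff R U \<alpha> = (\<Sum>\<^sub>\<infinity>\<beta>. R \<alpha> \<beta> *v U \<beta>)"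

definition orth_basis ::
  "(nat \<Rightarrow> real^'d::finite \<Rightarrow> real) \<Rightarrow> 'm::{finite,linorder} block_matrix \<Rightarrow> nat \<Rightarrow> real^'d \<Rightarrow> 'm state_matrix" where
  "orth_basis \<phi> R \<alpha> x = (\<Sum>\<^sub>\<infinity>\<beta>. basis_block \<phi> \<beta> x ** bmat_inverse R \<beta> \<alpha>)"

definition orth_mode ::
  "(nat \<Rightarrow> real^'d::finite \<Rightarrow> real) \<Rightarrow> 'm::{finite,linorder} block_matrix \<Rightarrow> (nat \<Rightarrow> 'm state)
     \<Rightarrow> nat \<Rightarrow> real^'d \<Rightarrow> 'm state" where
  "orth_mode \<phi> R U \<alpha> x = orth_basis \<phi> R \<alpha> x *v orth_coeff R U \<alpha>"

definition modal_energy :: "'m::finite block_matrix \<Rightarrow> (nat \<Rightarrow> real^'m) \<Rightarrow> nat \<Rightarrow> real" where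
  "modal_energy R U \<alpha> = 1/2 * (norm (orth_coeff R U \<alpha>))\<^sup>2"


section \<open>Face terms\<close>

text \<open>Below, \<open>\<nu>\<close> is the outward unit normal on the face \<open>f\<close>.\<close>

definition face_matrix ::
  "('d::finite \<Rightarrow> 'm::{finite,linorder} state \<Rightarrow> 'm state) \<Rightarrow> ('m state \<Rightarrow> real)
     \<Rightarrow> ('d \<Rightarrow> 'm state \<Rightarrow> 'm state_matrix) \<Rightarrow> (real^'d) set \<Rightarrow> (real^'d \<Rightarrow> real^'d)
     \<Rightarrow> (nat \<Rightarrow> real^'d \<Rightarrow> real) \<Rightarrow> 'm block_matrix \<Rightarrow> (real^'d \<Rightarrow> 'm state) \<Rightarrow> 'm block_matrix" where
  "face_matrix F e G f \<nu> \<phi> R v \<alpha> \<beta> =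
     (LINT x:f|surface_measure. \<Sum>k\<in>UNIV. (\<nu> x $ k) *\<^sub>R
        (transpose (orth_basis \<phi> R \<alpha> x) ** energy_matrix e (v x)
           ** (flux_jacobian F k (v x) + delta_jacobian F e G k (v x)) ** orth_basis \<phi> R \<beta> x))"

definition face_power ::
  "('d::finite \<Rightarrow> 'm::{finite,linorder} state \<Rightarrow> 'm state) \<Rightarrow> ('m state \<Rightarrow> real)
     \<Rightarrow> ('d \<Rightarrow> 'm state \<Rightarrow> 'm state_matrix) \<Rightarrow> (real^'d) set \<Rightarrow> (real^'d \<Rightarrow> real^'d)
     \<Rightarrow> (nat \<Rightarrow> real^'d \<Rightarrow> real) \<Rightarrow> 'm block_matrix \<Rightarrow> (nat \<Rightarrow> 'm state) \<Rightarrow> (real^'d \<Rightarrow> 'm state)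
     \<Rightarrow> nat \<Rightarrow> real" where
  "face_power F e G f \<nu> \<phi> R U v \<alpha> =
     - (1/2) * (\<Sum>\<^sub>\<infinity>\<beta>. orth_coeff R U \<alpha> \<bullet> (face_matrix F e G f \<nu> \<phi> R v \<alpha> \<beta> *v orth_coeff R U \<beta>))"

definition normal_flux_matrix ::
  "('d::finite \<Rightarrow> real^'m::finite \<Rightarrow> real^'m^'m) \<Rightarrow> real^'d \<Rightarrow> real^'m \<Rightarrow> real^'m^'m" where
  "normal_flux_matrix G \<nu> u = (\<Sum>k\<in>UNIV. (\<nu> $ k) *\<^sub>R G k u)"

text \<open>Power transferred through \<open>f\<close> between a mode \<open>w\<close> of the viewing element and a mode \<open>w'\<close> of its neighbour.\<close>

definition pair_power ::
  "('d::finite \<Rightarrow> real^'m::finite \<Rightarrow> real^'m^'m) \<Rightarrow> (real^'d) set \<Rightarrow> (real^'d \<Rightarrow> real^'d)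
     \<Rightarrow> (real^'d \<Rightarrow> real^'m) \<Rightarrow> (real^'d \<Rightarrow> real^'m) \<Rightarrow> (real^'d \<Rightarrow> real^'m) \<Rightarrow> real" where
  "pair_power G f \<nu> v w w' =
     - (1/2) * (LINT x:f|surface_measure. w x \<bullet> (normal_flux_matrix G (\<nu> x) (v x) *v w' x))"

end

theory Submission
  imports Defs
begin

text \<open>
  Write \<open>w\<^sub>\<alpha> = \<Phi>\<^sup>(\<^sup>o\<^sup>)\<^sub>\<alpha> U\<^sup>(\<^sup>o\<^sup>)\<^sub>\<alpha>\<close> for the orthogonalized modes of an element. The proof identifies every
  infinite modal sum with an integral of the state \<open>u\<close> itself; for these integrals the claims are classical.

  On a face, \<open>G\<^sub>k = H (A\<^sub>k + \<Delta>A\<^sub>k)\<close> turns each term of \<open>B\<^sub>\<alpha>\<close> into \<open>-1/2 \<integral> w\<^sub>\<alpha> \<bullet> G\<^sub>n w\<^sub>\<beta>\<close>. The modal series converges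
  in \<open>L\<^sup>2\<close> of the face and the weights are bounded, so it may be summed under the integral, and
  \<open>B\<^sub>\<alpha> = -1/2 \<integral> w\<^sub>\<alpha> \<bullet> G\<^sub>n u\<close> (\<open>face_power_eq_pair_power\<close>). Only the single-valued trace of \<open>u\<close> is left in the
  second argument. It may be expanded in the modes of the neighbour instead, which gives \<open>B\<^sub>\<alpha> = \<Sum>\<^sub>\<gamma> P\<^sub>\<alpha>\<^sub>\<gamma>\<close>
  (\<open>pair_power_has_sum\<close>). Exchanging the elements reverses the normal, and \<open>G\<close> is symmetric, so \<open>P\<close> is
  antisymmetric (\<open>pair_power_antisymmetric\<close>). Summation over \<open>\<alpha>\<close> gives
  \<open>\<Sum>\<^sub>\<alpha> B\<^sub>\<alpha> = -1/2 \<integral> u \<bullet> G\<^sub>n u = - \<integral> g\<^sub>k n\<^sub>k\<close>, with opposite signs on the two sides of an interface.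

  In an element, the Cholesky factorization makes the modes \<open>\<Phi>\<^sup>(\<^sup>o\<^sup>)\<close> orthonormal for the inner product
  \<open>\<integral> v\<^sup>T H w\<close>, and \<open>U\<^sup>(\<^sup>o\<^sup>)\<close> consists of the coefficients of \<open>u\<close> in this basis. Parseval's identity (\<open>parseval\<close>) yields
  \<open>\<Sum>\<^sub>\<alpha> E\<^sub>\<alpha> = 1/2 \<integral> u \<bullet> H u = \<integral> e(u)\<close>. Both facts need the inverse of an infinite Cholesky factor, which exists
  uniquely among the upper triangular block matrices (\<open>bmat_inverse_cholesky\<close>).

  Multiplying the system by \<open>\<nabla>e\<close> gives the conservation law \<open>\<partial>\<^sub>t e(u) + \<partial>\<^sub>k g\<^sub>k(u) = 0\<close>, and the Gauss-Green formula gives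
  \<open>d/dt \<integral> e(u) = - \<Sum>\<^sub>f \<integral> g\<^sub>k n\<^sub>k = \<Sum>\<^sub>f \<Sum>\<^sub>\<alpha> B\<^sub>\<alpha>\<close> in each element (\<open>element_energy_balance\<close>). In the sum over a union
  of elements, every face off the boundary of the union belongs to exactly two of its elements and cancels
  (\<open>sum_boundary_faces\<close>).
\<close>

section \<open>Bounded measurable fields and termwise integration\<close>

text \<open>This class of fields is closed under all the products and sums that occur in the matrix entries, and
  over a finite measure it consists of integrable functions.\<close>

definition bdd_measurable :: "'a measure \<Rightarrow> ('a \<Rightarrow> 'b::euclidean_space) \<Rightarrow> bool" where
  "bdd_measurable N f \<longleftrightarrow> f \<in> borel_measurable N \<and> (\<exists>K. \<forall>x\<in>space N. norm (f x) \<le> K)"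

lemma bdd_measurable_integrable:
  assumes "finite_measure N" "bdd_measurable N f"
  shows "integrable N f"
proof -
  obtain K where "\<forall>x\<in>space N. norm (f x) \<le> K" and m: "f \<in> borel_measurable N"
    using assms unfolding bdd_measurable_def by blast
  then show ?thesis
    by (intro finite_measure.integrable_const_bound[OF assms(1) AE_I2, of _ K]) auto
qed

lemma bdd_measurable_bounded_linear:
  assumes "bounded_linear L" "bdd_measurable N f"
  shows "bdd_measurable N (\<lambda>x. L (f x))"
proof -
  obtain K where K: "\<And>x. x \<in> space N \<Longrightarrow> norm (f x) \<le> K"
    using assms(2) unfolding bdd_measurable_def by blast
  obtain C where C: "\<And>y. norm (L y) \<le> norm y * C" "C > 0"
    using bounded_linear.pos_bounded[OF assms(1)] by blast
  have "norm (L (f x)) \<le> K * C" if "x \<in> space N" for x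
    using C(1)[of "f x"] mult_right_mono[OF K[OF that], of C] C(2) by linarith
  moreover have "(\<lambda>x. L (f x)) \<in> borel_measurable N"
    using assms by (intro borel_measurable_continuous_on[of L])
      (auto simp: bdd_measurable_def intro: linear_continuous_on)
  ultimately show ?thesis unfolding bdd_measurable_def by blast
qed

lemma bdd_measurable_bilinear:
  fixes mul :: "'b::euclidean_space \<Rightarrow> 'c::euclidean_space \<Rightarrow> 'e::euclidean_space"
  assumes "bounded_bilinear mul" "bdd_measurable N f" "bdd_measurable N g"
  shows "bdd_measurable N (\<lambda>x. mul (f x) (g x))"
proof -
  obtain K L where K: "\<And>x. x \<in> space N \<Longrightarrow> norm (f x) \<le> K" and L: "\<And>x. x \<in> space N \<Longrightarrow> norm (g x) \<le> L"
    using assms(2,3) unfolding bdd_measurable_def by blast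
  obtain C where C: "C > 0" "\<And>a b. norm (mul a b) \<le> norm a * norm b * C"
    using bounded_bilinear.pos_bounded[OF assms(1)] by blast
  have "norm (mul (f x) (g x)) \<le> K * L * C" if x: "x \<in> space N" for x
  proof -
    have "norm (f x) * norm (g x) \<le> K * L"
      using K[OF x] L[OF x] by (intro mult_mono) (auto intro: order_trans[OF norm_ge_zero])
    then show ?thesis using C(2)[of "f x" "g x"] C(1)
      by (intro order_trans[OF C(2)] mult_right_mono) auto
  qed
  moreover have "(\<lambda>x. mul (f x) (g x)) \<in> borel_measurable N"
  proof (rule borel_measurable_continuous_Pair[where H = mul])
    show "f \<in> borel_measurable N" "g \<in> borel_measurable N"
      using assms(2,3) unfolding bdd_measurable_def by auto
    show "continuous_on UNIV (\<lambda>x. mul (fst x) (snd x))"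
      by (intro bounded_bilinear.continuous_on[OF assms(1)] continuous_on_fst continuous_on_snd continuous_on_id)
  qed
  ultimately show ?thesis unfolding bdd_measurable_def by blast
qed

lemma bdd_measurable_add:
  assumes "bdd_measurable N f" "bdd_measurable N g"
  shows "bdd_measurable N (\<lambda>x. f x + g x)"
proof -
  obtain K L where "\<And>x. x \<in> space N \<Longrightarrow> norm (f x) \<le> K" "\<And>x. x \<in> space N \<Longrightarrow> norm (g x) \<le> L"
    using assms unfolding bdd_measurable_def by blast
  then have "\<forall>x\<in>space N. norm (f x + g x) \<le> K + L"
    by (auto intro!: order_trans[OF norm_triangle_ineq] add_mono)
  then show ?thesis using assms unfolding bdd_measurable_def by auto
qed

lemma bdd_measurable_zero: "bdd_measurable N (\<lambda>x. 0)"
  unfolding bdd_measurable_def by auto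

lemma bdd_measurable_sum:
  assumes "\<And>i. i \<in> J \<Longrightarrow> bdd_measurable N (f i)"
  shows "bdd_measurable N (\<lambda>x. \<Sum>i\<in>J. f i x)"
  using assms
  by (induction J rule: infinite_finite_induct)
     (auto intro: bdd_measurable_zero bdd_measurable_add)

lemma bdd_measurable_diff:
  assumes "bdd_measurable N f" "bdd_measurable N g"
  shows "bdd_measurable N (\<lambda>x. f x - g x)"
  using bdd_measurable_add[OF assms(1) bdd_measurable_bounded_linear[OF bounded_linear_minus[OF bounded_linear_ident] assms(2)]]
  by simp

lemma bdd_measurable_continuous:
  fixes f :: "'a::euclidean_space \<Rightarrow> 'b::euclidean_space"
  assumes "compact S" "sets M = sets borel" "continuous_on S f"
  shows "bdd_measurable (restrict_space M S) f"
proof -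
  have "space M = UNIV" using sets_eq_imp_space_eq[OF assms(2)] by simp
  moreover have "\<exists>K. \<forall>x\<in>S. norm (f x) \<le> K"
    using compact_imp_bounded[OF compact_continuous_image[OF assms(3,1)]] by (auto simp: bounded_iff)
  moreover have "f \<in> borel_measurable (restrict_space M S)"
    using borel_measurable_continuous_on_restrict[OF assms(3)]
    by (subst measurable_cong_sets[OF sets_restrict_space_cong[OF assms(2)] refl])
  ultimately show ?thesis by (auto simp: bdd_measurable_def space_restrict_space)
qed

lemma finite_measure_restrict_compact:
  fixes M :: "'a::euclidean_space measure"
  assumes "sets M = sets borel" "compact S" "emeasure M S < \<infinity>"
  shows "finite_measure (restrict_space M S)"
proof (rule finite_measureI)
  have "S \<in> sets M" using assms by (simp add: borel_compact)
  then show "emeasure (restrict_space M S) (space (restrict_space M S)) \<noteq> \<infinity>"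
    using assms(3) by (simp add: space_restrict_space2 emeasure_restrict_space)
qed

lemma set_integral_eq_restrict:
  fixes f :: "'a::euclidean_space \<Rightarrow> 'b::euclidean_space"
  assumes "sets M = sets borel" "compact S"
  shows "(LINT x:S|M. f x) = integral\<^sup>L (restrict_space M S) f"
  unfolding set_lebesgue_integral_def using assms
  by (subst integral_restrict_space) (auto simp: borel_compact sets_eq_imp_space_eq[OF assms(1)])

text \<open>For bounded fields on a set of finite measure the square errors are integrable, so the extended
  integrals of \<^const>\<open>l2_has_sum\<close> are real ones, to which linearity and monotonicity of the integral apply.\<close>

lemma l2_has_sum_iff_restrict:
  fixes s :: "nat \<Rightarrow> 'a::euclidean_space \<Rightarrow> 'b::euclidean_space"
  assumes M: "sets M = sets borel" "compact S" "emeasure M S < \<infinity>"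
    and "bdd_measurable (restrict_space M S) v" "\<And>\<alpha>. bdd_measurable (restrict_space M S) (s \<alpha>)"
  shows "l2_has_sum M S s v \<longleftrightarrow>
    ((\<lambda>J. LINT x|restrict_space M S. (norm (v x - (\<Sum>\<alpha>\<in>J. s \<alpha> x)))\<^sup>2) \<longlongrightarrow> 0) (finite_subsets_at_top UNIV)"
proof -
  let ?N = "restrict_space M S"
  have fin: "finite_measure ?N" by (rule finite_measure_restrict_compact[OF M])
  have *: "(\<integral>\<^sup>+x\<in>S. ennreal ((norm (v x - (\<Sum>\<alpha>\<in>J. s \<alpha> x)))\<^sup>2) \<partial>M)
      = ennreal (LINT x|?N. (norm (v x - (\<Sum>\<alpha>\<in>J. s \<alpha> x)))\<^sup>2)" for J
  proof -
    have b: "bdd_measurable ?N (\<lambda>x. v x - (\<Sum>\<alpha>\<in>J. s \<alpha> x))"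
      using assms by (intro bdd_measurable_diff bdd_measurable_sum) auto
    have "integrable ?N (\<lambda>x. (norm (v x - (\<Sum>\<alpha>\<in>J. s \<alpha> x)))\<^sup>2)"
      using bdd_measurable_integrable[OF fin bdd_measurable_bilinear[OF bounded_bilinear_inner b b]]
      by (simp add: power2_norm_eq_inner)
    then have "(\<integral>\<^sup>+x. ennreal ((norm (v x - (\<Sum>\<alpha>\<in>J. s \<alpha> x)))\<^sup>2) \<partial>?N)
      = ennreal (LINT x|?N. (norm (v x - (\<Sum>\<alpha>\<in>J. s \<alpha> x)))\<^sup>2)"
      by (intro nn_integral_eq_integral) auto
    then show ?thesis using M
      by (subst (asm) nn_integral_restrict_space) (auto simp: borel_compact sets_eq_imp_space_eq[OF M(1)])
  qed
  have nn: "0 \<le> (LINT x|?N. (norm (v x - (\<Sum>\<alpha>\<in>J. s \<alpha> x)))\<^sup>2)" for J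
    by (intro integral_nonneg_AE) auto
  show ?thesis unfolding l2_has_sum_def *
    using tendsto_ennreal_iff[of "\<lambda>J. LINT x|?N. (norm (v x - (\<Sum>\<alpha>\<in>J. s \<alpha> x)))\<^sup>2" "finite_subsets_at_top UNIV" 0] nn
    by (simp add: always_eventually)
qed

text \<open>A weight bounded by \<open>L\<close> turns an error \<open>r\<close> into at most \<open>L |r| \<le> L (\<delta> + |r|\<^sup>2 / (4 \<delta>))\<close> for every \<open>\<delta> > 0\<close>,
  so on a set of finite measure convergence in \<open>L\<^sup>2\<close> suffices to integrate a modal series termwise. The product is an
  arbitrary bilinear map, because the weights are vectors on the faces and matrices in the cells.\<close>

lemma l2_has_sum_integral:
  fixes s :: "nat \<Rightarrow> 'a::euclidean_space \<Rightarrow> 'b::euclidean_space"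
    and mul :: "'c::euclidean_space \<Rightarrow> 'b \<Rightarrow> 'e::euclidean_space"
  assumes M: "sets M = sets borel" "compact S" "emeasure M S < \<infinity>"
    and bb: "bounded_bilinear mul"
    and c: "bdd_measurable (restrict_space M S) c"
    and v: "bdd_measurable (restrict_space M S) v"
    and s: "\<And>\<alpha>. bdd_measurable (restrict_space M S) (s \<alpha>)"
    and l2: "l2_has_sum M S s v"
  shows "((\<lambda>\<alpha>. LINT x|restrict_space M S. mul (c x) (s \<alpha> x)) has_sum
          (LINT x|restrict_space M S. mul (c x) (v x))) UNIV"
proof -
  let ?N = "restrict_space M S"
  interpret bounded_bilinear mul by (rule bb)
  have fin: "finite_measure ?N" by (rule finite_measure_restrict_compact[OF M])
  obtain K where K: "\<And>x. x \<in> space ?N \<Longrightarrow> norm (c x) \<le> K"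
    using c unfolding bdd_measurable_def by blast
  obtain C where C: "C > 0" "\<And>a b. norm (mul a b) \<le> norm a * norm b * C"
    using pos_bounded by blast
  define L where "L = (\<bar>K\<bar> + 1) * C"
  have L: "L > 0" using C by (auto simp: L_def)
  have Lb: "norm (mul (c x) y) \<le> L * norm y" if "x \<in> space ?N" for x y
  proof -
    have "norm (c x) * (norm y * C) \<le> (\<bar>K\<bar> + 1) * (norm y * C)"
      using K[OF that] C by (intro mult_right_mono) auto
    then show ?thesis using C(2)[of "c x" y] by (simp add: L_def algebra_simps)
  qed
  define A where "A J = (LINT x|?N. (norm (v x - (\<Sum>\<alpha>\<in>J. s \<alpha> x)))\<^sup>2)" for J
  have A0: "(A \<longlongrightarrow> 0) (finite_subsets_at_top UNIV)"
    using l2 unfolding l2_has_sum_iff_restrict[OF M v s] A_def .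
  note int = bdd_measurable_integrable[OF fin]
  have r: "bdd_measurable ?N (\<lambda>x. v x - (\<Sum>\<alpha>\<in>J. s \<alpha> x))" for J
    using v s by (intro bdd_measurable_diff bdd_measurable_sum) auto
  have diff: "(LINT x|?N. mul (c x) (v x)) - (\<Sum>\<alpha>\<in>J. LINT x|?N. mul (c x) (s \<alpha> x))
      = (LINT x|?N. mul (c x) (v x - (\<Sum>\<alpha>\<in>J. s \<alpha> x)))" for J
  proof -
    have "(LINT x|?N. mul (c x) (v x - (\<Sum>\<alpha>\<in>J. s \<alpha> x)))
        = (LINT x|?N. mul (c x) (v x) - (\<Sum>\<alpha>\<in>J. mul (c x) (s \<alpha> x)))"
      by (simp only: diff_right sum_right)
    also have "\<dots> = (LINT x|?N. mul (c x) (v x)) - (LINT x|?N. (\<Sum>\<alpha>\<in>J. mul (c x) (s \<alpha> x)))"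
      by (intro Bochner_Integration.integral_diff Bochner_Integration.integrable_sum int
          bdd_measurable_bilinear[OF bb c] v s)
    also have "(LINT x|?N. (\<Sum>\<alpha>\<in>J. mul (c x) (s \<alpha> x))) = (\<Sum>\<alpha>\<in>J. LINT x|?N. mul (c x) (s \<alpha> x))"
      by (intro Bochner_Integration.integral_sum int bdd_measurable_bilinear[OF bb c] s)
    finally show ?thesis by simp
  qed
  have bound: "norm ((LINT x|?N. mul (c x) (v x)) - (\<Sum>\<alpha>\<in>J. LINT x|?N. mul (c x) (s \<alpha> x)))
      \<le> L * \<delta> * measure ?N (space ?N) + L / (4 * \<delta>) * A J" if \<delta>: "\<delta> > 0" for J \<delta>
  proof -
    let ?r = "\<lambda>x. v x - (\<Sum>\<alpha>\<in>J. s \<alpha> x)"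
    have iq: "integrable ?N (\<lambda>x. (norm (?r x))\<^sup>2)"
      using int[OF bdd_measurable_bilinear[OF bounded_bilinear_inner r r]] by (simp add: power2_norm_eq_inner)
    have "norm (LINT x|?N. mul (c x) (?r x)) \<le> (LINT x|?N. L * \<delta> + L / (4 * \<delta>) * (norm (?r x))\<^sup>2)"
    proof (rule Bochner_Integration.integral_norm_bound_integral)
      show "integrable ?N (\<lambda>x. mul (c x) (?r x))" by (rule int[OF bdd_measurable_bilinear[OF bb c r]])
      show "integrable ?N (\<lambda>x. L * \<delta> + L / (4 * \<delta>) * (norm (?r x))\<^sup>2)"
        using fin iq by (simp add: finite_measure.integrable_const)
      fix x assume x: "x \<in> space ?N"
      \<comment> \<open>The arithmetic-geometric mean inequality behind \<open>|r| \<le> \<delta> + |r|\<^sup>2 / (4 \<delta>)\<close>.\<close>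
      have "0 \<le> (2 * \<delta> - norm (?r x))\<^sup>2" by simp
      then have "4 * \<delta> * norm (?r x) \<le> 4 * \<delta>\<^sup>2 + (norm (?r x))\<^sup>2"
        by (simp add: power2_eq_square algebra_simps)
      then have "norm (?r x) \<le> \<delta> + (norm (?r x))\<^sup>2 / (4 * \<delta>)"
        using \<delta> by (simp add: field_simps power2_eq_square)
      then have "L * norm (?r x) \<le> L * (\<delta> + (norm (?r x))\<^sup>2 / (4 * \<delta>))"
        using L by (intro mult_left_mono) auto
      then show "norm (mul (c x) (?r x)) \<le> L * \<delta> + L / (4 * \<delta>) * (norm (?r x))\<^sup>2"
        using Lb[OF x, of "?r x"] by (simp add: algebra_simps)
    qed
    also have "\<dots> = L * \<delta> * measure ?N (space ?N) + L / (4 * \<delta>) * A J"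
      using fin iq unfolding A_def
      by (subst Bochner_Integration.integral_add) (auto simp: finite_measure.integrable_const)
    finally show ?thesis unfolding diff .
  qed
  show ?thesis unfolding has_sum_def
  proof (rule tendstoI)
    fix \<epsilon> :: real assume \<epsilon>: "\<epsilon> > 0"
    define \<mu> where "\<mu> = measure ?N (space ?N)"
    have \<mu>: "\<mu> \<ge> 0" by (simp add: \<mu>_def)
    \<comment> \<open>With this \<open>\<delta>\<close> the first term of the bound is at most \<open>\<epsilon>/2\<close>; \<open>\<mu> + 1\<close> stands in for \<open>\<mu>\<close>, which may be 0.\<close>
    define \<delta> where "\<delta> = \<epsilon> / (2 * L * (\<mu> + 1))"
    have \<delta>: "\<delta> > 0" using \<epsilon> L \<mu> by (simp add: \<delta>_def)
    have "L * \<delta> = \<epsilon> / 2 / (\<mu> + 1)" using L by (simp add: \<delta>_def)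
    then have "L * \<delta> * \<mu> = \<epsilon> / 2 * (\<mu> / (\<mu> + 1))" by simp
    also have "\<dots> \<le> \<epsilon> / 2 * 1" using \<epsilon> \<mu> by (intro mult_left_mono) auto
    finally have d1: "L * \<delta> * \<mu> \<le> \<epsilon> / 2" by simp
    have "((\<lambda>J. L / (4 * \<delta>) * A J) \<longlongrightarrow> L / (4 * \<delta>) * 0) (finite_subsets_at_top UNIV)"
      by (intro tendsto_intros A0)
    then have "\<forall>\<^sub>F J in finite_subsets_at_top UNIV. L / (4 * \<delta>) * A J < \<epsilon> / 2"
      using \<epsilon> by (intro order_tendstoD(2)[where a = "\<epsilon>/2"]) auto
    then show "\<forall>\<^sub>F J in finite_subsets_at_top UNIV.
       dist (\<Sum>\<alpha>\<in>J. LINT x|?N. mul (c x) (s \<alpha> x)) (LINT x|?N. mul (c x) (v x)) < \<epsilon>"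
    proof (eventually_elim)
      case (elim J)
      then show ?case using bound[OF \<delta>, of J] d1 by (simp add: dist_norm norm_minus_commute \<mu>_def)
    qed
  qed
qed

section \<open>Inverses of upper triangular block matrices\<close>

lemma bounded_bilinear_matrix_matrix_mult:
  "bounded_bilinear ((**) :: real^'m::finite^'n::finite \<Rightarrow> real^'k::finite^'m \<Rightarrow> real^'k^'n)"
  unfolding bilinear_conv_bounded_bilinear[symmetric] bilinear_def linear_iff
  by (simp add: vec_eq_iff matrix_matrix_mult_def sum.distrib sum_distrib_left algebra_simps)

lemma bounded_bilinear_matrix_vector_mult:
  "bounded_bilinear ((*v) :: real^'m::finite^'n::finite \<Rightarrow> real^'m \<Rightarrow> real^'n)"
  unfolding bilinear_conv_bounded_bilinear[symmetric] bilinear_def linear_iff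
  by (simp add: vec_eq_iff matrix_vector_mult_def sum.distrib sum_distrib_left algebra_simps)

lemma bounded_linear_transpose: "bounded_linear (transpose :: real^'m::finite^'n::finite \<Rightarrow> real^'n^'m)"
  unfolding linear_conv_bounded_linear[symmetric] linear_iff
  by (simp add: vec_eq_iff transpose_def)

lemma transpose_sum: "transpose (\<Sum>i\<in>J. A i) = (\<Sum>i\<in>J. transpose (A i :: real^'k::finite^'l::finite))"
  by (rule linear_sum[OF bounded_linear.linear[OF bounded_linear_transpose]])

interpretation mm: bounded_bilinear "(**) :: real^'m::finite^'n::finite \<Rightarrow> real^'k::finite^'m \<Rightarrow> real^'k^'n"
  by (rule bounded_bilinear_matrix_matrix_mult)

interpretation mv: bounded_bilinear "(*v) :: real^'m::finite^'n::finite \<Rightarrow> real^'m \<Rightarrow> real^'n"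
  by (rule bounded_bilinear_matrix_vector_mult)

lemma upper_triangular_mult_top:
  fixes A :: "'m::{finite,linorder} state_matrix"
  assumes "\<And>i j. j < i \<Longrightarrow> A $ i $ j = 0" and "\<And>j. i < j \<Longrightarrow> x $ j = 0"
  shows "(A *v x) $ i = A $ i $ i * x $ i"
proof -
  have "(A *v x) $ i = (\<Sum>j\<in>UNIV. A $ i $ j * x $ j)" by (simp add: matrix_vector_mult_def)
  also have "\<dots> = (\<Sum>j\<in>{i}. A $ i $ j * x $ j)"
    using assms by (intro sum.mono_neutral_right) (auto, metis linorder_neqE)
  finally show ?thesis by simp
qed

text \<open>The last nonzero entry of \<open>x\<close> among the indices in \<open>P\<close> would be multiplied by a nonzero diagonal entry of \<open>A\<close>
  and survive in \<open>A x\<close>. With \<open>P\<close> always true this is injectivity of \<open>A\<close>; with \<open>P\<close> the indices below the diagonal it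
  shows that the columns of the inverse are triangular.\<close>

lemma upper_triangular_last_nonzero:
  fixes A :: "'m::{finite,linorder} state_matrix" and P :: "'m \<Rightarrow> bool"
  assumes A: "\<And>i j. j < i \<Longrightarrow> A $ i $ j = 0" "\<And>i. A $ i $ i \<noteq> 0"
    and P: "\<And>i j. P i \<Longrightarrow> i < j \<Longrightarrow> P j" and z: "\<And>i. P i \<Longrightarrow> (A *v x) $ i = 0"
    and i: "P i"
  shows "x $ i = 0"
proof (rule ccontr)
  assume "x $ i \<noteq> 0"
  define S where "S = {i. P i \<and> x $ i \<noteq> 0}"
  have S: "finite S" "S \<noteq> {}" using i \<open>x $ i \<noteq> 0\<close> by (auto simp: S_def)
  define j where "j = Max S"
  have j: "P j" "x $ j \<noteq> 0" using Max_in[OF S] by (auto simp: S_def j_def)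
  have "x $ k = 0" if "j < k" for k
  proof (rule ccontr)
    assume "x $ k \<noteq> 0"
    then have "k \<in> S" using P[OF j(1) that] by (simp add: S_def)
    then show False using Max_ge[OF S(1)] that unfolding j_def by (simp add: leD)
  qed
  then have "(A *v x) $ j = A $ j $ j * x $ j" by (intro upper_triangular_mult_top A)
  then show False using z[OF j(1)] A(2)[of j] j(2) by simp
qed

lemma upper_triangular_inverse:
  fixes A :: "'m::{finite,linorder} state_matrix"
  assumes A: "\<And>i j. j < i \<Longrightarrow> A $ i $ j = 0" "\<And>i. A $ i $ i \<noteq> 0"
  obtains B where "A ** B = mat 1" "\<And>i j. j < i \<Longrightarrow> B $ i $ j = 0" "\<And>i. B $ i $ i \<noteq> 0"
proof -
  have "x = 0" if "A *v x = 0" for x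
    using upper_triangular_last_nonzero[OF A, where P = "\<lambda>_. True" and x = x] that by (simp add: vec_eq_iff)
  then have "\<exists>B. B ** A = mat 1" by (simp add: matrix_left_invertible_ker)
  then obtain B where B: "A ** B = mat 1" using matrix_left_right_inverse by blast
  have col: "A *v column j B = axis j 1" for j
    using B by (metis matrix_vector_mul_assoc matrix_vector_mul_lid matrix_vector_mult_basis)
  have up: "B $ i $ j = 0" if "j < i" for i j
  proof -
    have "(A *v column j B) $ k = 0" if "j < k" for k
      unfolding col using that by (simp add: axis_def)
    then have "column j B $ i = 0"
      using upper_triangular_last_nonzero[where A = A and P = "\<lambda>k. j < k" and x = "column j B" and i = i] A that
      by (meson less_trans)
    then show ?thesis by (simp add: column_def)
  qed
  have "B $ j $ j \<noteq> 0" for j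
  proof -
    have "(A *v column j B) $ j = A $ j $ j * column j B $ j"
      by (rule upper_triangular_mult_top) (use A up in \<open>auto simp: column_def\<close>)
    then show ?thesis unfolding col by (auto simp: column_def)
  qed
  with B up show ?thesis using that by blast
qed

lemma bmat_mult_upper:
  assumes "\<And>\<gamma>. \<beta> < \<gamma> \<Longrightarrow> B \<gamma> \<beta> = 0"
  shows "bmat_mult A B \<alpha> \<beta> = (\<Sum>\<gamma>\<le>\<beta>. A \<alpha> \<gamma> ** B \<gamma> \<beta>)"
proof -
  have "bmat_mult A B \<alpha> \<beta> = (\<Sum>\<^sub>\<infinity>\<gamma>\<in>{..\<beta>}. A \<alpha> \<gamma> ** B \<gamma> \<beta>)"
    unfolding bmat_mult_def using assms by (intro infsum_cong_neutral) auto
  then show ?thesis by simp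
qed

text \<open>Multiplication of infinite matrices is not associative in general. It is when the columns of the right
  factors end at the diagonal, since all sums are then finite.\<close>

lemma bmat_mult_assoc_upper:
  assumes B: "\<And>\<alpha> \<beta>. \<beta> < \<alpha> \<Longrightarrow> B \<alpha> \<beta> = 0" and C: "\<And>\<alpha> \<beta>. \<beta> < \<alpha> \<Longrightarrow> C \<alpha> \<beta> = 0"
  shows "bmat_mult (bmat_mult A B) C = bmat_mult A (bmat_mult B C)"
proof (intro ext)
  fix \<alpha> \<beta> :: nat
  have BC: "bmat_mult B C \<gamma> \<beta> = (\<Sum>\<delta>\<le>\<beta>. B \<gamma> \<delta> ** C \<delta> \<beta>)" for \<gamma>
    by (rule bmat_mult_upper) (rule C)
  have BC0: "bmat_mult B C \<gamma> \<beta> = 0" if "\<beta> < \<gamma>" for \<gamma>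
    unfolding BC using that by (intro sum.neutral) (auto simp: B)
  have "bmat_mult (bmat_mult A B) C \<alpha> \<beta> = (\<Sum>\<gamma>\<le>\<beta>. bmat_mult A B \<alpha> \<gamma> ** C \<gamma> \<beta>)"
    by (rule bmat_mult_upper) (rule C)
  also have "\<dots> = (\<Sum>\<gamma>\<le>\<beta>. (\<Sum>\<delta>\<le>\<beta>. A \<alpha> \<delta> ** B \<delta> \<gamma>) ** C \<gamma> \<beta>)"
  proof (intro sum.cong refl)
    fix \<gamma> assume "\<gamma> \<in> {..\<beta>}"
    then have "(\<Sum>\<delta>\<le>\<gamma>. A \<alpha> \<delta> ** B \<delta> \<gamma>) = (\<Sum>\<delta>\<le>\<beta>. A \<alpha> \<delta> ** B \<delta> \<gamma>)"
      by (intro sum.mono_neutral_left) (auto simp: B)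
    then show "bmat_mult A B \<alpha> \<gamma> ** C \<gamma> \<beta> = (\<Sum>\<delta>\<le>\<beta>. A \<alpha> \<delta> ** B \<delta> \<gamma>) ** C \<gamma> \<beta>"
      by (subst bmat_mult_upper) (auto simp: B)
  qed
  also have "\<dots> = (\<Sum>\<delta>\<le>\<beta>. A \<alpha> \<delta> ** (\<Sum>\<gamma>\<le>\<beta>. B \<delta> \<gamma> ** C \<gamma> \<beta>))"
    unfolding mm.sum_left mm.sum_right by (subst sum.swap) (simp add: matrix_mul_assoc)
  also have "\<dots> = bmat_mult A (bmat_mult B C) \<alpha> \<beta>"
    by (subst bmat_mult_upper[of \<beta> "bmat_mult B C"]) (simp_all only: BC0, simp only: BC)
  finally show "bmat_mult (bmat_mult A B) C \<alpha> \<beta> = bmat_mult A (bmat_mult B C) \<alpha> \<beta>" .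
qed

lemma bmat_mult_one_right: "bmat_mult A bmat_one = A"
proof (intro ext)
  fix \<alpha> \<beta>
  have "bmat_mult A bmat_one \<alpha> \<beta> = (\<Sum>\<gamma>\<le>\<beta>. A \<alpha> \<gamma> ** bmat_one \<gamma> \<beta>)"
    by (rule bmat_mult_upper) (simp add: bmat_one_def)
  also have "\<dots> = (\<Sum>\<gamma>\<le>\<beta>. if \<gamma> = \<beta> then A \<alpha> \<gamma> else 0)"
    by (intro sum.cong) (auto simp: bmat_one_def)
  finally show "bmat_mult A bmat_one \<alpha> \<beta> = A \<alpha> \<beta>" by simp
qed

lemma bmat_mult_one_left:
  assumes B: "\<And>\<alpha> \<beta>. \<beta> < \<alpha> \<Longrightarrow> B \<alpha> \<beta> = 0"
  shows "bmat_mult bmat_one B = B"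
proof (intro ext)
  fix \<alpha> \<beta>
  have "bmat_mult bmat_one B \<alpha> \<beta> = (\<Sum>\<gamma>\<le>\<beta>. bmat_one \<alpha> \<gamma> ** B \<gamma> \<beta>)"
    by (rule bmat_mult_upper) (rule B)
  also have "\<dots> = (\<Sum>\<gamma>\<le>\<beta>. if \<gamma> = \<alpha> then B \<alpha> \<beta> else 0)"
    by (intro sum.cong) (auto simp: bmat_one_def)
  finally show "bmat_mult bmat_one B \<alpha> \<beta> = B \<alpha> \<beta>" by (auto simp: B)
qed

text \<open>Back substitution: the column of index \<open>\<beta>\<close> is built from its diagonal block upwards. The diagonal of the
  right inverse is recorded so that the construction can be applied to it once more.\<close>

lemma upper_triangular_bmat_right_inverse:
  fixes A :: "'m::{finite,linorder} block_matrix"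
  assumes A: "upper_triangular_bmat A" and d: "\<And>\<alpha> i. A \<alpha> \<alpha> $ i $ i \<noteq> 0"
  shows "\<exists>T. upper_triangular_bmat T \<and> (\<forall>\<alpha> i. T \<alpha> \<alpha> $ i $ i \<noteq> 0) \<and> bmat_mult A T = bmat_one"
proof -
  have Ab: "A \<alpha> \<beta> = 0" if "\<beta> < \<alpha>" for \<alpha> \<beta> using A that by (auto simp: upper_triangular_bmat_def)
  have "\<exists>B. A \<alpha> \<alpha> ** B = mat 1 \<and> (\<forall>i j. j < i \<longrightarrow> B $ i $ j = 0) \<and> (\<forall>i. B $ i $ i \<noteq> 0)" for \<alpha>
    using A d[of \<alpha>] unfolding upper_triangular_bmat_def by (metis upper_triangular_inverse)
  then obtain D where D: "\<And>\<alpha>. A \<alpha> \<alpha> ** D \<alpha> = mat 1"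
    "\<And>\<alpha> i j. j < i \<Longrightarrow> D \<alpha> $ i $ j = 0" "\<And>\<alpha> i. D \<alpha> $ i $ i \<noteq> 0" by metis
  have "\<exists>c. c \<beta> = D \<beta> \<and> (\<forall>\<alpha>>\<beta>. c \<alpha> = 0) \<and> (\<forall>\<alpha>\<ge>k. (\<Sum>\<gamma>\<le>\<beta>. A \<alpha> \<gamma> ** c \<gamma>) = bmat_one \<alpha> \<beta>)"
    if "k \<le> \<beta>" for k \<beta>
    using that
  proof (induction k rule: inc_induct)
    case base
    define c where "c = (\<lambda>\<gamma>. if \<gamma> = \<beta> then D \<beta> else 0)"
    have "(\<Sum>\<gamma>\<le>\<beta>. A \<alpha> \<gamma> ** c \<gamma>) = A \<alpha> \<beta> ** D \<beta>" for \<alpha>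
    proof -
      have "(\<Sum>\<gamma>\<le>\<beta>. A \<alpha> \<gamma> ** c \<gamma>) = (\<Sum>\<gamma>\<le>\<beta>. if \<gamma> = \<beta> then A \<alpha> \<beta> ** D \<beta> else 0)"
        by (intro sum.cong) (auto simp: c_def)
      then show ?thesis by simp
    qed
    moreover have "A \<alpha> \<beta> ** D \<beta> = bmat_one \<alpha> \<beta>" if "\<alpha> \<ge> \<beta>" for \<alpha>
      using that D(1) Ab[of \<beta> \<alpha>] by (cases "\<alpha> = \<beta>") (auto simp: bmat_one_def)
    ultimately show ?case by (intro exI[of _ c]) (auto simp: c_def)
  next
    case (step k)
    then obtain c where c: "c \<beta> = D \<beta>" "\<And>\<alpha>. \<alpha> > \<beta> \<Longrightarrow> c \<alpha> = 0"
      "\<And>\<alpha>. \<alpha> \<ge> Suc k \<Longrightarrow> (\<Sum>\<gamma>\<le>\<beta>. A \<alpha> \<gamma> ** c \<gamma>) = bmat_one \<alpha> \<beta>" by blast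
    \<comment> \<open>The new block at position \<open>k\<close> solves equation \<open>k\<close>; it does not enter the equations below, where \<open>A \<alpha> k = 0\<close>.\<close>
    define r where "r = (\<Sum>\<gamma>\<in>{..\<beta>}-{k}. A k \<gamma> ** c \<gamma>)"
    define c' where "c' = c(k := D k ** (- r))"
    have split: "(\<Sum>\<gamma>\<le>\<beta>. A \<alpha> \<gamma> ** c' \<gamma>) = A \<alpha> k ** c' k + (\<Sum>\<gamma>\<in>{..\<beta>}-{k}. A \<alpha> \<gamma> ** c \<gamma>)" for \<alpha>
      using step.hyps by (subst sum.remove[of _ k]) (auto simp: c'_def)
    have splitc: "(\<Sum>\<gamma>\<le>\<beta>. A \<alpha> \<gamma> ** c \<gamma>) = A \<alpha> k ** c k + (\<Sum>\<gamma>\<in>{..\<beta>}-{k}. A \<alpha> \<gamma> ** c \<gamma>)" for \<alpha>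
      using step.hyps by (subst sum.remove[of _ k]) auto
    have "(\<Sum>\<gamma>\<le>\<beta>. A \<alpha> \<gamma> ** c' \<gamma>) = bmat_one \<alpha> \<beta>" if "\<alpha> \<ge> k" for \<alpha>
    proof (cases "\<alpha> = k")
      case True
      have "A k k ** c' k = - r" unfolding c'_def by (simp add: matrix_mul_assoc D(1))
      then show ?thesis using True step.hyps split[of k] by (auto simp: r_def bmat_one_def)
    next
      case False
      then have "A \<alpha> k = 0" "Suc k \<le> \<alpha>" using that by (auto intro: Ab)
      then show ?thesis using split[of \<alpha>] splitc[of \<alpha>] c(3)[of \<alpha>] by simp
    qed
    then show ?case using c step.hyps by (intro exI[of _ c']) (auto simp: c'_def)
  qed
  from this[OF le0] have "\<forall>\<beta>. \<exists>c. c \<beta> = D \<beta> \<and> (\<forall>\<alpha>>\<beta>. c \<alpha> = 0)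
      \<and> (\<forall>\<alpha>. (\<Sum>\<gamma>\<le>\<beta>. A \<alpha> \<gamma> ** c \<gamma>) = bmat_one \<alpha> \<beta>)"
    by simp
  then have "\<exists>c. \<forall>\<beta>. c \<beta> \<beta> = D \<beta> \<and> (\<forall>\<alpha>>\<beta>. c \<beta> \<alpha> = 0)
      \<and> (\<forall>\<alpha>. (\<Sum>\<gamma>\<le>\<beta>. A \<alpha> \<gamma> ** c \<beta> \<gamma>) = bmat_one \<alpha> \<beta>)"
    by (rule choice)
  then obtain c where c: "\<And>\<beta>. c \<beta> \<beta> = D \<beta>" "\<And>\<beta> \<alpha>. \<alpha> > \<beta> \<Longrightarrow> c \<beta> \<alpha> = 0"
    "\<And>\<beta> \<alpha>. (\<Sum>\<gamma>\<le>\<beta>. A \<alpha> \<gamma> ** c \<beta> \<gamma>) = bmat_one \<alpha> \<beta>" by blast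
  define T where "T = (\<lambda>\<alpha> \<beta>. c \<beta> \<alpha>)"
  have "bmat_mult A T = bmat_one"
  proof (intro ext)
    fix \<alpha> \<beta> show "bmat_mult A T \<alpha> \<beta> = bmat_one \<alpha> \<beta>"
      by (subst bmat_mult_upper) (auto simp: T_def c)
  qed
  moreover have "upper_triangular_bmat T" using D by (auto simp: upper_triangular_bmat_def T_def c)
  moreover have "\<forall>\<alpha> i. T \<alpha> \<alpha> $ i $ i \<noteq> 0" using D(3) by (simp add: T_def c)
  ultimately show ?thesis by blast
qed

text \<open>The right inverse \<open>T\<close> of \<open>R\<close> has a right inverse \<open>Q\<close> in turn, and \<open>R = R (T Q) = (R T) Q = Q\<close>, so \<open>T\<close> is
  two-sided. Any triangular right inverse \<open>S\<close> equals \<open>(T R) S = T\<close>, so the definite description in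
  \<^const>\<open>bmat_inverse\<close> denotes \<open>T\<close>.\<close>

lemma bmat_inverse_cholesky:
  fixes R :: "'m::{finite,linorder} block_matrix"
  assumes "cholesky_factor M R"
  shows "upper_triangular_bmat (bmat_inverse R)" (is ?U)
    and "bmat_mult R (bmat_inverse R) = bmat_one" (is ?R)
    and "bmat_mult (bmat_inverse R) R = bmat_one" (is ?L)
proof -
  have R: "upper_triangular_bmat R" "\<And>\<alpha> i. R \<alpha> \<alpha> $ i $ i \<noteq> 0"
    using assms unfolding cholesky_factor_def by (auto simp: less_le)
  have bl: "X \<alpha> \<beta> = 0" if "upper_triangular_bmat X" "\<beta> < \<alpha>" for X :: "'m block_matrix" and \<alpha> \<beta>
    using that by (auto simp: upper_triangular_bmat_def)
  obtain T where T: "upper_triangular_bmat T" "\<And>\<alpha> i. T \<alpha> \<alpha> $ i $ i \<noteq> 0" "bmat_mult R T = bmat_one"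
    using upper_triangular_bmat_right_inverse[OF R] by metis
  obtain Q where Q: "upper_triangular_bmat Q" "\<And>\<alpha> i. Q \<alpha> \<alpha> $ i $ i \<noteq> 0" "bmat_mult T Q = bmat_one"
    using upper_triangular_bmat_right_inverse[OF T(1,2)] by metis
  have "R = bmat_mult R (bmat_mult T Q)" by (simp add: Q bmat_mult_one_right)
  also have "\<dots> = bmat_mult bmat_one Q"
    by (subst bmat_mult_assoc_upper[symmetric]) (auto simp: T bl[OF T(1)] bl[OF Q(1)])
  also have "\<dots> = Q" by (rule bmat_mult_one_left) (rule bl[OF Q(1)])
  finally have TR: "bmat_mult T R = bmat_one" using Q by simp
  have uniq: "S = T" if S: "upper_triangular_bmat S" "bmat_mult R S = bmat_one" for S
  proof -
    have "S = bmat_mult (bmat_mult T R) S"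
      unfolding TR by (rule bmat_mult_one_left[symmetric]) (rule bl[OF S(1)])
    also have "\<dots> = bmat_mult T (bmat_mult R S)"
      by (rule bmat_mult_assoc_upper) (auto simp: bl[OF R(1)] bl[OF S(1)])
    finally show ?thesis by (simp add: S bmat_mult_one_right)
  qed
  have "bmat_inverse R = T"
    unfolding bmat_inverse_def
  proof (rule the_equality)
    show "upper_triangular_bmat T \<and> bmat_mult R T = bmat_one \<and> bmat_mult T R = bmat_one"
      by (intro conjI T(1) T(3) TR)
    show "S = T" if "upper_triangular_bmat S \<and> bmat_mult R S = bmat_one \<and> bmat_mult S R = bmat_one" for S
      by (rule uniq) (simp_all only: that)
  qed
  then show ?U ?R ?L by (simp_all only: T TR)
qed

section \<open>The orthogonalized modes and Parseval's identity\<close>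

lemma basis_block_mult [simp]:
  "basis_block \<phi> \<alpha> x ** A = \<phi> \<alpha> x *\<^sub>R A" "basis_block \<phi> \<alpha> x *v y = \<phi> \<alpha> x *\<^sub>R y"
  "transpose (basis_block \<phi> \<alpha> x) = basis_block \<phi> \<alpha> x"
  by (simp_all add: basis_block_def vec_eq_iff matrix_matrix_mult_def matrix_vector_mult_def mat_def
      transpose_def if_distrib[of "\<lambda>z. z * _"] eq_commute cong: if_cong)

lemma basis_block_mult_right [simp]: "A ** basis_block \<phi> \<alpha> x = \<phi> \<alpha> x *\<^sub>R A"
  by (simp add: basis_block_def vec_eq_iff matrix_matrix_mult_def mat_def
      if_distrib[of "\<lambda>z. _ * z"] mult.commute cong: if_cong)

lemma inner_transpose: "(A *v y) \<bullet> z = y \<bullet> (transpose A *v z)" for A :: "real^'k::finite^'l::finite"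
  by (metis dot_lmul_matrix transpose_matrix_vector inner_commute)

text \<open>The columns of the triangular inverse are finite, so each orthogonalized mode is a polynomial.\<close>

lemma orth_basis_finite:
  fixes R :: "'m::{finite,linorder} block_matrix"
  assumes "cholesky_factor M R"
  shows "orth_basis \<phi> R \<alpha> x = (\<Sum>\<beta>\<le>\<alpha>. \<phi> \<beta> x *\<^sub>R bmat_inverse R \<beta> \<alpha>)"
proof -
  have "bmat_inverse R \<beta> \<alpha> = 0" if "\<alpha> < \<beta>" for \<beta>
    using bmat_inverse_cholesky(1)[OF assms] that by (auto simp: upper_triangular_bmat_def)
  then have "orth_basis \<phi> R \<alpha> x = (\<Sum>\<^sub>\<infinity>\<beta>\<in>{..\<alpha>}. basis_block \<phi> \<beta> x ** bmat_inverse R \<beta> \<alpha>)"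
    unfolding orth_basis_def by (intro infsum_cong_neutral) auto
  then show ?thesis by simp
qed

lemma continuous_on_orth_basis:
  fixes R :: "'m::{finite,linorder} block_matrix"
  assumes "cholesky_factor M R" "modal_basis \<Omega> \<phi>"
  shows "continuous_on S (orth_basis \<phi> R \<alpha>)"
proof -
  have "continuous_on S (\<phi> \<beta>)" for \<beta>
    using assms(2) continuous_real_polymonial_function unfolding modal_basis_def
    by (blast intro: continuous_at_imp_continuous_on)
  then have "continuous_on S (\<lambda>x. \<Sum>\<beta>\<le>\<alpha>. \<phi> \<beta> x *\<^sub>R bmat_inverse R \<beta> \<alpha>)"
    by (intro continuous_intros)
  then show ?thesis unfolding orth_basis_finite[OF assms(1)] .
qed

text \<open>The mass matrix for a weight \<open>H\<close> is the Gram matrix of the modes in the inner product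
  \<open>\<integral> v\<^sup>T H w\<close>; the Cholesky factorization performs Gram-Schmidt orthogonalization.\<close>

locale weighted_modes =
  fixes \<Omega> :: "(real^'d::finite) set" and \<phi> :: "nat \<Rightarrow> real^'d \<Rightarrow> real"
    and H :: "real^'d \<Rightarrow> 'm::{finite,linorder} state_matrix" and R :: "'m block_matrix"
  assumes compact: "compact \<Omega>" and basis: "modal_basis \<Omega> \<phi>" and H_cont: "continuous_on \<Omega> H"
    and H_sym: "\<And>x. x \<in> \<Omega> \<Longrightarrow> transpose (H x) = H x"
    and H_nonneg: "\<And>x y. x \<in> \<Omega> \<Longrightarrow> 0 \<le> y \<bullet> (H x *v y)"
    and factor: "cholesky_factor
      (\<lambda>\<alpha> \<beta>. LINT x:\<Omega>|lborel. transpose (basis_block \<phi> \<alpha> x) ** H x ** basis_block \<phi> \<beta> x) R"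
begin

abbreviation "N \<equiv> restrict_space lborel \<Omega>"
abbreviation "T \<equiv> bmat_inverse R"
abbreviation "\<Psi> \<equiv> orth_basis \<phi> R"

lemma fin: "finite_measure N"
  using compact emeasure_compact_finite[OF compact]
  by (intro finite_measure_restrict_compact) auto

lemma int: "bdd_measurable N f \<Longrightarrow> integrable N f"
  by (rule bdd_measurable_integrable[OF fin])

lemma space_N: "space N = \<Omega>"
  by (simp add: space_restrict_space)

lemma cont: "continuous_on \<Omega> f \<Longrightarrow> bdd_measurable N f" for f :: "real^'d \<Rightarrow> 'b::euclidean_space"
  by (rule bdd_measurable_continuous[OF compact]) auto

lemma \<phi>_cont: "continuous_on \<Omega> (\<phi> \<beta>)"
  using basis continuous_real_polymonial_function unfolding modal_basis_def
  by (blast intro: continuous_at_imp_continuous_on)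

lemma \<Psi>_cont: "continuous_on \<Omega> (\<Psi> \<alpha>)"
  by (rule continuous_on_orth_basis[OF factor basis])

lemma triangular: "\<beta> < \<alpha> \<Longrightarrow> R \<alpha> \<beta> = 0" "\<beta> < \<alpha> \<Longrightarrow> T \<alpha> \<beta> = 0"
  using bmat_inverse_cholesky(1)[OF factor] factor by (auto simp: upper_triangular_bmat_def cholesky_factor_def)

lemma RT: "(\<Sum>\<gamma>\<le>\<beta>. R \<alpha> \<gamma> ** T \<gamma> \<beta>) = bmat_one \<alpha> \<beta>"
  using bmat_inverse_cholesky(2)[OF factor] bmat_mult_upper[of \<beta> T R \<alpha>] triangular by metis

lemma TR: "(\<Sum>\<gamma>\<le>\<beta>. T \<alpha> \<gamma> ** R \<gamma> \<beta>) = bmat_one \<alpha> \<beta>"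
  using bmat_inverse_cholesky(3)[OF factor] bmat_mult_upper[of \<beta> R T \<alpha>] triangular by metis

lemma gram: "(LINT x|N. (\<phi> \<alpha> x * \<phi> \<beta> x) *\<^sub>R H x) = (\<Sum>\<delta>\<le>\<beta>. transpose (R \<delta> \<alpha>) ** R \<delta> \<beta>)"
proof -
  have "(\<lambda>\<alpha> \<beta>. LINT x:\<Omega>|lborel. transpose (basis_block \<phi> \<alpha> x) ** H x ** basis_block \<phi> \<beta> x)
      = bmat_mult (bmat_transpose R) R" using factor unfolding cholesky_factor_def by blast
  then have "(LINT x:\<Omega>|lborel. transpose (basis_block \<phi> \<alpha> x) ** H x ** basis_block \<phi> \<beta> x)
      = bmat_mult (bmat_transpose R) R \<alpha> \<beta>" by (rule fun_cong[OF fun_cong])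
  also have "\<dots> = (\<Sum>\<delta>\<le>\<beta>. transpose (R \<delta> \<alpha>) ** R \<delta> \<beta>)"
    by (subst bmat_mult_upper) (auto simp: triangular bmat_transpose_def)
  also have "(LINT x:\<Omega>|lborel. transpose (basis_block \<phi> \<alpha> x) ** H x ** basis_block \<phi> \<beta> x)
      = (LINT x|N. (\<phi> \<alpha> x * \<phi> \<beta> x) *\<^sub>R H x)"
    by (subst set_integral_eq_restrict[OF _ compact]) (auto simp: mult.commute)
  finally show ?thesis .
qed

text \<open>From \<open>M = R\<^sup>T R\<close> follows \<open>T\<^sup>T M = (R T)\<^sup>T R = R\<close>. The left side consists of the inner products of the new basis
  with the old one, so \<open>R U\<close> is the sequence of inner products of the new basis with \<open>\<Phi> U\<close>.\<close>

lemma factor_eq_inner: "(LINT x|N. \<phi> \<beta> x *\<^sub>R (transpose (\<Psi> \<alpha> x) ** H x)) = R \<alpha> \<beta>"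
proof -
  have ib: "integrable N (\<lambda>x. (\<phi> \<gamma> x * \<phi> \<beta> x) *\<^sub>R H x)" for \<gamma>
    by (intro int cont continuous_intros \<phi>_cont H_cont)
  have "(LINT x|N. \<phi> \<beta> x *\<^sub>R (transpose (\<Psi> \<alpha> x) ** H x))
      = (LINT x|N. (\<Sum>\<gamma>\<le>\<alpha>. transpose (T \<gamma> \<alpha>) ** ((\<phi> \<gamma> x * \<phi> \<beta> x) *\<^sub>R H x)))"
    by (simp add: orth_basis_finite[OF factor] transpose_sum transpose_scalar mm.sum_left mm.scaleR_left
        mm.scaleR_right scaleR_sum_right mult.commute)
  also have "\<dots> = (\<Sum>\<gamma>\<le>\<alpha>. LINT x|N. transpose (T \<gamma> \<alpha>) ** ((\<phi> \<gamma> x * \<phi> \<beta> x) *\<^sub>R H x))"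
    by (intro Bochner_Integration.integral_sum integrable_bounded_linear[OF mm.bounded_linear_right ib])
  also have "\<dots> = (\<Sum>\<gamma>\<le>\<alpha>. transpose (T \<gamma> \<alpha>) ** (\<Sum>\<delta>\<le>\<beta>. transpose (R \<delta> \<gamma>) ** R \<delta> \<beta>))"
    unfolding gram[symmetric]
    by (intro sum.cong refl integral_bounded_linear[OF mm.bounded_linear_right ib])
  also have "\<dots> = (\<Sum>\<delta>\<le>\<beta>. (\<Sum>\<gamma>\<le>\<alpha>. transpose (T \<gamma> \<alpha>) ** transpose (R \<delta> \<gamma>)) ** R \<delta> \<beta>)"
    unfolding mm.sum_left mm.sum_right by (subst sum.swap) (simp add: matrix_mul_assoc)
  also have "\<dots> = (\<Sum>\<delta>\<le>\<beta>. transpose (\<Sum>\<gamma>\<le>\<alpha>. R \<delta> \<gamma> ** T \<gamma> \<alpha>) ** R \<delta> \<beta>)"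
    by (simp add: transpose_sum matrix_transpose_mul)
  also have "\<dots> = (\<Sum>\<delta>\<le>\<beta>. if \<delta> = \<alpha> then R \<alpha> \<beta> else 0)"
    unfolding RT by (intro sum.cong refl) (auto simp: bmat_one_def transpose_mat
        linear_0[OF bounded_linear.linear[OF bounded_linear_transpose]])
  also have "\<dots> = R \<alpha> \<beta>" by (auto simp: triangular)
  finally show ?thesis .
qed

text \<open>Here \<open>\<Psi> = \<Phi> T\<close> and the Gram matrix becomes \<open>T\<^sup>T M T = R T = 1\<close>.\<close>

lemma orthonormal: "(LINT x|N. transpose (\<Psi> \<alpha> x) ** H x ** \<Psi> \<beta> x) = bmat_one \<alpha> \<beta>"
proof -
  have ib: "integrable N (\<lambda>x. \<phi> \<gamma> x *\<^sub>R (transpose (\<Psi> \<alpha> x) ** H x))" for \<gamma>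
    by (intro int cont continuous_intros \<phi>_cont H_cont mm.continuous_on \<Psi>_cont
        bounded_linear.continuous_on[OF bounded_linear_transpose])
  have "(LINT x|N. transpose (\<Psi> \<alpha> x) ** H x ** \<Psi> \<beta> x)
      = (LINT x|N. (\<Sum>\<gamma>\<le>\<beta>. (\<phi> \<gamma> x *\<^sub>R (transpose (\<Psi> \<alpha> x) ** H x)) ** T \<gamma> \<beta>))"
    by (simp add: orth_basis_finite[OF factor, of _ \<beta>] mm.sum_right mm.scaleR_left mm.scaleR_right)
  also have "\<dots> = (\<Sum>\<gamma>\<le>\<beta>. LINT x|N. (\<phi> \<gamma> x *\<^sub>R (transpose (\<Psi> \<alpha> x) ** H x)) ** T \<gamma> \<beta>)"
    by (intro Bochner_Integration.integral_sum integrable_bounded_linear[OF mm.bounded_linear_left ib])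
  also have "\<dots> = (\<Sum>\<gamma>\<le>\<beta>. R \<alpha> \<gamma> ** T \<gamma> \<beta>)"
    by (simp only: integral_bounded_linear[OF mm.bounded_linear_left ib] factor_eq_inner)
  finally show ?thesis unfolding RT .
qed

text \<open>Since \<open>\<Psi> R = \<Phi> T R = \<Phi>\<close> with finite columns, the old and the new basis have the same finite spans. This provides the
  completeness that Parseval's identity requires.\<close>

lemma mode_in_span: "\<phi> \<beta> x *\<^sub>R mat 1 = (\<Sum>\<alpha>\<le>\<beta>. \<Psi> \<alpha> x ** R \<alpha> \<beta>)"
proof -
  have "(\<Sum>\<alpha>\<le>\<beta>. \<Psi> \<alpha> x ** R \<alpha> \<beta>) = (\<Sum>\<alpha>\<le>\<beta>. (\<Sum>\<gamma>\<le>\<beta>. \<phi> \<gamma> x *\<^sub>R T \<gamma> \<alpha>) ** R \<alpha> \<beta>)"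
  proof (intro sum.cong refl arg_cong2[where f = "(**)"])
    fix \<alpha> assume "\<alpha> \<in> {..\<beta>}"
    then show "\<Psi> \<alpha> x = (\<Sum>\<gamma>\<le>\<beta>. \<phi> \<gamma> x *\<^sub>R T \<gamma> \<alpha>)"
      unfolding orth_basis_finite[OF factor] by (intro sum.mono_neutral_left) (auto simp: triangular)
  qed
  also have "\<dots> = (\<Sum>\<gamma>\<le>\<beta>. \<phi> \<gamma> x *\<^sub>R (\<Sum>\<alpha>\<le>\<beta>. T \<gamma> \<alpha> ** R \<alpha> \<beta>))"
    unfolding mm.sum_left scaleR_sum_right by (subst sum.swap) (simp add: mm.scaleR_left)
  also have "\<dots> = (\<Sum>\<gamma>\<le>\<beta>. if \<gamma> = \<beta> then \<phi> \<beta> x *\<^sub>R mat 1 else 0)"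
    unfolding TR by (intro sum.cong) (auto simp: bmat_one_def)
  finally show ?thesis by simp
qed

definition inner_coeff :: "(real^'d \<Rightarrow> 'm state) \<Rightarrow> nat \<Rightarrow> 'm state" where
  "inner_coeff v \<alpha> = (LINT x|N. (transpose (\<Psi> \<alpha> x) ** H x) *v v x)"

definition norm2 :: "(real^'d \<Rightarrow> 'm state) \<Rightarrow> real" where
  "norm2 v = (LINT x|N. v x \<bullet> (H x *v v x))"

definition combination :: "nat \<Rightarrow> (nat \<Rightarrow> 'm state) \<Rightarrow> real^'d \<Rightarrow> 'm state" where
  "combination n c x = (\<Sum>\<alpha>\<le>n. \<Psi> \<alpha> x *v c \<alpha>)"

lemma combination_cont: "continuous_on \<Omega> (combination n c)"
  unfolding combination_def by (intro continuous_intros mv.continuous_on \<Psi>_cont)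

lemma weight_cont: "continuous_on \<Omega> (\<lambda>x. transpose (\<Psi> \<alpha> x) ** H x)"
  by (intro mm.continuous_on bounded_linear.continuous_on[OF bounded_linear_transpose] \<Psi>_cont H_cont)

lemma inner_combination:
  assumes w: "continuous_on \<Omega> w"
  shows "(LINT x|N. combination n c x \<bullet> (H x *v w x)) = (\<Sum>\<alpha>\<le>n. c \<alpha> \<bullet> inner_coeff w \<alpha>)"
proof -
  have ib: "integrable N (\<lambda>x. (transpose (\<Psi> \<alpha> x) ** H x) *v w x)" for \<alpha>
    by (intro int cont mv.continuous_on weight_cont w)
  have "combination n c x \<bullet> (H x *v w x) = (\<Sum>\<alpha>\<le>n. c \<alpha> \<bullet> ((transpose (\<Psi> \<alpha> x) ** H x) *v w x))" for x
    by (simp add: combination_def inner_sum_left inner_transpose matrix_vector_mul_assoc[symmetric])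
  then have "(LINT x|N. combination n c x \<bullet> (H x *v w x))
      = (\<Sum>\<alpha>\<le>n. LINT x|N. c \<alpha> \<bullet> ((transpose (\<Psi> \<alpha> x) ** H x) *v w x))"
    using ib by (simp only:) (intro Bochner_Integration.integral_sum integrable_inner_right)
  then show ?thesis
    using ib unfolding inner_coeff_def by (simp add: integral_inner_right)
qed

lemma inner_coeff_combination:
  assumes "\<alpha> \<le> n" shows "inner_coeff (combination n c) \<alpha> = c \<alpha>"
proof -
  have ib: "integrable N (\<lambda>x. transpose (\<Psi> \<alpha> x) ** H x ** \<Psi> \<beta> x)" for \<beta>
    by (intro int cont mm.continuous_on weight_cont \<Psi>_cont)
  have "inner_coeff (combination n c) \<alpha>
      = (LINT x|N. (\<Sum>\<beta>\<le>n. (transpose (\<Psi> \<alpha> x) ** H x ** \<Psi> \<beta> x) *v c \<beta>))"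
    by (simp add: inner_coeff_def combination_def mv.sum_right matrix_vector_mul_assoc)
  also have "\<dots> = (\<Sum>\<beta>\<le>n. LINT x|N. (transpose (\<Psi> \<alpha> x) ** H x ** \<Psi> \<beta> x) *v c \<beta>)"
    by (intro Bochner_Integration.integral_sum integrable_bounded_linear[OF mv.bounded_linear_left ib])
  also have "\<dots> = (\<Sum>\<beta>\<le>n. bmat_one \<alpha> \<beta> *v c \<beta>)"
    by (simp only: integral_bounded_linear[OF mv.bounded_linear_left ib] orthonormal)
  also have "\<dots> = (\<Sum>\<beta>\<le>n. if \<beta> = \<alpha> then c \<alpha> else 0)"
    by (intro sum.cong refl) (auto simp: bmat_one_def)
  finally show ?thesis using assms by simp
qed

text \<open>Completing the square in each coefficient: the distance from \<open>v\<close> to a combination is least for the coefficients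
  \<open>inner_coeff v\<close>. This gives Bessel's inequality and bounds its defect by the distance to any combination.\<close>

lemma norm2_diff_combination:
  assumes v: "continuous_on \<Omega> v"
  shows "norm2 (\<lambda>x. v x - combination n c x)
    = norm2 v + (\<Sum>\<alpha>\<le>n. (norm (c \<alpha> - inner_coeff v \<alpha>))\<^sup>2 - (norm (inner_coeff v \<alpha>))\<^sup>2)"
proof -
  let ?p = "combination n c"
  have i: "integrable N (\<lambda>x. w x \<bullet> (H x *v y x))"
    if "continuous_on \<Omega> w" "continuous_on \<Omega> y" for w y
    using that by (intro int cont continuous_on_inner mv.continuous_on H_cont)
  note ii = i[OF v v] i[OF combination_cont v] i[OF combination_cont combination_cont]
  have "norm2 (\<lambda>x. v x - ?p x)
      = (LINT x|N. v x \<bullet> (H x *v v x) - 2 * (?p x \<bullet> (H x *v v x)) + ?p x \<bullet> (H x *v ?p x))"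
    unfolding norm2_def
  proof (rule Bochner_Integration.integral_cong[OF refl])
    fix x assume "x \<in> space N"
    then have "v x \<bullet> (H x *v ?p x) = ?p x \<bullet> (H x *v v x)"
      using H_sym[of x] by (metis space_N dot_lmul_matrix inner_commute vector_transpose_matrix)
    then show "(v x - ?p x) \<bullet> (H x *v (v x - ?p x))
        = v x \<bullet> (H x *v v x) - 2 * (?p x \<bullet> (H x *v v x)) + ?p x \<bullet> (H x *v ?p x)"
      by (simp add: matrix_vector_mult_diff_distrib inner_diff_left inner_diff_right)
  qed
  also have "\<dots> = norm2 v - 2 * (\<Sum>\<alpha>\<le>n. c \<alpha> \<bullet> inner_coeff v \<alpha>) + (\<Sum>\<alpha>\<le>n. c \<alpha> \<bullet> inner_coeff ?p \<alpha>)"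
    unfolding norm2_def inner_combination[OF v, symmetric] inner_combination[OF combination_cont, symmetric]
    using ii by simp
  also have "(\<Sum>\<alpha>\<le>n. c \<alpha> \<bullet> inner_coeff ?p \<alpha>) = (\<Sum>\<alpha>\<le>n. c \<alpha> \<bullet> c \<alpha>)"
    by (intro sum.cong) (auto simp: inner_coeff_combination)
  also have "norm2 v - 2 * (\<Sum>\<alpha>\<le>n. c \<alpha> \<bullet> inner_coeff v \<alpha>) + (\<Sum>\<alpha>\<le>n. c \<alpha> \<bullet> c \<alpha>)
      = norm2 v + (\<Sum>\<alpha>\<le>n. c \<alpha> \<bullet> c \<alpha> - 2 * (c \<alpha> \<bullet> inner_coeff v \<alpha>))"
    by (simp add: sum_subtractf sum_distrib_left)
  also have "(\<Sum>\<alpha>\<le>n. c \<alpha> \<bullet> c \<alpha> - 2 * (c \<alpha> \<bullet> inner_coeff v \<alpha>))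
      = (\<Sum>\<alpha>\<le>n. (norm (c \<alpha> - inner_coeff v \<alpha>))\<^sup>2 - (norm (inner_coeff v \<alpha>))\<^sup>2)"
    by (simp add: power2_norm_eq_inner inner_diff_left inner_diff_right inner_commute algebra_simps)
  finally show ?thesis .
qed

lemma bessel:
  assumes v: "continuous_on \<Omega> v"
  shows "(\<Sum>\<alpha>\<le>n. (norm (inner_coeff v \<alpha>))\<^sup>2) \<le> norm2 v"
proof -
  have "0 \<le> norm2 (\<lambda>x. v x - combination n (inner_coeff v) x)"
    unfolding norm2_def using H_nonneg by (intro integral_nonneg_AE) (auto simp: space_N)
  then show ?thesis by (simp add: norm2_diff_combination[OF v] sum_negf)
qed

lemma bessel_defect_le:
  assumes v: "continuous_on \<Omega> v"
  shows "norm2 v - (\<Sum>\<alpha>\<le>n. (norm (inner_coeff v \<alpha>))\<^sup>2) \<le> norm2 (\<lambda>x. v x - combination n c x)"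
  by (simp add: norm2_diff_combination[OF v] sum_subtractf sum_nonneg)

lemma modal_sum_eq_combination:
  assumes J: "J \<subseteq> {..n}"
  shows "(\<Sum>\<beta>\<in>J. basis_block \<phi> \<beta> x *v U \<beta>) = combination n (\<lambda>\<alpha>. \<Sum>\<beta>\<in>J. R \<alpha> \<beta> *v U \<beta>) x"
proof -
  have "basis_block \<phi> \<beta> x *v U \<beta> = (\<Sum>\<alpha>\<le>n. \<Psi> \<alpha> x *v (R \<alpha> \<beta> *v U \<beta>))" if "\<beta> \<in> J" for \<beta>
  proof -
    have "basis_block \<phi> \<beta> x *v U \<beta> = (\<phi> \<beta> x *\<^sub>R mat 1) *v U \<beta>" by (simp add: mv.scaleR_left)
    also have "\<dots> = (\<Sum>\<alpha>\<le>\<beta>. \<Psi> \<alpha> x ** R \<alpha> \<beta>) *v U \<beta>" unfolding mode_in_span ..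
    also have "(\<Sum>\<alpha>\<le>\<beta>. \<Psi> \<alpha> x ** R \<alpha> \<beta>) = (\<Sum>\<alpha>\<le>n. \<Psi> \<alpha> x ** R \<alpha> \<beta>)"
      using that J by (intro sum.mono_neutral_left) (auto simp: triangular)
    finally show ?thesis by (simp add: mv.sum_left matrix_vector_mul_assoc)
  qed
  then have "(\<Sum>\<beta>\<in>J. basis_block \<phi> \<beta> x *v U \<beta>) = (\<Sum>\<beta>\<in>J. \<Sum>\<alpha>\<le>n. \<Psi> \<alpha> x *v (R \<alpha> \<beta> *v U \<beta>))"
    by (rule sum.cong[OF refl])
  then show ?thesis by (subst (asm) sum.swap) (simp add: combination_def mv.sum_right)
qed

lemma norm2_le:
  obtains K where "K \<ge> 0" "\<And>w. continuous_on \<Omega> w \<Longrightarrow> norm2 w \<le> K * (LINT x|N. (norm (w x))\<^sup>2)"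
proof -
  obtain K where K: "\<And>x. x \<in> \<Omega> \<Longrightarrow> norm (H x) \<le> K"
    using cont[OF H_cont] unfolding bdd_measurable_def space_N by blast
  obtain C where C: "C > 0" "\<And>A y. norm ((A::'m state_matrix) *v y) \<le> norm A * norm y * C"
    using mv.pos_bounded by blast
  define L where "L = \<bar>K\<bar> * C"
  have "norm2 w \<le> L * (LINT x|N. (norm (w x))\<^sup>2)" if w: "continuous_on \<Omega> w" for w
  proof -
    have "w x \<bullet> (H x *v w x) \<le> L * (norm (w x))\<^sup>2" if x: "x \<in> \<Omega>" for x
    proof -
      have "w x \<bullet> (H x *v w x) \<le> norm (w x) * (norm (H x) * norm (w x) * C)"
        by (meson C(2) mult_left_mono norm_cauchy_schwarz norm_ge_zero order_trans)
      also have "\<dots> = norm (H x) * ((norm (w x))\<^sup>2 * C)" by (simp add: power2_eq_square)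
      also have "\<dots> \<le> \<bar>K\<bar> * ((norm (w x))\<^sup>2 * C)"
        using K[OF x] C(1) by (intro mult_right_mono) auto
      finally show ?thesis by (simp add: L_def mult_ac)
    qed
    then have "norm2 w \<le> (LINT x|N. L * (norm (w x))\<^sup>2)"
      unfolding norm2_def
      by (intro integral_mono int cont continuous_intros mv.continuous_on H_cont w) (auto simp: space_N)
    then show ?thesis by simp
  qed
  moreover have "L \<ge> 0" using C by (simp add: L_def)
  ultimately show ?thesis using that by blast
qed

text \<open>The partial sums of the given expansion \<open>v = \<Phi> U\<close> are combinations of the orthonormal modes and converge to \<open>v\<close>, so the
  defect in Bessel's inequality tends to 0. The same convergence shows that \<open>R U\<close> is a convergent product, with the
  coefficients of \<open>v\<close> as its entries.\<close>

lemma parseval: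
  assumes v: "continuous_on \<Omega> v"
    and l2: "l2_has_sum lborel \<Omega> (\<lambda>\<alpha> x. basis_block \<phi> \<alpha> x *v U \<alpha>) v"
  shows "(modal_energy R U has_sum 1/2 * (LINT x:\<Omega>|lborel. v x \<bullet> (H x *v v x))) UNIV"
proof -
  note M = sets_lborel compact emeasure_compact_finite[OF compact]
  have s_cont: "continuous_on \<Omega> (\<lambda>x. basis_block \<phi> \<alpha> x *v U \<alpha>)" for \<alpha>
    by (simp add: continuous_on_scaleR \<phi>_cont)
  have U: "orth_coeff R U \<alpha> = inner_coeff v \<alpha>" for \<alpha>
  proof -
    have "((\<lambda>\<beta>. LINT x|N. (transpose (\<Psi> \<alpha> x) ** H x) *v (basis_block \<phi> \<beta> x *v U \<beta>)) has_sum inner_coeff v \<alpha>) UNIV"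
      unfolding inner_coeff_def
      by (rule l2_has_sum_integral[OF M bounded_bilinear_matrix_vector_mult _ _ _ l2])
         (intro cont weight_cont v s_cont)+
    moreover have "(LINT x|N. (transpose (\<Psi> \<alpha> x) ** H x) *v (basis_block \<phi> \<beta> x *v U \<beta>)) = R \<alpha> \<beta> *v U \<beta>" for \<beta>
    proof -
      have ib: "integrable N (\<lambda>x. \<phi> \<beta> x *\<^sub>R (transpose (\<Psi> \<alpha> x) ** H x))"
        by (intro int cont continuous_on_scaleR \<phi>_cont weight_cont)
      have "(LINT x|N. (transpose (\<Psi> \<alpha> x) ** H x) *v (basis_block \<phi> \<beta> x *v U \<beta>))
          = (LINT x|N. (\<phi> \<beta> x *\<^sub>R (transpose (\<Psi> \<alpha> x) ** H x)) *v U \<beta>)"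
        by (simp add: mv.scaleR_left mv.scaleR_right)
      then show ?thesis
        by (simp only: integral_bounded_linear[OF mv.bounded_linear_left ib] factor_eq_inner)
    qed
    ultimately show ?thesis unfolding orth_coeff_def by (simp add: infsumI)
  qed
  obtain K where K: "K \<ge> 0" "\<And>w. continuous_on \<Omega> w \<Longrightarrow> norm2 w \<le> K * (LINT x|N. (norm (w x))\<^sup>2)"
    using norm2_le by blast
  have lim: "((\<lambda>J. K * (LINT x|N. (norm (v x - (\<Sum>\<alpha>\<in>J. basis_block \<phi> \<alpha> x *v U \<alpha>)))\<^sup>2)) \<longlongrightarrow> K * 0)
      (finite_subsets_at_top UNIV)"
    using l2 l2_has_sum_iff_restrict[OF M cont[OF v] cont[OF s_cont]] by (intro tendsto_intros) simp
  have "(\<lambda>n. \<Sum>\<alpha>\<le>n. (norm (inner_coeff v \<alpha>))\<^sup>2) \<longlonglongrightarrow> norm2 v"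
  proof (rule LIMSEQ_I)
    fix \<epsilon> :: real assume "0 < \<epsilon>"
    then have "\<forall>\<^sub>F J in finite_subsets_at_top UNIV.
        K * (LINT x|N. (norm (v x - (\<Sum>\<alpha>\<in>J. basis_block \<phi> \<alpha> x *v U \<alpha>)))\<^sup>2) < \<epsilon>"
      by (intro order_tendstoD(2)[OF lim]) simp
    then obtain J where J: "finite J" "K * (LINT x|N. (norm (v x - (\<Sum>\<alpha>\<in>J. basis_block \<phi> \<alpha> x *v U \<alpha>)))\<^sup>2) < \<epsilon>"
      unfolding eventually_finite_subsets_at_top by blast
    obtain n0 where n0: "J \<subseteq> {..n0}" using finite_nat_set_iff_bounded_le[of J] J(1) by auto
    have "norm ((\<Sum>\<alpha>\<le>n. (norm (inner_coeff v \<alpha>))\<^sup>2) - norm2 v) < \<epsilon>" if "n \<ge> n0" for n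
    proof -
      let ?c = "\<lambda>\<alpha>. \<Sum>\<beta>\<in>J. R \<alpha> \<beta> *v U \<beta>"
      have "J \<subseteq> {..n}" using n0 that by auto
      note eq = modal_sum_eq_combination[OF this]
      have "norm2 v - (\<Sum>\<alpha>\<le>n. (norm (inner_coeff v \<alpha>))\<^sup>2) \<le> norm2 (\<lambda>x. v x - combination n ?c x)"
        by (rule bessel_defect_le[OF v])
      also have "\<dots> \<le> K * (LINT x|N. (norm (v x - combination n ?c x))\<^sup>2)"
        by (intro K(2) continuous_on_diff v combination_cont)
      also have "\<dots> < \<epsilon>" using J(2) unfolding eq .
      finally show ?thesis using bessel[OF v, of n] by simp
    qed
    then show "\<exists>n0. \<forall>n\<ge>n0. norm ((\<Sum>\<alpha>\<le>n. (norm (inner_coeff v \<alpha>))\<^sup>2) - norm2 v) < \<epsilon>" by blast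
  qed
  then have "((\<lambda>\<alpha>. (norm (inner_coeff v \<alpha>))\<^sup>2) has_sum norm2 v) UNIV"
    by (intro sums_nonneg_imp_has_sum) (auto simp: sums_def_le)
  then have "((\<lambda>\<alpha>. 1/2 * (norm (inner_coeff v \<alpha>))\<^sup>2) has_sum 1/2 * norm2 v) UNIV"
    by (rule has_sum_cmult_right)
  then show ?thesis
    unfolding norm2_def set_integral_eq_restrict[OF sets_lborel compact]
    by (simp add: modal_energy_def[abs_def] U)
qed

end

section \<open>Smooth functions near a set\<close>

lemma smooth_near_C1:
  assumes "smooth_near S f"
  obtains W where "open W" "S \<subseteq> W"
    "\<And>x. x \<in> W \<Longrightarrow> (f has_derivative frechet_derivative f (at x)) (at x)"
    "\<And>v. continuous_on W (\<lambda>x. frechet_derivative f (at x) v)"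
proof -
  obtain W where W: "open W" "S \<subseteq> W" "\<And>k. Ck_on k W f" using assms unfolding smooth_near_def by blast
  have "Ck_on (Suc 0) W f" by (rule W(3))
  then show ?thesis using that[OF W(1,2)] by (simp add: frechet_derivative_works[symmetric])
qed

lemma smooth_near_continuous_on: "smooth_near S f \<Longrightarrow> continuous_on S f"
  unfolding smooth_near_def by (metis Ck_on.simps(1) continuous_on_subset)

lemma smooth_near_hessian_continuous:
  assumes "smooth_near S f"
  shows "continuous_on S (hessian f)"
proof -
  obtain W where W: "S \<subseteq> W" "\<And>k. Ck_on k W f" using assms unfolding smooth_near_def by blast
  have "Ck_on (Suc (Suc 0)) W f" by (rule W(2))
  then have "continuous_on W (\<lambda>x. partial i (partial j f) x)" for i j
    unfolding partial_def by simp
  then show ?thesis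
    unfolding hessian_def by (intro continuous_on_vec_lambda) (rule continuous_on_subset[OF _ W(1)])
qed

section \<open>The energy matrix and the flux matrices\<close>

lemma spd_scaleR: "0 < c \<Longrightarrow> spd A \<Longrightarrow> spd (c *\<^sub>R A)"
  unfolding spd_def by (simp add: transpose_scalar mv.scaleR_left)

lemma spd_invertible: assumes "spd A" shows "invertible A"
proof -
  have "x = 0" if "A *v x = 0" for x
    using assms that unfolding spd_def by (metis inner_zero_right less_irrefl)
  then have "\<exists>B. B ** A = mat 1" by (simp add: matrix_left_invertible_ker)
  then show ?thesis unfolding invertible_def using matrix_left_right_inverse by blast
qed

locale energy_law =
  fixes \<U> :: "'m::{finite,linorder} state set" and F :: "'d::finite \<Rightarrow> 'm state \<Rightarrow> 'm state"
    and e :: "'m state \<Rightarrow> real" and g :: "'d \<Rightarrow> 'm state \<Rightarrow> real" and G :: "'d \<Rightarrow> 'm state \<Rightarrow> 'm state_matrix"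
    and c\<^sub>H C\<^sub>H :: real
  assumes system: "energy_system \<U> F e g G c\<^sub>H C\<^sub>H"
begin

lemma smooth: "smooth_near \<U> e" "smooth_near \<U> (g k)" "smooth_near \<U> (G k)"
  using system unfolding energy_system_def by auto

lemma compatible: "u \<in> \<U> \<Longrightarrow> gradient e u v* flux_jacobian F k u = gradient (g k) u"
  using system unfolding energy_system_def by auto

lemma flux_quadratic: "u \<in> \<U> \<Longrightarrow> transpose (G k u) = G k u" "u \<in> \<U> \<Longrightarrow> g k u = 1/2 * (u \<bullet> (G k u *v u))"
  using system unfolding energy_system_def by auto

lemma energy_pos: "u \<in> \<U> \<Longrightarrow> 0 < e u" and hessian_spd: "u \<in> \<U> \<Longrightarrow> spd (hessian e u)"
  using system unfolding energy_system_def by auto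

text \<open>At \<open>u = 0\<close> the quotient in \<^const>\<open>energy_matrix\<close> is \<open>x / 0 = 0\<close>, so the eigenvalue 0 would violate the lower bound \<open>c\<^sub>H > 0\<close>.\<close>

lemma state_nonzero: assumes "u \<in> \<U>" shows "u \<noteq> 0"
proof
  assume "u = 0"
  then have "energy_matrix e u *v axis i 1 = 0 *\<^sub>R axis i 1" for i by (simp add: energy_matrix_def)
  moreover have "axis i (1::real) \<noteq> 0" for i :: 'm by (simp add: axis_eq_0_iff)
  ultimately have "c\<^sub>H \<le> 0" using system assms unfolding energy_system_def by blast
  then show False using system unfolding energy_system_def by auto
qed

lemma hessian_state_pos: "u \<in> \<U> \<Longrightarrow> 0 < u \<bullet> (hessian e u *v u)"
  using hessian_spd state_nonzero unfolding spd_def by blast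

lemma energy_matrix_spd: assumes "u \<in> \<U>" shows "spd (energy_matrix e u)"
  unfolding energy_matrix_def
  using energy_pos hessian_state_pos hessian_spd assms by (intro spd_scaleR) simp_all

lemma energy_quadratic: assumes "u \<in> \<U>" shows "1/2 * (u \<bullet> (energy_matrix e u *v u)) = e u"
  using hessian_state_pos[OF assms] by (simp add: energy_matrix_def mv.scaleR_left)

lemma energy_matrix_continuous: "continuous_on \<U> (energy_matrix e)"
proof -
  have "u \<bullet> (hessian e u *v u) \<noteq> 0" if "u \<in> \<U>" for u using hessian_state_pos[OF that] by simp
  then show ?thesis unfolding energy_matrix_def[abs_def]
    by (intro continuous_intros mv.continuous_on smooth_near_continuous_on smooth_near_hessian_continuous smooth) auto
qed

lemma energy_matrix_flux:
  assumes "u \<in> \<U>"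
  shows "energy_matrix e u ** (flux_jacobian F k u + delta_jacobian F e G k u) = G k u"
proof -
  have "energy_matrix e u ** matrix_inv (energy_matrix e u) = mat 1"
    using spd_invertible[OF energy_matrix_spd[OF assms]] unfolding invertible_def matrix_inv_def
    by (rule someI2_ex) blast
  then show ?thesis by (simp add: delta_jacobian_def matrix_mul_assoc)
qed

lemma normal_flux_symmetric: "u \<in> \<U> \<Longrightarrow> transpose (normal_flux_matrix G \<nu> u) = normal_flux_matrix G \<nu> u"
  using flux_quadratic(1) unfolding normal_flux_matrix_def
  by (simp add: transpose_sum transpose_scalar)

lemma normal_flux_quadratic:
  assumes "u \<in> \<U>"
  shows "1/2 * (u \<bullet> (normal_flux_matrix G \<nu> u *v u)) = (\<Sum>k\<in>UNIV. \<nu> $ k * g k u)"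
  unfolding normal_flux_matrix_def
  by (simp add: flux_quadratic(2)[OF assms] mv.sum_left mv.scaleR_left inner_sum_right sum_distrib_left)

end

section \<open>Series of face powers\<close>

lemma sets_surface_measure: "sets surface_measure = sets borel"
  unfolding surface_measure_def hausdorff_measure_def
  by (metis sets.sets_measure_of_eq space_borel)

lemma l2_has_sum_cong:
  assumes "\<And>x. x \<in> S \<Longrightarrow> v x = v' x"
  shows "l2_has_sum M S s v \<longleftrightarrow> l2_has_sum M S s v'"
proof -
  have "(\<integral>\<^sup>+x\<in>S. ennreal ((norm (v x - (\<Sum>\<alpha>\<in>J. s \<alpha> x)))\<^sup>2) \<partial>M)
      = (\<integral>\<^sup>+x\<in>S. ennreal ((norm (v' x - (\<Sum>\<alpha>\<in>J. s \<alpha> x)))\<^sup>2) \<partial>M)" for J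
    using assms by (intro nn_integral_cong) (auto simp: indicator_def)
  then show ?thesis unfolding l2_has_sum_def by simp
qed

text \<open>One face seen from one element: \<open>\<nu>\<close> is the outward normal and \<open>v\<close> the trace of the state. The modes that enter
  below may come from either of the two elements at the face.\<close>

locale energy_face = energy_law \<U> F e g G c\<^sub>H C\<^sub>H
  for \<U> :: "'m::{finite,linorder} state set" and F :: "'d::finite \<Rightarrow> 'm state \<Rightarrow> 'm state"
    and e g G c\<^sub>H C\<^sub>H +
  fixes f :: "(real^'d) set" and \<nu> :: "real^'d \<Rightarrow> real^'d" and v :: "real^'d \<Rightarrow> 'm state"
  assumes compact_face: "compact f" and finite_face: "emeasure surface_measure f < \<infinity>"
    and normal: "\<nu> \<in> borel_measurable borel" "\<And>x. x \<in> f \<Longrightarrow> norm (\<nu> x) = 1"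
    and face_state: "continuous_on f v" "v ` f \<subseteq> \<U>"
begin

abbreviation "S \<equiv> restrict_space surface_measure f"
abbreviation "\<Gamma> x \<equiv> normal_flux_matrix G (\<nu> x) (v x)"

lemma fin_S: "finite_measure S"
  by (rule finite_measure_restrict_compact[OF sets_surface_measure compact_face finite_face])

lemma space_S: "space S = f"
  by (simp add: space_restrict_space sets_eq_imp_space_eq[OF sets_surface_measure])

lemma cont_S: "continuous_on f w \<Longrightarrow> bdd_measurable S w" for w :: "real^'d \<Rightarrow> 'b::euclidean_space"
  by (rule bdd_measurable_continuous[OF compact_face sets_surface_measure])

lemma normal_bdd: "bdd_measurable S \<nu>"
proof -
  have "\<nu> \<in> borel_measurable S"
    using normal(1) measurable_cong_sets[OF sets_surface_measure refl, of borel]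
    by (intro measurable_restrict_space1) auto
  then show ?thesis unfolding bdd_measurable_def space_S using normal(2) by (metis order_refl)
qed

lemma flux_bdd: "bdd_measurable S \<Gamma>"
  unfolding normal_flux_matrix_def
proof (rule bdd_measurable_sum)
  fix k
  have "continuous_on f (\<lambda>x. G k (v x))"
    using continuous_on_compose2[OF smooth_near_continuous_on[OF smooth(3)] face_state] by simp
  then show "bdd_measurable S (\<lambda>x. (\<nu> x $ k) *\<^sub>R G k (v x))"
    by (intro bdd_measurable_bilinear[OF bounded_bilinear_scaleR] cont_S
        bdd_measurable_bounded_linear[OF bounded_linear_vec_nth normal_bdd])
qed

lemma trace_bdd: "bdd_measurable S v"
  by (rule cont_S[OF face_state(1)])

text \<open>The pair power is linear in its last argument with the bounded weight \<open>\<Gamma>\<^sup>T a\<close>, so any modal expansion of the trace may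
  be inserted there.\<close>

lemma pair_power_has_sum:
  assumes a: "bdd_measurable S a" and s: "\<And>\<gamma>. bdd_measurable S (s \<gamma>)" and l2: "l2_has_sum surface_measure f s v"
  shows "((\<lambda>\<gamma>. pair_power G f \<nu> v a (s \<gamma>)) has_sum pair_power G f \<nu> v a v) UNIV"
proof -
  have b: "bdd_measurable S (\<lambda>x. transpose (\<Gamma> x) *v a x)"
    by (intro bdd_measurable_bilinear[OF bounded_bilinear_matrix_vector_mult] a
        bdd_measurable_bounded_linear[OF bounded_linear_transpose] flux_bdd)
  have eq: "pair_power G f \<nu> v a w = - (1/2) * (LINT x|S. (transpose (\<Gamma> x) *v a x) \<bullet> w x)" for w
    unfolding pair_power_def set_integral_eq_restrict[OF sets_surface_measure compact_face]
    by (simp only: inner_transpose transpose_transpose)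
  show ?thesis unfolding eq
    by (intro has_sum_cmult_right l2_has_sum_integral[OF sets_surface_measure compact_face finite_face
          bounded_bilinear_inner b trace_bdd s l2])
qed

lemma pair_power_state_has_sum:
  assumes s: "\<And>\<gamma>. bdd_measurable S (s \<gamma>)" and l2: "l2_has_sum surface_measure f s v"
  shows "((\<lambda>\<alpha>. pair_power G f \<nu> v (s \<alpha>) v) has_sum pair_power G f \<nu> v v v) UNIV"
proof -
  have "bdd_measurable S (\<lambda>x. \<Gamma> x *v v x)"
    by (intro bdd_measurable_bilinear[OF bounded_bilinear_matrix_vector_mult] trace_bdd flux_bdd)
  note h = l2_has_sum_integral[OF sets_surface_measure compact_face finite_face
          bounded_bilinear_inner this trace_bdd s l2]
  show ?thesis
    unfolding pair_power_def set_integral_eq_restrict[OF sets_surface_measure compact_face]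
    by (intro has_sum_cmult_right) (use h in \<open>simp add: inner_commute\<close>)
qed

lemma orth_mode_bdd:
  assumes "cholesky_factor M R" "modal_basis \<Omega> \<phi>"
  shows "bdd_measurable S (orth_mode \<phi> R U \<alpha>)"
  unfolding orth_mode_def[abs_def]
  by (intro cont_S mv.continuous_on continuous_on_orth_basis[OF assms] continuous_intros)

text \<open>The identity \<open>H (A + \<Delta>A) = G\<close> makes each entry of the face matrix a pair power of two modes, and the sum over the second
  mode restores the trace of the state.\<close>

lemma face_power_eq_pair_power:
  assumes R: "cholesky_factor M R" "modal_basis \<Omega> \<phi>"
    and l2: "l2_has_sum surface_measure f (orth_mode \<phi> R U) v"
  shows "face_power F e G f \<nu> \<phi> R U v \<alpha> = pair_power G f \<nu> v (orth_mode \<phi> R U \<alpha>) v"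
proof -
  let ?\<Psi> = "orth_basis \<phi> R" and ?c = "orth_coeff R U"
  have matrix: "face_matrix F e G f \<nu> \<phi> R v \<alpha> \<beta> = (LINT x|S. transpose (?\<Psi> \<alpha> x) ** \<Gamma> x ** ?\<Psi> \<beta> x)" for \<beta>
    unfolding face_matrix_def set_integral_eq_restrict[OF sets_surface_measure compact_face]
  proof (rule Bochner_Integration.integral_cong[OF refl])
    fix x assume "x \<in> space S"
    then have "v x \<in> \<U>" using face_state(2) by (auto simp: space_S)
    note G = energy_matrix_flux[OF this]
    show "(\<Sum>k\<in>UNIV. (\<nu> x $ k) *\<^sub>R (transpose (?\<Psi> \<alpha> x) ** energy_matrix e (v x)
           ** (flux_jacobian F k (v x) + delta_jacobian F e G k (v x)) ** ?\<Psi> \<beta> x))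
        = transpose (?\<Psi> \<alpha> x) ** \<Gamma> x ** ?\<Psi> \<beta> x"
      unfolding matrix_mul_assoc[symmetric] normal_flux_matrix_def
      by (simp add: matrix_mul_assoc[of "energy_matrix e (v x)"] G
          mm.sum_left mm.sum_right mm.scaleR_left mm.scaleR_right)
  qed
  have entry: "?c \<alpha> \<bullet> (face_matrix F e G f \<nu> \<phi> R v \<alpha> \<beta> *v ?c \<beta>)
      = (LINT x|S. orth_mode \<phi> R U \<alpha> x \<bullet> (\<Gamma> x *v orth_mode \<phi> R U \<beta> x))" for \<beta>
  proof -
    have i: "integrable S (\<lambda>x. transpose (?\<Psi> \<alpha> x) ** \<Gamma> x ** ?\<Psi> \<beta> x)"
      by (intro bdd_measurable_integrable[OF fin_S] bdd_measurable_bilinear[OF bounded_bilinear_matrix_matrix_mult]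
          bdd_measurable_bounded_linear[OF bounded_linear_transpose] flux_bdd cont_S continuous_on_orth_basis[OF R])
    have L: "bounded_linear (\<lambda>A. ?c \<alpha> \<bullet> (A *v ?c \<beta>))"
      by (intro bounded_linear_compose[OF bounded_linear_inner_right] mv.bounded_linear_left)
    have "?c \<alpha> \<bullet> (face_matrix F e G f \<nu> \<phi> R v \<alpha> \<beta> *v ?c \<beta>)
        = (LINT x|S. ?c \<alpha> \<bullet> ((transpose (?\<Psi> \<alpha> x) ** \<Gamma> x ** ?\<Psi> \<beta> x) *v ?c \<beta>))"
      unfolding matrix by (rule integral_bounded_linear[OF L i, symmetric])
    then show ?thesis
      by (simp add: orth_mode_def inner_transpose matrix_vector_mul_assoc matrix_mul_assoc)
  qed
  have "face_power F e G f \<nu> \<phi> R U v \<alpha>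
      = (\<Sum>\<^sub>\<infinity>\<beta>. pair_power G f \<nu> v (orth_mode \<phi> R U \<alpha>) (orth_mode \<phi> R U \<beta>))"
    unfolding face_power_def entry pair_power_def set_integral_eq_restrict[OF sets_surface_measure compact_face]
    by (rule infsum_cmult_right'[symmetric])
  also have "\<dots> = pair_power G f \<nu> v (orth_mode \<phi> R U \<alpha>) v"
    by (intro infsumI pair_power_has_sum orth_mode_bdd[OF R] l2)
  finally show ?thesis .
qed

lemma face_power_has_sum:
  assumes R: "cholesky_factor M R" "modal_basis \<Omega> \<phi>"
    and l2: "l2_has_sum surface_measure f (orth_mode \<phi> R U) v"
  shows "(face_power F e G f \<nu> \<phi> R U v has_sum pair_power G f \<nu> v v v) UNIV"
  using pair_power_state_has_sum[OF orth_mode_bdd[OF R] l2]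
  unfolding face_power_eq_pair_power[OF R l2, symmetric] by simp

text \<open>The quadratic form of the flux matrix is the energy flux: \<open>g\<^sub>k = 1/2 u \<bullet> G\<^sub>k u\<close>.\<close>

lemma total_face_power: "pair_power G f \<nu> v v v = - (LINT x:f|surface_measure. (\<Sum>k\<in>UNIV. \<nu> x $ k * g k (v x)))"
proof -
  have "(LINT x|S. (\<Sum>k\<in>UNIV. \<nu> x $ k * g k (v x))) = (LINT x|S. 1/2 * (v x \<bullet> (\<Gamma> x *v v x)))"
    using normal_flux_quadratic face_state(2)
    by (intro Bochner_Integration.integral_cong[OF refl]) (auto simp: space_S image_subset_iff)
  then show ?thesis unfolding pair_power_def set_integral_eq_restrict[OF sets_surface_measure compact_face] by simp
qed

end

text \<open>Seen from the other side of a face, the normal is reversed, and the symmetry of \<open>G\<close> exchanges the two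
  modes.\<close>

lemma (in energy_law) pair_power_antisymmetric:
  assumes "\<And>x. x \<in> f \<Longrightarrow> \<nu>' x = - \<nu> x" "\<And>x. x \<in> f \<Longrightarrow> v' x = v x" "\<And>x. x \<in> f \<Longrightarrow> v x \<in> \<U>"
  shows "pair_power G f \<nu>' v' w' w = - pair_power G f \<nu> v w w'"
proof -
  have "w' x \<bullet> (normal_flux_matrix G (\<nu>' x) (v' x) *v w x) = - (w x \<bullet> (normal_flux_matrix G (\<nu> x) (v x) *v w' x))"
    if "x \<in> f" for x
  proof -
    have "normal_flux_matrix G (- \<nu> x) (v x) = - normal_flux_matrix G (\<nu> x) (v x)"
      by (simp add: normal_flux_matrix_def sum_negf)
    then show ?thesis using assms[OF that] normal_flux_symmetric[OF assms(3)[OF that], of "\<nu> x"]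
      by (simp add: mv.minus_left inner_commute[of "w' x"] inner_transpose)
  qed
  then have "indicator f x *\<^sub>R (w' x \<bullet> (normal_flux_matrix G (\<nu>' x) (v' x) *v w x))
      = - (indicator f x *\<^sub>R (w x \<bullet> (normal_flux_matrix G (\<nu> x) (v x) *v w' x)))" for x
    by (simp add: indicator_def)
  then show ?thesis unfolding pair_power_def set_lebesgue_integral_def by simp
qed

section \<open>Differentiation under the integral and the Gauss-Green formula\<close>

text \<open>By the mean value theorem the difference quotient of \<open>h\<close> at \<open>x\<close> is \<open>D (z, x)\<close> for some \<open>z\<close> between \<open>s\<close> and \<open>t\<close>. Uniform continuity
  of \<open>D\<close> on a compact set brings it close to \<open>D (t, x)\<close> uniformly in \<open>x\<close>.\<close>

lemma leibniz_rule_compact: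
  fixes h :: "real \<Rightarrow> 'a::euclidean_space \<Rightarrow> real"
  assumes \<Omega>: "compact \<Omega>" and I: "open I" "t \<in> I"
    and der: "\<And>s x. s \<in> I \<Longrightarrow> x \<in> \<Omega> \<Longrightarrow> ((\<lambda>s. h s x) has_real_derivative D (s, x)) (at s)"
    and D: "continuous_on (I \<times> \<Omega>) D" and h: "\<And>s. s \<in> I \<Longrightarrow> continuous_on \<Omega> (h s)"
  shows "((\<lambda>s. LINT x:\<Omega>|lborel. h s x) has_real_derivative (LINT x:\<Omega>|lborel. D (t, x))) (at t)"
proof -
  let ?N = "restrict_space lborel \<Omega>"
  have fin: "finite_measure ?N"
    using emeasure_compact_finite[OF \<Omega>] \<Omega> by (intro finite_measure_restrict_compact) auto
  have int: "integrable ?N w" if "continuous_on \<Omega> w" for w :: "'a \<Rightarrow> real"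
    by (intro bdd_measurable_integrable[OF fin] bdd_measurable_continuous[OF \<Omega>] that) auto
  have Dt: "continuous_on \<Omega> (\<lambda>x. D (t, x))"
    using I by (intro continuous_on_compose2[OF D]) (auto intro!: continuous_intros)
  obtain r where r: "r > 0" "cball t r \<subseteq> I" using I open_contains_cball by blast
  have "uniformly_continuous_on (cball t r \<times> \<Omega>) D"
    using r by (intro compact_uniformly_continuous continuous_on_subset[OF D] compact_Times \<Omega>) auto
  note unif = this[unfolded uniformly_continuous_on_def, rule_format]
  have "((\<lambda>s. ((LINT x|?N. h s x) - (LINT x|?N. h t x)) / (s - t)) \<longlongrightarrow> (LINT x|?N. D (t, x))) (at t)"
  proof (rule tendstoI)
    fix \<epsilon> :: real assume \<epsilon>: "0 < \<epsilon>"
    define \<mu> where "\<mu> = measure ?N (space ?N)"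
    have \<mu>: "0 \<le> \<mu>" by (simp add: \<mu>_def)
    define \<eta> where "\<eta> = \<epsilon> / (\<mu> + 1)"
    have \<eta>: "0 < \<eta>" using \<epsilon> \<mu> by (simp add: \<eta>_def)
    have "\<eta> * \<mu> < \<eta> * (\<mu> + 1)" using \<eta> by (intro mult_strict_left_mono) auto
    also have "\<eta> * (\<mu> + 1) = \<epsilon>" using \<mu> by (simp add: \<eta>_def)
    finally have \<eta>\<mu>: "\<eta> * \<mu> < \<epsilon>" .
    obtain \<delta> where \<delta>: "\<delta> > 0"
      "\<And>z z'. z \<in> cball t r \<times> \<Omega> \<Longrightarrow> z' \<in> cball t r \<times> \<Omega> \<Longrightarrow> dist z' z < \<delta> \<Longrightarrow> dist (D z') (D z) < \<eta>"
      using unif[OF \<eta>] by blast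
    have "dist (((LINT x|?N. h s x) - (LINT x|?N. h t x)) / (s - t)) (LINT x|?N. D (t, x)) < \<epsilon>"
      if s: "s \<noteq> t" "dist s t < min \<delta> r" for s
    proof -
      have sI: "s \<in> I" using s r by (auto simp: dist_commute)
      have close: "norm ((h s x - h t x) / (s - t) - D (t, x)) \<le> \<eta>" if x: "x \<in> \<Omega>" for x
      proof -
        have seg: "z \<in> I" if "min s t \<le> z" "z \<le> max s t" for z
          using s r(2) that by (intro subsetD[OF r(2)]) (auto simp: dist_real_def)
        obtain z where z: "min s t < z" "z < max s t" "h (max s t) x - h (min s t) x = (max s t - min s t) * D (z, x)"
          using MVT2[of "min s t" "max s t" "\<lambda>s. h s x" "\<lambda>s. D (s, x)", OF _ der[OF seg x]] s(1)
          by fastforce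
        have "(h s x - h t x) / (s - t) = D (z, x)"
          using z(3) s(1) by (cases "s < t") (auto simp: max_def min_def field_simps)
        moreover have "dist (D (z, x)) (D (t, x)) < \<eta>"
          using z s r x by (intro \<delta>(2)) (auto simp: dist_Pair_Pair dist_real_def)
        ultimately show ?thesis by (simp add: dist_real_def)
      qed
      have "((LINT x|?N. h s x) - (LINT x|?N. h t x)) / (s - t) - (LINT x|?N. D (t, x))
          = (LINT x|?N. (h s x - h t x) / (s - t) - D (t, x))"
        using int[OF h[OF sI]] int[OF h[OF I(2)]] int[OF Dt] by simp
      also have "norm \<dots> \<le> (LINT x|?N. \<eta>)"
        by (rule Bochner_Integration.integral_norm_bound_integral)
          (use int[OF h[OF sI]] int[OF h[OF I(2)]] int[OF Dt] fin close in
            \<open>auto simp: finite_measure.integrable_const space_restrict_space\<close>)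
      finally show ?thesis using \<eta>\<mu> by (simp add: dist_norm \<mu>_def mult.commute)
    qed
    then show "\<forall>\<^sub>F s in at t. dist (((LINT x|?N. h s x) - (LINT x|?N. h t x)) / (s - t)) (LINT x|?N. D (t, x)) < \<epsilon>"
      unfolding eventually_at using \<delta>(1) r(1) by (intro exI[of _ "min \<delta> r"]) auto
  qed
  then show ?thesis
    unfolding set_integral_eq_restrict[OF sets_lborel \<Omega>] has_field_derivative_iff .
qed

lemma has_real_derivative_square_max:
  "((\<lambda>s::real. (max 0 s)\<^sup>2) has_real_derivative 2 * max 0 s) (at s)"
proof -
  consider "s > 0" | "s < 0" | "s = 0" by linarith
  then show ?thesis
  proof cases
    case 1
    have "((\<lambda>s::real. s\<^sup>2) has_real_derivative 2 * max 0 s) (at s)"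
      using 1 by (auto intro!: derivative_eq_intros)
    then show ?thesis
      by (rule has_field_derivative_transform_within_open[of _ _ _ "{0<..}"]) (use 1 in auto)
  next
    case 2
    have "((\<lambda>s::real. 0) has_real_derivative 2 * max 0 s) (at s)" using 2 by auto
    then show ?thesis
      by (rule has_field_derivative_transform_within_open[of _ _ _ "{..<0}"]) (use 2 in auto)
  next
    case 3
    have "((\<lambda>y::real. max 0 y) \<longlongrightarrow> max 0 0) (at 0)" by (intro tendsto_intros)
    moreover have "\<forall>\<^sub>F y in at (0::real). max 0 y = ((max 0 y)\<^sup>2 - (max 0 0)\<^sup>2) / (y - 0)"
      by (auto simp: eventually_at_filter max_def power2_eq_square)
    ultimately show ?thesis
      unfolding 3 has_field_derivative_iff by (auto elim: Lim_transform_eventually)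
  qed
qed

text \<open>Finitely many \<open>C\<^sup>1\<close> bumps \<open>q (r\<^sup>2 - |x - c|\<^sup>2)\<close> with \<open>q s = (max 0 s)\<^sup>2\<close> have a sum \<open>S\<close> that is at least \<open>m > 0\<close> on the compact
  set. The \<open>C\<^sup>1\<close> function \<open>1 - q (1 - 2 S / m)\<close> is 0 where \<open>S = 0\<close> and levels off at 1 where \<open>S \<ge> m / 2\<close>, hence on a whole
  neighbourhood of the set.\<close>

lemma C1_cutoff:
  fixes \<Omega> W :: "'a::euclidean_space set"
  assumes \<Omega>: "compact \<Omega>" "\<Omega> \<noteq> {}" and W: "open W" "\<Omega> \<subseteq> W"
  shows "\<exists>(\<kappa> :: 'a \<Rightarrow> real) \<kappa>' V K. open V \<and> \<Omega> \<subseteq> V \<and> (\<forall>x\<in>V. \<kappa> x = 1) \<and>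
    compact K \<and> K \<subseteq> W \<and> (\<forall>x. x \<notin> K \<longrightarrow> \<kappa> x = 0) \<and>
    (\<forall>x. (\<kappa> has_derivative \<kappa>' x) (at x)) \<and> (\<forall>v. continuous_on UNIV (\<lambda>x. \<kappa>' x v))"
proof -
  define q where "q = (\<lambda>s::real. (max 0 s)\<^sup>2)"
  have q: "(q has_real_derivative 2 * max 0 s) (at s)" for s
    unfolding q_def by (rule has_real_derivative_square_max)
  have "\<forall>c\<in>\<Omega>. \<exists>r>0. cball c r \<subseteq> W" using W open_contains_cball by blast
  then obtain r where r: "\<And>c. c \<in> \<Omega> \<Longrightarrow> r c > 0" "\<And>c. c \<in> \<Omega> \<Longrightarrow> cball c (r c) \<subseteq> W" by metis
  have "\<Omega> \<subseteq> (\<Union>c\<in>\<Omega>. ball c (r c))" using r by auto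
  then obtain C where C: "C \<subseteq> \<Omega>" "finite C" "\<Omega> \<subseteq> (\<Union>c\<in>C. ball c (r c))"
    using compactE_image[OF \<Omega>(1), of \<Omega> "\<lambda>c. ball c (r c)"] by auto
  define p where "p c x = (r c)\<^sup>2 - (x - c) \<bullet> (x - c)" for c x
  define S where "S x = (\<Sum>c\<in>C. q (p c x))" for x
  define S' where "S' x v = (\<Sum>c\<in>C. 2 * max 0 (p c x) * (- 2 * ((x - c) \<bullet> v)))" for x v
  have p_pos: "p c x > 0 \<longleftrightarrow> x \<in> ball c (r c)" if "c \<in> C" for c x
  proof -
    have "p c x > 0 \<longleftrightarrow> (dist c x)\<^sup>2 < (r c)\<^sup>2"
      by (simp add: p_def dist_norm norm_minus_commute[of c] power2_norm_eq_inner[symmetric])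
    then show ?thesis using r(1)[of c] C(1) that
      by (metis mem_ball power2_less_imp_less power_strict_mono less_imp_le pos2 subsetD zero_le_dist)
  qed
  have "((\<lambda>x. q (p c x)) has_derivative (\<lambda>v. 2 * max 0 (p c x) * (- 2 * ((x - c) \<bullet> v)))) (at x)" for c x
  proof -
    have "(p c has_derivative (\<lambda>v. - 2 * ((x - c) \<bullet> v))) (at x)"
      unfolding p_def[abs_def] by (auto intro!: derivative_eq_intros simp: inner_commute)
    from has_derivative_compose[OF this has_field_derivative_imp_has_derivative[OF q]]
    show ?thesis by simp
  qed
  then have S: "(S has_derivative S' x) (at x)" for x
    unfolding S_def[abs_def] S'_def[abs_def] by (intro has_derivative_sum)
  have S_cont: "continuous_on A S" for A
    by (intro continuous_at_imp_continuous_on ballI has_derivative_continuous[OF S])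
  have S'_cont: "continuous_on UNIV (\<lambda>x. S' x v)" for v
    unfolding S'_def p_def by (intro continuous_intros)
  have S_pos: "S x > 0" if x: "x \<in> \<Omega>" for x
  proof -
    obtain c where c: "c \<in> C" "x \<in> ball c (r c)" using x C(3) by blast
    then have "p c x > 0" using p_pos by blast
    then have "q (p c x) > 0" by (simp add: q_def)
    then show ?thesis unfolding S_def using C(2) c(1)
      by (intro sum_pos2[of _ c]) (auto simp: q_def)
  qed
  obtain y where y: "y \<in> \<Omega>" "\<And>x. x \<in> \<Omega> \<Longrightarrow> S y \<le> S x"
    using continuous_attains_inf[OF \<Omega> S_cont] by blast
  define m where "m = S y"
  have m: "m > 0" unfolding m_def by (rule S_pos[OF y(1)])
  define \<kappa> where "\<kappa> x = 1 - q (1 - 2 / m * S x)" for x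
  define \<kappa>' where "\<kappa>' x v = 2 * max 0 (1 - 2 / m * S x) * (2 / m * S' x v)" for x v
  show ?thesis
  proof (intro exI conjI allI ballI impI)
    show "open {x. m / 2 < S x}" by (intro open_Collect_less continuous_on_const S_cont)
    show "\<Omega> \<subseteq> {x. m / 2 < S x}" using y m by (force simp: m_def)
    show "\<kappa> x = 1" if "x \<in> {x. m / 2 < S x}" for x
      using that m by (simp add: \<kappa>_def q_def max_def field_simps)
    show "compact (\<Union>c\<in>C. cball c (r c))" using C(2) by (intro compact_UN) auto
    show "(\<Union>c\<in>C. cball c (r c)) \<subseteq> W" using r C(1) by auto
    show "\<kappa> x = 0" if "x \<notin> (\<Union>c\<in>C. cball c (r c))" for x
    proof -
      have "q (p c x) = 0" if "c \<in> C" for c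
        using p_pos[OF that, of x] that \<open>x \<notin> _\<close> by (auto simp: q_def max_def)
      then show ?thesis by (simp add: \<kappa>_def S_def) (simp add: q_def)
    qed
    show "(\<kappa> has_derivative \<kappa>' x) (at x)" for x
    proof -
      have "((\<lambda>x. 1 - 2 / m * S x) has_derivative (\<lambda>v. - (2 / m * S' x v))) (at x)"
        using m by (auto intro!: derivative_eq_intros S)
      from has_derivative_compose[OF this has_field_derivative_imp_has_derivative[OF q]]
      have "((\<lambda>x. q (1 - 2 / m * S x)) has_derivative (\<lambda>v. - \<kappa>' x v)) (at x)" by (simp add: \<kappa>'_def)
      from has_derivative_diff[OF has_derivative_const this]
      show ?thesis unfolding \<kappa>_def[abs_def] by simp
    qed
    show "continuous_on UNIV (\<lambda>x. \<kappa>' x v)" for v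
      unfolding \<kappa>'_def by (intro continuous_intros S_cont S'_cont)
  qed
qed

text \<open>The formula is postulated for compactly supported \<open>C\<^sup>1\<close> fields on the whole space. A field defined near the cell is made
  into one by a cutoff that is 1 near the cell, so that neither the field nor its divergence changes there.\<close>

lemma gauss_green_near:
  fixes \<Omega> :: "(real^'d::finite) set"
  assumes elem: "mesh_element \<Omega> \<F> n" and W: "open W" "\<Omega> \<subseteq> W"
    and D: "\<And>x. x \<in> W \<Longrightarrow> (\<psi> has_derivative D x) (at x)" "\<And>v. continuous_on W (\<lambda>x. D x v)"
  shows "(LINT x:\<Omega>|lborel. (\<Sum>k\<in>UNIV. D x (axis k 1) $ k)) = (\<Sum>f\<in>\<F>. LINT x:f|surface_measure. \<psi> x \<bullet> n f x)"
proof -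
  have \<Omega>: "compact \<Omega>" "\<Omega> \<noteq> {}" and \<F>: "\<Union>\<F> = frontier \<Omega>" and normal: "outward_unit_normal \<Omega> \<F> n"
    using elem unfolding mesh_element_def by auto
  obtain \<kappa> :: "real^'d \<Rightarrow> real" and \<kappa>' V K where "open V" "\<Omega> \<subseteq> V" "\<forall>x\<in>V. \<kappa> x = 1"
    "compact K" "K \<subseteq> W" "\<forall>x. x \<notin> K \<longrightarrow> \<kappa> x = 0"
    "\<forall>x. (\<kappa> has_derivative \<kappa>' x) (at x)" "\<forall>v. continuous_on UNIV (\<lambda>x. \<kappa>' x v)"
    using C1_cutoff[OF \<Omega> W] by (elim exE conjE) (rule that; assumption)
  note V = this(1-3)[rule_format] and K = this(4-6)[rule_format] and \<kappa> = this(7,8)[rule_format]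
  define \<theta> where "\<theta> x = \<kappa> x *\<^sub>R \<psi> x" for x
  have inW: "(\<theta> has_derivative (\<lambda>v. \<kappa> x *\<^sub>R D x v + \<kappa>' x v *\<^sub>R \<psi> x)) (at x)" if "x \<in> W" for x
    unfolding \<theta>_def[abs_def] by (rule has_derivative_scaleR[OF \<kappa>(1) D(1)[OF that]])
  have outK: "(\<theta> has_derivative (\<lambda>v. 0)) (at x)" if "x \<in> - K" for x
    by (rule has_derivative_transform_within_open[of "\<lambda>x. 0" _ _ _ "- K"])
      (use that K in \<open>auto simp: \<theta>_def compact_imp_closed open_Compl\<close>)
  have cover: "UNIV = W \<union> - K" using K(2) by auto
  have \<psi>_cont: "continuous_on W \<psi>"
    by (intro continuous_at_imp_continuous_on ballI has_derivative_continuous[OF D(1)])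
  have \<kappa>_cont: "continuous_on W \<kappa>"
    by (intro continuous_at_imp_continuous_on ballI has_derivative_continuous[OF \<kappa>(1)])
  have "continuous_on (W \<union> - K) (\<lambda>x. frechet_derivative \<theta> (at x) v)" for v
  proof (rule continuous_on_open_Un)
    show "open W" "open (- K)" using W K by (auto simp: compact_imp_closed open_Compl)
    have "continuous_on W (\<lambda>x. \<kappa> x *\<^sub>R D x v + \<kappa>' x v *\<^sub>R \<psi> x)"
      by (intro continuous_intros D(2) \<psi>_cont \<kappa>_cont continuous_on_subset[OF \<kappa>(2)]) auto
    then show "continuous_on W (\<lambda>x. frechet_derivative \<theta> (at x) v)"
      by (rule continuous_on_eq) (simp add: frechet_derivative_at[OF inW, symmetric])
    show "continuous_on (- K) (\<lambda>x. frechet_derivative \<theta> (at x) v)"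
      by (rule continuous_on_eq[OF continuous_on_const[of _ 0]]) (simp add: frechet_derivative_at[OF outK, symmetric])
  qed
  then have "continuous_on UNIV (\<lambda>x. frechet_derivative \<theta> (at x) v)" for v
    by (simp only: cover[symmetric])
  moreover have "\<theta> differentiable (at x)" for x
    using inW[of x] outK[of x] K(2) unfolding differentiable_def by blast
  ultimately have "Ck_on 1 UNIV \<theta>" by simp
  moreover have "\<exists>K. compact K \<and> (\<forall>x. x \<notin> K \<longrightarrow> \<theta> x = 0)" using K by (intro exI[of _ K]) (auto simp: \<theta>_def)
  ultimately have gg: "(LINT x:\<Omega>|lborel. divergence \<theta> x) = (\<Sum>f\<in>\<F>. LINT x:f|surface_measure. \<theta> x \<bullet> n f x)"
    using normal unfolding outward_unit_normal_def by blast
  have div: "divergence \<theta> x = (\<Sum>k\<in>UNIV. D x (axis k 1) $ k)" if "x \<in> \<Omega>" for x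
  proof -
    have "(\<theta> has_derivative D x) (at x)"
      by (rule has_derivative_transform_within_open[OF D(1) V(1)])
        (use that V W in \<open>auto simp: \<theta>_def\<close>)
    then have "frechet_derivative \<theta> (at x) = D x" by (rule frechet_derivative_at[symmetric])
    then show ?thesis by (simp add: divergence_def partial_def)
  qed
  have face: "\<theta> x = \<psi> x" if "f \<in> \<F>" "x \<in> f" for f x
  proof -
    have "x \<in> \<Omega>" using that \<F> \<Omega>(1) by (metis UnionI compact_imp_closed frontier_subset_eq subsetD)
    then show ?thesis using V by (auto simp: \<theta>_def)
  qed
  have "(LINT x:\<Omega>|lborel. (\<Sum>k\<in>UNIV. D x (axis k 1) $ k)) = (LINT x:\<Omega>|lborel. divergence \<theta> x)"
    unfolding set_lebesgue_integral_def using div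
    by (intro Bochner_Integration.integral_cong[OF refl]) (auto simp: indicator_def)
  moreover have "(LINT x:f|surface_measure. \<theta> x \<bullet> n f x) = (LINT x:f|surface_measure. \<psi> x \<bullet> n f x)"
    if "f \<in> \<F>" for f
    unfolding set_lebesgue_integral_def using face[OF that]
    by (intro Bochner_Integration.integral_cong[OF refl]) (auto simp: indicator_def)
  ultimately show ?thesis using gg by simp
qed

section \<open>The energy balance of one element\<close>

text \<open>Continuity of each directional derivative suffices for the joint continuity of \<open>f' x v\<close> in \<open>x\<close> and \<open>v\<close>, because the space of
  directions is finite-dimensional.\<close>

lemma continuous_on_derivative_apply:
  fixes f' :: "'a::euclidean_space \<Rightarrow> 'b::euclidean_space \<Rightarrow> 'c::euclidean_space"
  assumes "\<And>x. x \<in> W \<Longrightarrow> linear (f' x)" "\<And>v. continuous_on W (\<lambda>x. f' x v)"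
    and p: "continuous_on A p" "p ` A \<subseteq> W" and q: "continuous_on A q"
  shows "continuous_on A (\<lambda>z. f' (p z) (q z))"
proof -
  have "f' (p z) (q z) = (\<Sum>b\<in>Basis. (q z \<bullet> b) *\<^sub>R f' (p z) b)" if "z \<in> A" for z
  proof -
    have "linear (f' (p z))" using assms(1) p(2) that by blast
    from linear_sum[OF this, of "\<lambda>b. (q z \<bullet> b) *\<^sub>R b" Basis] show ?thesis
      by (simp add: euclidean_representation linear_scale[OF \<open>linear (f' (p z))\<close>])
  qed
  moreover have "continuous_on A (\<lambda>z. \<Sum>b\<in>Basis. (q z \<bullet> b) *\<^sub>R f' (p z) b)"
    by (intro continuous_intros q continuous_on_compose2[OF assms(2) p])
  ultimately show ?thesis by (simp cong: continuous_on_cong)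
qed

lemma gradient_inner:
  assumes "(f has_derivative f') (at y)"
  shows "gradient f y \<bullet> z = f' z"
proof -
  have lin: "linear f'" using assms has_derivative_linear by blast
  have "f' z = f' (\<Sum>i\<in>UNIV. z $ i *\<^sub>R axis i 1)"
    using basis_expansion[of z] by (simp add: scalar_mult_eq_scaleR)
  also have "\<dots> = (\<Sum>i\<in>UNIV. z $ i * f' (axis i 1))"
    by (simp add: linear_sum[OF lin] linear_scale[OF lin])
  finally show ?thesis
    by (simp add: gradient_def partial_def frechet_derivative_at[OF assms, symmetric] inner_vec_def mult.commute)
qed

context energy_law
begin

text \<open>On the interior, the compatibility of \<open>e\<close> and \<open>g\<^sub>k\<close> turns the system into \<open>\<partial>\<^sub>t e(u) + \<partial>\<^sub>k g\<^sub>k(u) = 0\<close>. Both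
  terms are continuous up to the boundary, and the cell is the closure of its interior, so the law holds on the
  whole cell, where it can be integrated.\<close>

lemma element_energy_balance:
  fixes \<Omega> :: "(real^'d) set"
  assumes elem: "mesh_element \<Omega> \<F> n" and sol: "smooth_solution \<U> F I \<Omega> u" and I: "open I" "t \<in> I"
  shows "((\<lambda>s. LINT x:\<Omega>|lborel. e (u s x)) has_real_derivative
    (\<Sum>f\<in>\<F>. - (LINT x:f|surface_measure. (\<Sum>k\<in>UNIV. n f x $ k * g k (u t x))))) (at t)"
proof -
  have \<Omega>: "compact \<Omega>" "closure (interior \<Omega>) = \<Omega>" using elem unfolding mesh_element_def by auto
  define w where "w = (\<lambda>z. u (fst z) (snd z))"
  define w' where "w' z = frechet_derivative w (at z)" for z
  have "smooth_near (I \<times> \<Omega>) w"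
    using sol unfolding smooth_solution_def w_def by (simp add: case_prod_beta')
  then obtain W where W: "open W" "I \<times> \<Omega> \<subseteq> W" "\<And>z. z \<in> W \<Longrightarrow> (w has_derivative w' z) (at z)"
    "\<And>v. continuous_on W (\<lambda>z. w' z v)"
    unfolding w'_def by (rule smooth_near_C1) blast
  have w_cont: "continuous_on W w"
    by (intro continuous_at_imp_continuous_on ballI has_derivative_continuous[OF W(3)])
  have wU: "w z \<in> \<U>" if "z \<in> I \<times> \<Omega>" for z
    using sol that unfolding smooth_solution_def w_def by auto
  have uU: "u t x \<in> \<U>" if "x \<in> \<Omega>" for x
    using wU[of "(t, x)"] I that by (simp add: w_def)
  define e' where "e' y = frechet_derivative e (at y)" for y
  obtain We where We: "open We" "\<U> \<subseteq> We" "\<And>y. y \<in> We \<Longrightarrow> (e has_derivative e' y) (at y)"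
    "\<And>v. continuous_on We (\<lambda>y. e' y v)"
    unfolding e'_def by (rule smooth_near_C1[OF smooth(1)]) blast
  define g' where "g' k y = frechet_derivative (g k) (at y)" for k y
  have "\<exists>Wg. open Wg \<and> \<U> \<subseteq> Wg \<and> (\<forall>y\<in>Wg. (g k has_derivative g' k y) (at y)) \<and>
      (\<forall>v. continuous_on Wg (\<lambda>y. g' k y v))" for k
    unfolding g'_def by (rule smooth_near_C1[OF smooth(2)]) blast
  then obtain Wg where Wg: "\<And>k. open (Wg k)" "\<And>k. \<U> \<subseteq> Wg k"
    "\<And>k y. y \<in> Wg k \<Longrightarrow> (g k has_derivative g' k y) (at y)" "\<And>k v. continuous_on (Wg k) (\<lambda>y. g' k y v)"
    by metis
  have time: "((\<lambda>s. u s x) has_derivative (\<lambda>h. w' (s, x) (h, 0))) (at s)" if "(s, x) \<in> W" for s x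
  proof -
    have "((\<lambda>s. (s, x)) has_derivative (\<lambda>h. (h, 0))) (at s)" by (auto intro!: derivative_eq_intros)
    from has_derivative_compose[OF this W(3)[OF that]] show ?thesis by (simp add: w_def)
  qed
  have space: "(u s has_derivative (\<lambda>h. w' (s, x) (0, h))) (at x)" if "(s, x) \<in> W" for s x
  proof -
    have "((\<lambda>x. (s, x)) has_derivative (\<lambda>h. (0, h))) (at x)" by (auto intro!: derivative_eq_intros)
    from has_derivative_compose[OF this W(3)[OF that]] show ?thesis by (simp add: w_def)
  qed
  have time_lin: "w' (s, x) (h, 0) = h *\<^sub>R w' (s, x) (1, 0)" if "(s, x) \<in> W" for s x h
    using linear_scale[OF has_derivative_linear[OF W(3)[OF that]], of h "(1, 0)"] by simp
  define D where "D z = e' (w z) (w' z (1, 0))" for z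
  define Q where "Q x = (\<Sum>k\<in>UNIV. g' k (u t x) (w' (t, x) (0, axis k 1)))" for x
  have D_cont: "continuous_on (I \<times> \<Omega>) D"
    unfolding D_def
  proof (rule continuous_on_derivative_apply[where W = We and f' = e' and p = w and q = "\<lambda>z. w' z (1, 0)"])
    show "linear (e' y)" if "y \<in> We" for y by (rule has_derivative_linear[OF We(3)[OF that]])
    show "w ` (I \<times> \<Omega>) \<subseteq> We" using wU We(2) by blast
    show "continuous_on (I \<times> \<Omega>) w" "continuous_on (I \<times> \<Omega>) (\<lambda>z. w' z (1, 0))"
      by (rule continuous_on_subset[OF w_cont W(2)], rule continuous_on_subset[OF W(4) W(2)])
  qed (rule We(4))
  \<comment> \<open>\<open>D\<close> is \<open>\<partial>\<^sub>t e(u)\<close>, and \<open>Q\<close> is \<open>\<partial>\<^sub>k g\<^sub>k(u)\<close> at time \<open>t\<close>.\<close>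
  have at_t: "continuous_on \<Omega> (\<lambda>x. (t, x))" "(\<lambda>x. (t, x)) ` \<Omega> \<subseteq> I \<times> \<Omega>"
    using I by (auto intro!: continuous_intros)
  have ut_cont: "continuous_on \<Omega> (u s)" if "s \<in> I" for s
    using W(2) that by (intro continuous_at_imp_continuous_on ballI has_derivative_continuous[OF space]) blast
  have Q_cont: "continuous_on \<Omega> Q"
    unfolding Q_def
  proof (rule continuous_on_sum)
    fix k
    have "continuous_on \<Omega> (\<lambda>x. w' (t, x) (0, axis k 1))"
      by (rule continuous_on_compose2[OF W(4) at_t(1)]) (use at_t(2) W(2) in blast)
    then show "continuous_on \<Omega> (\<lambda>x. g' k (u t x) (w' (t, x) (0, axis k 1)))"
    proof (rule continuous_on_derivative_apply[where W = "Wg k" and f' = "g' k" and p = "u t", rotated 4])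
      show "linear (g' k y)" if "y \<in> Wg k" for y by (rule has_derivative_linear[OF Wg(3)[OF that]])
      show "u t ` \<Omega> \<subseteq> Wg k" using uU Wg(2) by blast
    qed (rule Wg(4) ut_cont I)+
  qed
  have law: "D (t, x) + Q x = 0" if x: "x \<in> \<Omega>" for x
  proof (rule continuous_constant_on_closure[of "interior \<Omega>"])
    show "continuous_on (closure (interior \<Omega>)) (\<lambda>x. D (t, x) + Q x)"
      unfolding \<Omega>(2) by (intro continuous_on_add Q_cont continuous_on_compose2[OF D_cont at_t])
    show "x \<in> closure (interior \<Omega>)" using x \<Omega>(2) by simp
    fix x assume xi: "x \<in> interior \<Omega>"
    then have x: "x \<in> \<Omega>" using interior_subset by blast
    have z: "(t, x) \<in> W" using x I W(2) by blast
    let ?y = "u t x"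
    have y: "?y \<in> \<U>" using wU[of "(t, x)"] x I by (simp add: w_def)
    have "(\<lambda>h. w' (t, x) (h, 0)) = (\<lambda>h. h *\<^sub>R w' (t, x) (1, 0))"
      by (rule ext) (rule time_lin[OF z])
    then have "((\<lambda>s. u s x) has_vector_derivative w' (t, x) (1, 0)) (at t)"
      using time[OF z] unfolding has_vector_derivative_def by simp
    then have vd: "vector_derivative (\<lambda>s. u s x) (at t) = w' (t, x) (1, 0)" by (rule vector_derivative_at)
    have pd: "partial k (u t) x = w' (t, x) (0, axis k 1)" for k
      unfolding partial_def frechet_derivative_at[OF space[OF z], symmetric] ..
    have "w' (t, x) (1, 0) + (\<Sum>k\<in>UNIV. flux_jacobian F k ?y *v w' (t, x) (0, axis k 1)) = 0"
      using sol xi I unfolding smooth_solution_def vd[symmetric] pd[symmetric] by blast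
    then have "0 = gradient e ?y \<bullet> (w' (t, x) (1, 0) + (\<Sum>k\<in>UNIV. flux_jacobian F k ?y *v w' (t, x) (0, axis k 1)))"
      by simp
    also have "\<dots> = gradient e ?y \<bullet> w' (t, x) (1, 0)
        + (\<Sum>k\<in>UNIV. (gradient e ?y v* flux_jacobian F k ?y) \<bullet> w' (t, x) (0, axis k 1))"
      by (simp add: inner_add_right inner_sum_right dot_lmul_matrix)
    also have "\<dots> = gradient e ?y \<bullet> w' (t, x) (1, 0) + (\<Sum>k\<in>UNIV. gradient (g k) ?y \<bullet> w' (t, x) (0, axis k 1))"
      by (simp add: compatible[OF y])
    also have "\<dots> = D (t, x) + Q x"
      using y We(2) Wg(2) by (simp add: D_def Q_def w_def gradient_inner[OF We(3)] gradient_inner[OF Wg(3)] subset_iff)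
    finally show "D (t, x) + Q x = 0" by simp
  qed
  have "((\<lambda>s. LINT x:\<Omega>|lborel. e (u s x)) has_real_derivative (LINT x:\<Omega>|lborel. D (t, x))) (at t)"
  proof (rule leibniz_rule_compact[OF \<Omega>(1) I _ D_cont])
    fix s assume s: "s \<in> I"
    show "continuous_on \<Omega> (\<lambda>x. e (u s x))"
      by (rule continuous_on_compose2[OF smooth_near_continuous_on[OF smooth(1)] ut_cont[OF s]])
        (use wU s in \<open>force simp: w_def\<close>)
    fix x assume x: "x \<in> \<Omega>"
    then have z: "(s, x) \<in> W" and y: "u s x \<in> We" using s W(2) wU[of "(s, x)"] We(2) by (auto simp: w_def)
    have "e' (u s x) (w' (s, x) (h, 0)) = h * D (s, x)" for h
      using linear_scale[OF has_derivative_linear[OF We(3)[OF y]]]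
      by (subst time_lin[OF z]) (simp add: w_def D_def)
    with has_derivative_compose[OF time[OF z] We(3)[OF y]]
    show "((\<lambda>s. e (u s x)) has_real_derivative D (s, x)) (at s)"
      by (simp add: has_field_derivative_def mult.commute[of _ "D (s, x)"])
  qed
  also have "(LINT x:\<Omega>|lborel. D (t, x)) = - (LINT x:\<Omega>|lborel. Q x)"
  proof -
    have "indicator \<Omega> x *\<^sub>R D (t, x) = - (indicator \<Omega> x *\<^sub>R Q x)" for x
      using law[of x] by (auto simp: indicator_def eq_neg_iff_add_eq_0)
    then show ?thesis unfolding set_lebesgue_integral_def by simp
  qed
  also have "(LINT x:\<Omega>|lborel. Q x)
      = (\<Sum>f\<in>\<F>. LINT x:f|surface_measure. (\<Sum>k\<in>UNIV. n f x $ k * g k (u t x)))"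
  proof -
    \<comment> \<open>\<open>W2\<close> is an open neighbourhood of the cell on which the flux field \<open>\<psi>\<close> with components \<open>g\<^sub>k(u)\<close> is \<open>C\<^sup>1\<close>.\<close>
    define W2 where "W2 = {x. (t, x) \<in> W \<and> u t x \<in> (\<Inter>k. Wg k)}"
    define \<psi> where "\<psi> x = (\<Sum>k\<in>UNIV. g k (u t x) *\<^sub>R axis k (1::real))" for x
    define \<psi>' where "\<psi>' x h = (\<Sum>k\<in>UNIV. g' k (u t x) (w' (t, x) (0, h)) *\<^sub>R axis k (1::real))" for x h
    have pre: "open {x. (t, x) \<in> W}"
      using open_vimage[OF W(1), of "Pair t"] by (simp add: vimage_def continuous_intros)
    have ut: "continuous_on {x. (t, x) \<in> W} (u t)"
      by (intro continuous_at_imp_continuous_on ballI has_derivative_continuous[OF space]) simp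
    have "open ({x. (t, x) \<in> W} \<inter> u t -` (\<Inter>k. Wg k))"
      by (rule continuous_open_preimage[OF ut pre]) (simp add: open_INT Wg(1))
    then have W2: "open W2" by (simp add: W2_def Collect_conj_eq vimage_def)
    have sub: "\<Omega> \<subseteq> W2"
    proof
      fix x assume x: "x \<in> \<Omega>"
      then have "(t, x) \<in> W" using W(2) I by blast
      moreover have "u t x \<in> Wg k" for k using uU[OF x] Wg(2) by blast
      ultimately show "x \<in> W2" by (simp add: W2_def)
    qed
    have "(\<psi> has_derivative \<psi>' x) (at x)" if "x \<in> W2" for x
      unfolding \<psi>_def[abs_def] \<psi>'_def[abs_def]
      using that by (intro has_derivative_sum has_derivative_scaleR_left
        has_derivative_compose[OF space Wg(3)]) (auto simp: W2_def)
    moreover have "continuous_on W2 (\<lambda>x. \<psi>' x h)" for h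
      unfolding \<psi>'_def
    proof (intro continuous_on_sum continuous_on_scaleR continuous_on_const)
      fix k
      have "continuous_on W2 (\<lambda>x. w' (t, x) (0, h))"
        by (rule continuous_on_compose2[OF W(4)]) (auto simp: W2_def intro!: continuous_intros)
      then show "continuous_on W2 (\<lambda>x. g' k (u t x) (w' (t, x) (0, h)))"
      proof (rule continuous_on_derivative_apply[where W = "Wg k" and f' = "g' k" and p = "u t", rotated 4])
        show "linear (g' k y)" if "y \<in> Wg k" for y by (rule has_derivative_linear[OF Wg(3)[OF that]])
        show "u t ` W2 \<subseteq> Wg k" by (auto simp: W2_def)
        show "continuous_on W2 (u t)" by (rule continuous_on_subset[OF ut]) (auto simp: W2_def)
      qed (rule Wg(4))
    qed
    ultimately have "(LINT x:\<Omega>|lborel. (\<Sum>k\<in>UNIV. \<psi>' x (axis k 1) $ k))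
        = (\<Sum>f\<in>\<F>. LINT x:f|surface_measure. \<psi> x \<bullet> n f x)"
      by (rule gauss_green_near[OF elem W2 sub])
    moreover have "(\<Sum>k\<in>UNIV. \<psi>' x (axis k 1) $ k) = Q x" for x
      by (simp add: \<psi>'_def Q_def axis_def if_distrib cong: if_cong)
    moreover have "\<psi> x \<bullet> n f x = (\<Sum>k\<in>UNIV. n f x $ k * g k (u t x))" for f x
      by (simp add: \<psi>_def inner_sum_left inner_axis' mult.commute)
    ultimately show ?thesis by simp
  qed
  finally show ?thesis by (simp add: sum_negf)
qed

end

section \<open>Faces of a union of elements\<close>

lemma is_mesh_opposite_normals:
  assumes "is_mesh \<T> faces n" "\<Omega> \<in> \<T>" "\<Omega>' \<in> \<T>" "\<Omega> \<noteq> \<Omega>'" "f \<in> faces \<Omega>" "f \<in> faces \<Omega>'" "x \<in> f"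
  shows "n \<Omega>' f x = - n \<Omega> f x"
proof -
  have "\<forall>\<Omega>\<in>\<T>. \<forall>\<Omega>'\<in>\<T>. \<Omega> \<noteq> \<Omega>' \<longrightarrow>
      (\<forall>f\<in>faces \<Omega> \<inter> faces \<Omega>'. \<forall>x\<in>f. n \<Omega>' f x = - n \<Omega> f x)"
    using assms(1) unfolding is_mesh_def by (elim conjE)
  then show ?thesis using assms(2-) by blast
qed

lemma mesh_face_frontier:
  assumes "mesh_element \<Omega> \<F> n" "f \<in> \<F>"
  shows "f \<subseteq> \<Omega>" "compact f" "f \<noteq> {}" "emeasure surface_measure f < \<infinity>"
proof -
  have el: "compact \<Omega>" "\<Union>\<F> = frontier \<Omega>" "emeasure surface_measure (frontier \<Omega>) < \<infinity>"
    and f: "compact f" "f \<noteq> {}"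
    using assms unfolding mesh_element_def by auto
  have fr: "f \<subseteq> frontier \<Omega>" using el(2) assms(2) by blast
  show "compact f" "f \<noteq> {}" by (fact f)+
  show "f \<subseteq> \<Omega>" using fr frontier_subset_eq[of \<Omega>] compact_imp_closed[OF el(1)] by blast
  have "emeasure surface_measure f \<le> emeasure surface_measure (frontier \<Omega>)"
    using fr by (intro emeasure_mono) (simp_all add: sets_surface_measure borel_closed)
  then show "emeasure surface_measure f < \<infinity>" using el(3) by (rule le_less_trans)
qed

text \<open>A face of an element of \<open>\<D>\<close> that is not on the boundary of the union has \<open>\<D>\<close> on its other side: an
  element outside \<open>\<D>\<close> is the closure of its interior, which is disjoint from the interiors of the finitely many
  elements of \<open>\<D>\<close>, so it cannot reach into the interior of their union.\<close>

lemma interior_face_neighbour: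
  assumes mesh: "is_mesh \<T> faces n" and D: "\<D> \<subseteq> \<T>" "finite \<D>"
    and f: "\<Omega> \<in> \<D>" "f \<in> faces \<Omega>" "\<not> f \<subseteq> frontier (\<Union>\<D>)"
  obtains \<Omega>' where "\<Omega>' \<in> \<D>" "\<Omega>' \<noteq> \<Omega>" "f \<in> faces \<Omega>'"
proof -
  have elem: "mesh_element \<Omega> (faces \<Omega>) (n \<Omega>)" if "\<Omega> \<in> \<T>" for \<Omega>
    using mesh that unfolding is_mesh_def by simp
  have clos: "closure (interior \<Omega>) = \<Omega>" if "\<Omega> \<in> \<T>" for \<Omega>
    using elem[OF that] unfolding mesh_element_def by simp
  have "\<forall>\<Omega>\<in>\<T>. \<forall>f\<in>faces \<Omega>. f \<subseteq> frontier (\<Union>\<T>) \<or> (\<exists>\<Omega>'\<in>\<T>. \<Omega>' \<noteq> \<Omega> \<and> f \<in> faces \<Omega>')"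
    using mesh unfolding is_mesh_def by simp
  note neighbour = this[rule_format]
  have sub: "f \<subseteq> \<Union>\<D>" using mesh_face_frontier(1)[OF elem f(2)] f(1) D(1) by blast
  then obtain x where x: "x \<in> f" "x \<in> interior (\<Union>\<D>)"
    using f(3) closure_subset[of "\<Union>\<D>"] unfolding frontier_def by blast
  have "x \<in> interior (\<Union>\<T>)" using x(2) interior_mono[OF Union_mono[OF D(1)]] by blast
  then have "\<not> f \<subseteq> frontier (\<Union>\<T>)" using x(1) unfolding frontier_def by blast
  then obtain \<Omega>' where \<Omega>': "\<Omega>' \<in> \<T>" "\<Omega>' \<noteq> \<Omega>" "f \<in> faces \<Omega>'"
    using neighbour[of \<Omega> f] f D(1) by blast
  have "\<Omega>' \<in> \<D>"
  proof (rule ccontr)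
    assume out: "\<Omega>' \<notin> \<D>"
    have "x \<in> closure (interior \<Omega>')"
      using x(1) mesh_face_frontier(1)[OF elem[OF \<Omega>'(1)] \<Omega>'(3)] clos[OF \<Omega>'(1)] by auto
    then have "interior (\<Union>\<D>) \<inter> interior \<Omega>' \<noteq> {}"
      using x(2) open_Int_closure_eq_empty[OF open_interior, of "\<Union>\<D>" "interior \<Omega>'"] by blast
    then obtain y where y: "y \<in> interior (\<Union>\<D>)" "y \<in> interior \<Omega>'" by blast
    then obtain \<Omega>'' where \<Omega>'': "\<Omega>'' \<in> \<D>" "y \<in> \<Omega>''" using interior_subset by blast
    have "y \<in> closure (interior \<Omega>'')" using \<Omega>'' D(1) clos by auto
    then have "interior \<Omega>' \<inter> interior \<Omega>'' \<noteq> {}"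
      using y(2) open_Int_closure_eq_empty[OF open_interior, of \<Omega>' "interior \<Omega>''"] by blast
    moreover have "\<Omega>' \<noteq> \<Omega>''" "\<Omega>'' \<in> \<T>" using out \<Omega>'' D(1) by auto
    ultimately show False using mesh \<Omega>'(1) unfolding is_mesh_def by simp
  qed
  then show ?thesis using that \<Omega>' by blast
qed

text \<open>The unit normals of three elements at a common face would be pairwise opposite, which is impossible.\<close>

lemma face_shared_by_two:
  assumes mesh: "is_mesh \<T> faces n" and T: "\<Omega> \<in> \<T>" "\<Omega>' \<in> \<T>" "\<Omega>'' \<in> \<T>"
    and f: "f \<in> faces \<Omega>" "f \<in> faces \<Omega>'" "f \<in> faces \<Omega>''"
    and ne: "\<Omega> \<noteq> \<Omega>'" "\<Omega> \<noteq> \<Omega>''"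
  shows "\<Omega>' = \<Omega>''"
proof (rule ccontr)
  assume ne': "\<Omega>' \<noteq> \<Omega>''"
  have elem: "mesh_element \<Omega> (faces \<Omega>) (n \<Omega>)" using mesh T(1) unfolding is_mesh_def by simp
  obtain x where x: "x \<in> f" using mesh_face_frontier(3)[OF elem f(1)] by blast
  have "n \<Omega> f x = - n \<Omega> f x"
    using is_mesh_opposite_normals[OF mesh T(1,2) ne(1) f(1,2) x]
      is_mesh_opposite_normals[OF mesh T(1,3) ne(2) f(1,3) x]
      is_mesh_opposite_normals[OF mesh T(2,3) ne' f(2,3) x]
    by (metis minus_minus)
  then have "n \<Omega> f x = 0" by (simp add: vec_eq_iff)
  moreover have "norm (n \<Omega> f x) = 1"
    using elem f(1) x unfolding mesh_element_def outward_unit_normal_def by simp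
  ultimately show False by simp
qed

text \<open>Faces off the boundary of the union occur for exactly two elements, with opposite contributions.\<close>

lemma sum_boundary_faces:
  fixes b :: "(real^'d::finite) set \<Rightarrow> (real^'d) set \<Rightarrow> real"
  assumes mesh: "is_mesh \<T> faces n" and D: "\<D> \<subseteq> \<T>" "finite \<D>"
    and anti: "\<And>\<Omega> \<Omega>' f. \<Omega> \<in> \<T> \<Longrightarrow> \<Omega>' \<in> \<T> \<Longrightarrow> \<Omega> \<noteq> \<Omega>' \<Longrightarrow> f \<in> faces \<Omega> \<inter> faces \<Omega>' \<Longrightarrow> b \<Omega> f + b \<Omega>' f = 0"
  shows "(\<Sum>\<Omega>\<in>\<D>. \<Sum>f\<in>faces \<Omega>. b \<Omega> f)
    = (\<Sum>\<Omega>\<in>\<D>. \<Sum>f | f \<in> faces \<Omega> \<and> f \<subseteq> frontier (\<Union>\<D>). b \<Omega> f)"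
proof -
  define X where "X = {f \<in> (\<Union>\<Omega>\<in>\<D>. faces \<Omega>). \<not> f \<subseteq> frontier (\<Union>\<D>)}"
  have fin: "finite (faces \<Omega>)" if "\<Omega> \<in> \<D>" for \<Omega>
    using mesh subsetD[OF D(1) that] unfolding is_mesh_def mesh_element_def by simp
  then have X: "finite X" using D(2) by (simp add: X_def)
  have "(\<Sum>f\<in>faces \<Omega>. b \<Omega> f) = (\<Sum>f | f \<in> faces \<Omega> \<and> f \<subseteq> frontier (\<Union>\<D>). b \<Omega> f) + (\<Sum>f | f \<in> X \<and> f \<in> faces \<Omega>. b \<Omega> f)"
    if "\<Omega> \<in> \<D>" for \<Omega>
  proof -
    have "faces \<Omega> = {f. f \<in> faces \<Omega> \<and> f \<subseteq> frontier (\<Union>\<D>)} \<union> {f. f \<in> X \<and> f \<in> faces \<Omega>}"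
      using that by (auto simp: X_def)
    then show ?thesis using fin[OF that]
      by (subst sum.union_disjoint[symmetric]) (auto simp: X_def)
  qed
  then have "(\<Sum>\<Omega>\<in>\<D>. \<Sum>f\<in>faces \<Omega>. b \<Omega> f) = (\<Sum>\<Omega>\<in>\<D>. \<Sum>f | f \<in> faces \<Omega> \<and> f \<subseteq> frontier (\<Union>\<D>). b \<Omega> f)
      + (\<Sum>\<Omega>\<in>\<D>. \<Sum>f | f \<in> X \<and> f \<in> faces \<Omega>. b \<Omega> f)"
    by (simp add: sum.distrib)
  moreover have "(\<Sum>\<Omega>\<in>\<D>. \<Sum>f | f \<in> X \<and> f \<in> faces \<Omega>. b \<Omega> f) = (\<Sum>f\<in>X. \<Sum>\<Omega> | \<Omega> \<in> \<D> \<and> f \<in> faces \<Omega>. b \<Omega> f)"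
    by (rule sum.swap_restrict[OF D(2) X])
  moreover have "(\<Sum>\<Omega> | \<Omega> \<in> \<D> \<and> f \<in> faces \<Omega>. b \<Omega> f) = 0" if "f \<in> X" for f
  proof -
    from that obtain \<Omega> where \<Omega>: "\<Omega> \<in> \<D>" "f \<in> faces \<Omega>" "\<not> f \<subseteq> frontier (\<Union>\<D>)" by (auto simp: X_def)
    obtain \<Omega>' where \<Omega>': "\<Omega>' \<in> \<D>" "\<Omega>' \<noteq> \<Omega>" "f \<in> faces \<Omega>'"
      by (rule interior_face_neighbour[OF mesh D \<Omega>])
    have "{\<Omega>. \<Omega> \<in> \<D> \<and> f \<in> faces \<Omega>} = {\<Omega>, \<Omega>'}"
      using \<Omega> \<Omega>' D(1) face_shared_by_two[OF mesh, of \<Omega> \<Omega>' _ f] by blast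
    then show ?thesis using anti[of \<Omega> \<Omega>' f] \<Omega> \<Omega>' D(1) by auto
  qed
  ultimately show ?thesis by simp
qed

section \<open>Energy transfer between modes and elements\<close>

lemma smooth_solution_trace:
  assumes "smooth_solution \<U> F I \<Omega> u" "t \<in> I"
  shows "continuous_on \<Omega> (u t)" "u t ` \<Omega> \<subseteq> \<U>"
proof -
  have "continuous_on (I \<times> \<Omega>) (\<lambda>(t, x). u t x)"
    using assms unfolding smooth_solution_def by (blast intro: smooth_near_continuous_on)
  then have "continuous_on \<Omega> (\<lambda>x. case (t, x) of (t, x) \<Rightarrow> u t x)"
    by (rule continuous_on_compose2) (use assms(2) in \<open>auto intro!: continuous_intros\<close>)
  then show "continuous_on \<Omega> (u t)" by simp
  show "u t ` \<Omega> \<subseteq> \<U>" using assms unfolding smooth_solution_def by blast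
qed

text \<open>Parseval's identity for the weight \<open>H(u)\<close>, which is scaled such that \<open>1/2 u \<bullet> H(u) u = e(u)\<close>.\<close>

lemma (in energy_law) modal_energy_has_sum:
  assumes "compact \<Omega>" "modal_basis \<Omega> \<phi>" and v: "continuous_on \<Omega> v" "v ` \<Omega> \<subseteq> \<U>"
    and R: "cholesky_factor (mass_matrix e \<Omega> \<phi> v) R"
    and l2: "l2_has_sum lborel \<Omega> (\<lambda>\<alpha> x. basis_block \<phi> \<alpha> x *v U \<alpha>) v"
  shows "(modal_energy R U has_sum (LINT x:\<Omega>|lborel. e (v x))) UNIV"
proof -
  have vU: "v x \<in> \<U>" if "x \<in> \<Omega>" for x using v(2) that by blast
  interpret weighted_modes \<Omega> \<phi> "\<lambda>x. energy_matrix e (v x)" R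
  proof
    show "continuous_on \<Omega> (\<lambda>x. energy_matrix e (v x))"
      by (rule continuous_on_compose2[OF energy_matrix_continuous v])
    show "transpose (energy_matrix e (v x)) = energy_matrix e (v x)" if "x \<in> \<Omega>" for x
      using energy_matrix_spd[OF vU[OF that]] unfolding spd_def by blast
    show "0 \<le> y \<bullet> (energy_matrix e (v x) *v y)" if "x \<in> \<Omega>" for x y
      using energy_matrix_spd[OF vU[OF that]] unfolding spd_def by (cases "y = 0") (auto intro: less_imp_le)
    show "cholesky_factor (\<lambda>\<alpha> \<beta>. LINT x:\<Omega>|lborel. transpose (basis_block \<phi> \<alpha> x)
        ** energy_matrix e (v x) ** basis_block \<phi> \<beta> x) R"
      using R unfolding mass_matrix_def[abs_def] .
  qed (use assms in auto)
  have "1/2 * (LINT x:\<Omega>|lborel. v x \<bullet> (energy_matrix e (v x) *v v x)) = (LINT x:\<Omega>|lborel. e (v x))"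
    unfolding set_lebesgue_integral_def integral_mult_right_zero[symmetric]
    using energy_quadratic[OF vU] by (intro Bochner_Integration.integral_cong[OF refl]) (auto simp: indicator_def)
  then show ?thesis using parseval[OF v(1) l2] by simp
qed

theorem theorem4p12:
  fixes \<U> :: "'m::{finite,linorder} state set"
    and F :: "'d::finite \<Rightarrow> 'm state \<Rightarrow> 'm state"
    and e :: "'m state \<Rightarrow> real"
    and g :: "'d \<Rightarrow> 'm state \<Rightarrow> real"
    and G :: "'d \<Rightarrow> 'm state \<Rightarrow> 'm state_matrix"
    and c\<^sub>H C\<^sub>H :: real
    and \<T> :: "(real^'d) set set"
    and faces :: "(real^'d) set \<Rightarrow> (real^'d) set set"
    and n :: "(real^'d) set \<Rightarrow> (real^'d) set \<Rightarrow> real^'d \<Rightarrow> real^'d"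
    and I :: "real set"
    and \<phi> :: "(real^'d) set \<Rightarrow> nat \<Rightarrow> real^'d \<Rightarrow> real"
    and u :: "(real^'d) set \<Rightarrow> real \<Rightarrow> real^'d \<Rightarrow> 'm state"
    and U :: "(real^'d) set \<Rightarrow> real \<Rightarrow> nat \<Rightarrow> 'm state"
    and R :: "(real^'d) set \<Rightarrow> real \<Rightarrow> 'm block_matrix"
    and E :: "(real^'d) set \<Rightarrow> real \<Rightarrow> nat \<Rightarrow> real"
    and B :: "(real^'d) set \<Rightarrow> (real^'d) set \<Rightarrow> real \<Rightarrow> nat \<Rightarrow> real"
    and P :: "(real^'d) set \<Rightarrow> (real^'d) set \<Rightarrow> (real^'d) set \<Rightarrow> real \<Rightarrow> nat \<Rightarrow> nat \<Rightarrow> real"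
  assumes system: "energy_system \<U> F e g G c\<^sub>H C\<^sub>H"
    and mesh: "is_mesh \<T> faces n"
    and interval: "open I" "is_interval I"
    and basis: "\<And>\<Omega>. \<Omega> \<in> \<T> \<Longrightarrow> modal_basis \<Omega> (\<phi> \<Omega>)"
    and solution: "\<And>\<Omega>. \<Omega> \<in> \<T> \<Longrightarrow> smooth_solution \<U> F I \<Omega> (u \<Omega>)"
    and trace: "\<And>\<Omega> \<Omega>' f t x. \<lbrakk>\<Omega> \<in> \<T>; \<Omega>' \<in> \<T>; f \<in> faces \<Omega> \<inter> faces \<Omega>'; t \<in> I; x \<in> f\<rbrakk>
                  \<Longrightarrow> u \<Omega> t x = u \<Omega>' t x"
    and expansion: "\<And>\<Omega> t. \<lbrakk>\<Omega> \<in> \<T>; t \<in> I\<rbrakk>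
                  \<Longrightarrow> l2_has_sum lborel \<Omega> (\<lambda>\<alpha> x. basis_block (\<phi> \<Omega>) \<alpha> x *v U \<Omega> t \<alpha>) (u \<Omega> t)"
    and galerkin: "\<And>\<Omega>. \<Omega> \<in> \<T> \<Longrightarrow> galerkin_system F e I \<Omega> (\<phi> \<Omega>) (u \<Omega>) (U \<Omega>)"
    and cholesky: "\<And>\<Omega> t. \<lbrakk>\<Omega> \<in> \<T>; t \<in> I\<rbrakk>
                  \<Longrightarrow> cholesky_factor (mass_matrix e \<Omega> (\<phi> \<Omega>) (u \<Omega> t)) (R \<Omega> t)"
    and face_expansion: "\<And>\<Omega> f t. \<lbrakk>\<Omega> \<in> \<T>; f \<in> faces \<Omega>; t \<in> I\<rbrakk>
                  \<Longrightarrow> l2_has_sum surface_measure f (orth_mode (\<phi> \<Omega>) (R \<Omega> t) (U \<Omega> t)) (u \<Omega> t)"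
    and nonzero: "\<And>\<Omega> t. \<lbrakk>\<Omega> \<in> \<T>; t \<in> I\<rbrakk> \<Longrightarrow> \<exists>\<alpha>. orth_coeff (R \<Omega> t) (U \<Omega> t) \<alpha> \<noteq> 0"
  defines "E \<equiv> \<lambda>\<Omega> t \<alpha>. modal_energy (R \<Omega> t) (U \<Omega> t) \<alpha>"
    and "B \<equiv> \<lambda>\<Omega> f t \<alpha>. face_power F e G f (n \<Omega> f) (\<phi> \<Omega>) (R \<Omega> t) (U \<Omega> t) (u \<Omega> t) \<alpha>"
    and "P \<equiv> \<lambda>\<Omega> f \<Omega>' t \<alpha> \<gamma>. pair_power G f (n \<Omega> f) (u \<Omega> t)
                  (orth_mode (\<phi> \<Omega>) (R \<Omega> t) (U \<Omega> t) \<alpha>) (orth_mode (\<phi> \<Omega>') (R \<Omega>' t) (U \<Omega>' t) \<gamma>)"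
  shows "(\<forall>\<Omega>\<in>\<T>. \<forall>\<Omega>\<^sub>f\<in>\<T>. \<forall>f\<in>faces \<Omega> \<inter> faces \<Omega>\<^sub>f. \<forall>t\<in>I. \<Omega> \<noteq> \<Omega>\<^sub>f \<longrightarrow>
            (\<forall>\<alpha>. ((\<lambda>\<gamma>. P \<Omega> f \<Omega>\<^sub>f t \<alpha> \<gamma>) has_sum B \<Omega> f t \<alpha>) UNIV) \<and>
            (\<forall>\<gamma>. ((\<lambda>\<alpha>. P \<Omega>\<^sub>f f \<Omega> t \<gamma> \<alpha>) has_sum B \<Omega>\<^sub>f f t \<gamma>) UNIV) \<and>
            (\<forall>\<alpha> \<gamma>. P \<Omega>\<^sub>f f \<Omega> t \<gamma> \<alpha> = - P \<Omega> f \<Omega>\<^sub>f t \<alpha> \<gamma>) \<and>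
            B \<Omega> f t summable_on UNIV \<and> B \<Omega>\<^sub>f f t summable_on UNIV \<and>
            (\<Sum>\<^sub>\<infinity>\<alpha>. B \<Omega> f t \<alpha>) + (\<Sum>\<^sub>\<infinity>\<gamma>. B \<Omega>\<^sub>f f t \<gamma>) = 0) \<and>
         (\<forall>\<D> t. \<D> \<subseteq> \<T> \<and> finite \<D> \<and> t \<in> I \<longrightarrow>
            (\<forall>\<Omega>\<in>\<D>. E \<Omega> t summable_on UNIV) \<and>
            (\<forall>\<Omega>\<in>\<D>. \<forall>f\<in>faces \<Omega>. f \<subseteq> frontier (\<Union>\<D>) \<longrightarrow> B \<Omega> f t summable_on UNIV) \<and>
            ((\<lambda>s. \<Sum>\<Omega>\<in>\<D>. \<Sum>\<^sub>\<infinity>\<alpha>. E \<Omega> s \<alpha>) has_real_derivative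
               (\<Sum>\<Omega>\<in>\<D>. \<Sum>f | f \<in> faces \<Omega> \<and> f \<subseteq> frontier (\<Union>\<D>). \<Sum>\<^sub>\<infinity>\<alpha>. B \<Omega> f t \<alpha>)) (at t))"
proof -
  interpret energy_law \<U> F e g G c\<^sub>H C\<^sub>H by unfold_locales (rule system)
  have elem: "mesh_element \<Omega> (faces \<Omega>) (n \<Omega>)" if "\<Omega> \<in> \<T>" for \<Omega>
    using mesh that unfolding is_mesh_def by simp
  have face: "energy_face \<U> F e g G c\<^sub>H C\<^sub>H f (n \<Omega> f) (u \<Omega> t)" if "\<Omega> \<in> \<T>" "f \<in> faces \<Omega>" "t \<in> I" for \<Omega> f t
  proof
    note fr = mesh_face_frontier[OF elem[OF that(1)] that(2)]
    note tr = smooth_solution_trace[OF solution[OF that(1)] that(3)]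
    show "compact f" "emeasure surface_measure f < \<infinity>" by (fact fr)+
    show "n \<Omega> f \<in> borel_measurable borel"
      using elem[OF that(1)] that(2) unfolding mesh_element_def outward_unit_normal_def by simp
    show "norm (n \<Omega> f x) = 1" if "x \<in> f" for x
      using elem[OF \<open>\<Omega> \<in> \<T>\<close>] \<open>f \<in> faces \<Omega>\<close> that unfolding mesh_element_def outward_unit_normal_def by simp
    show "continuous_on f (u \<Omega> t)" by (rule continuous_on_subset[OF tr(1) fr(1)])
    show "u \<Omega> t ` f \<subseteq> \<U>" using tr(2) fr(1) by blast
  qed
  let ?w = "\<lambda>\<Omega> t. orth_mode (\<phi> \<Omega>) (R \<Omega> t) (U \<Omega> t)"
  let ?p = "\<lambda>\<Omega> f t. pair_power G f (n \<Omega> f) (u \<Omega> t)"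
  have B_eq: "B \<Omega> f t \<alpha> = ?p \<Omega> f t (?w \<Omega> t \<alpha>) (u \<Omega> t)"
    and B_sum: "(B \<Omega> f t has_sum ?p \<Omega> f t (u \<Omega> t) (u \<Omega> t)) UNIV"
    and B_total: "?p \<Omega> f t (u \<Omega> t) (u \<Omega> t) = - (LINT x:f|surface_measure. (\<Sum>k\<in>UNIV. n \<Omega> f x $ k * g k (u \<Omega> t x)))"
    if "\<Omega> \<in> \<T>" "f \<in> faces \<Omega>" "t \<in> I" for \<Omega> f t \<alpha>
  proof -
    interpret energy_face \<U> F e g G c\<^sub>H C\<^sub>H f "n \<Omega> f" "u \<Omega> t" by (rule face[OF that])
    note a = cholesky[OF that(1,3)] basis[OF that(1)] face_expansion[OF that]
    show "B \<Omega> f t \<alpha> = ?p \<Omega> f t (?w \<Omega> t \<alpha>) (u \<Omega> t)"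
      unfolding B_def by (rule face_power_eq_pair_power[OF a])
    show "(B \<Omega> f t has_sum ?p \<Omega> f t (u \<Omega> t) (u \<Omega> t)) UNIV"
      unfolding B_def using face_power_has_sum[OF a] by simp
    show "?p \<Omega> f t (u \<Omega> t) (u \<Omega> t) = - (LINT x:f|surface_measure. (\<Sum>k\<in>UNIV. n \<Omega> f x $ k * g k (u \<Omega> t x)))"
      by (rule total_face_power)
  qed
  have anti: "?p \<Omega>' f t w' w = - ?p \<Omega> f t w w'"
    if "\<Omega> \<in> \<T>" "\<Omega>' \<in> \<T>" "\<Omega> \<noteq> \<Omega>'" "f \<in> faces \<Omega> \<inter> faces \<Omega>'" "t \<in> I" for \<Omega> \<Omega>' f t w w'
  proof (rule pair_power_antisymmetric)
    fix x assume x: "x \<in> f"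
    show "n \<Omega>' f x = - n \<Omega> f x" 
      using is_mesh_opposite_normals[OF mesh that(1-3) _ _ x] that(4) by simp
    show "u \<Omega>' t x = u \<Omega> t x" using trace[OF that(1,2,4,5) x] by simp
    have "x \<in> \<Omega>" using mesh_face_frontier(1)[OF elem[OF that(1)]] that(4) x by blast
    then show "u \<Omega> t x \<in> \<U>" using smooth_solution_trace(2)[OF solution[OF that(1)] that(5)] by blast
  qed
  have P_sum: "((\<lambda>\<gamma>. P \<Omega> f \<Omega>' t \<alpha> \<gamma>) has_sum B \<Omega> f t \<alpha>) UNIV"
    if "\<Omega> \<in> \<T>" "\<Omega>' \<in> \<T>" "\<Omega> \<noteq> \<Omega>'" "f \<in> faces \<Omega> \<inter> faces \<Omega>'" "t \<in> I" for \<Omega> \<Omega>' f t \<alpha>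
  proof -
    have f: "f \<in> faces \<Omega>" "f \<in> faces \<Omega>'" using that(4) by auto
    interpret energy_face \<U> F e g G c\<^sub>H C\<^sub>H f "n \<Omega> f" "u \<Omega> t" by (rule face[OF that(1) f(1) that(5)])
    have "l2_has_sum surface_measure f (?w \<Omega>' t) (u \<Omega>' t)" by (rule face_expansion[OF that(2) f(2) that(5)])
    then have "l2_has_sum surface_measure f (?w \<Omega>' t) (u \<Omega> t)"
      using l2_has_sum_cong[of f "u \<Omega>' t" "u \<Omega> t"] trace[OF that(1,2,4,5)] by simp
    then show ?thesis
      unfolding P_def B_eq[OF that(1) f(1) that(5)]
      by (intro pair_power_has_sum orth_mode_bdd[OF cholesky[OF that(1,5)] basis[OF that(1)]]
          orth_mode_bdd[OF cholesky[OF that(2,5)] basis[OF that(2)]])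
  qed
  have cancel: "(\<Sum>\<^sub>\<infinity>\<alpha>. B \<Omega> f t \<alpha>) + (\<Sum>\<^sub>\<infinity>\<gamma>. B \<Omega>' f t \<gamma>) = 0"
    if "\<Omega> \<in> \<T>" "\<Omega>' \<in> \<T>" "\<Omega> \<noteq> \<Omega>'" "f \<in> faces \<Omega> \<inter> faces \<Omega>'" "t \<in> I" for \<Omega> \<Omega>' f t
  proof -
    have f: "f \<in> faces \<Omega>" "f \<in> faces \<Omega>'" using that(4) by auto
    have "?p \<Omega>' f t (u \<Omega>' t) (u \<Omega>' t) = - ?p \<Omega> f t (u \<Omega>' t) (u \<Omega>' t)" by (rule anti[OF that])
    also have "?p \<Omega> f t (u \<Omega>' t) (u \<Omega>' t) = ?p \<Omega> f t (u \<Omega> t) (u \<Omega> t)"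
      unfolding pair_power_def set_lebesgue_integral_def using trace[OF that(1,2,4,5)]
      by (intro arg_cong[where f = "\<lambda>z. _ * z"] Bochner_Integration.integral_cong[OF refl]) (auto simp: indicator_def)
    finally show ?thesis
      using infsumI[OF B_sum[OF that(1) f(1) that(5)]] infsumI[OF B_sum[OF that(2) f(2) that(5)]] by simp
  qed
  have E_sum: "(E \<Omega> t has_sum (LINT x:\<Omega>|lborel. e (u \<Omega> t x))) UNIV" if "\<Omega> \<in> \<T>" "t \<in> I" for \<Omega> t
  proof -
    have "compact \<Omega>" using elem[OF that(1)] unfolding mesh_element_def by blast
    from modal_energy_has_sum[OF this basis[OF that(1)] smooth_solution_trace[OF solution[OF that(1)] that(2)]
        cholesky[OF that] expansion[OF that]]
    show ?thesis unfolding E_def by simp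
  qed
  have balance: "((\<lambda>s. \<Sum>\<^sub>\<infinity>\<alpha>. E \<Omega> s \<alpha>) has_real_derivative (\<Sum>f\<in>faces \<Omega>. \<Sum>\<^sub>\<infinity>\<alpha>. B \<Omega> f t \<alpha>)) (at t)"
    if "\<Omega> \<in> \<T>" "t \<in> I" for \<Omega> t
  proof -
    have faces_sum: "(\<Sum>f\<in>faces \<Omega>. \<Sum>\<^sub>\<infinity>\<alpha>. B \<Omega> f t \<alpha>)
        = (\<Sum>f\<in>faces \<Omega>. - (LINT x:f|surface_measure. (\<Sum>k\<in>UNIV. n \<Omega> f x $ k * g k (u \<Omega> t x))))"
    proof (rule sum.cong[OF refl])
      fix f assume f: "f \<in> faces \<Omega>"
      show "(\<Sum>\<^sub>\<infinity>\<alpha>. B \<Omega> f t \<alpha>) = - (LINT x:f|surface_measure. (\<Sum>k\<in>UNIV. n \<Omega> f x $ k * g k (u \<Omega> t x)))"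
        using infsumI[OF B_sum[OF that(1) f that(2)]] B_total[OF that(1) f that(2)] by (rule trans)
    qed
    have energy: "(LINT x:\<Omega>|lborel. e (u \<Omega> s x)) = (\<Sum>\<^sub>\<infinity>\<alpha>. E \<Omega> s \<alpha>)" if "s \<in> I" for s
      by (rule infsumI[OF E_sum[OF \<open>\<Omega> \<in> \<T>\<close> that], symmetric])
    show ?thesis
      unfolding faces_sum
      by (rule has_field_derivative_transform_within_open[OF element_energy_balance[OF elem[OF that(1)]
            solution[OF that(1)] interval(1) that(2)] interval(1) that(2) energy])
  qed
  have total: "((\<lambda>s. \<Sum>\<Omega>\<in>\<D>. \<Sum>\<^sub>\<infinity>\<alpha>. E \<Omega> s \<alpha>) has_real_derivative
      (\<Sum>\<Omega>\<in>\<D>. \<Sum>f | f \<in> faces \<Omega> \<and> f \<subseteq> frontier (\<Union>\<D>). \<Sum>\<^sub>\<infinity>\<alpha>. B \<Omega> f t \<alpha>)) (at t)"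
    if "\<D> \<subseteq> \<T>" "finite \<D>" "t \<in> I" for \<D> t
  proof -
    have "((\<lambda>s. \<Sum>\<Omega>\<in>\<D>. \<Sum>\<^sub>\<infinity>\<alpha>. E \<Omega> s \<alpha>) has_real_derivative (\<Sum>\<Omega>\<in>\<D>. \<Sum>f\<in>faces \<Omega>. \<Sum>\<^sub>\<infinity>\<alpha>. B \<Omega> f t \<alpha>)) (at t)"
      using that by (intro DERIV_sum balance) auto
    then show ?thesis
      using sum_boundary_faces[OF mesh that(1,2), of "\<lambda>\<Omega> f. \<Sum>\<^sub>\<infinity>\<alpha>. B \<Omega> f t \<alpha>", OF cancel[OF _ _ _ _ that(3)]]
      by simp
  qed
  show ?thesis
  proof (intro conjI ballI allI impI; (elim conjE)?)
    fix \<Omega> \<Omega>\<^sub>f f t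
    assume T: "\<Omega> \<in> \<T>" "\<Omega>\<^sub>f \<in> \<T>" and f: "f \<in> faces \<Omega> \<inter> faces \<Omega>\<^sub>f" and t: "t \<in> I" and ne: "\<Omega> \<noteq> \<Omega>\<^sub>f"
    have ne': "\<Omega>\<^sub>f \<noteq> \<Omega>" and f': "f \<in> faces \<Omega>\<^sub>f \<inter> faces \<Omega>" using ne f by auto
    show "((\<lambda>\<gamma>. P \<Omega> f \<Omega>\<^sub>f t \<alpha> \<gamma>) has_sum B \<Omega> f t \<alpha>) UNIV" for \<alpha> by (rule P_sum[OF T ne f t])
    show "((\<lambda>\<alpha>. P \<Omega>\<^sub>f f \<Omega> t \<gamma> \<alpha>) has_sum B \<Omega>\<^sub>f f t \<gamma>) UNIV" for \<gamma> by (rule P_sum[OF T(2,1) ne' f' t])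
    show "P \<Omega>\<^sub>f f \<Omega> t \<gamma> \<alpha> = - P \<Omega> f \<Omega>\<^sub>f t \<alpha> \<gamma>" for \<alpha> \<gamma> unfolding P_def by (rule anti[OF T ne f t])
    show "B \<Omega> f t summable_on UNIV" "B \<Omega>\<^sub>f f t summable_on UNIV"
      using B_sum[OF T(1) _ t] B_sum[OF T(2) _ t] f by (auto intro: has_sum_imp_summable)
    show "(\<Sum>\<^sub>\<infinity>\<alpha>. B \<Omega> f t \<alpha>) + (\<Sum>\<^sub>\<infinity>\<gamma>. B \<Omega>\<^sub>f f t \<gamma>) = 0" by (rule cancel[OF T ne f t])
  next
    fix \<D> t \<Omega> assume D: "\<D> \<subseteq> \<T>" "t \<in> I" "\<Omega> \<in> \<D>"
    then show "E \<Omega> t summable_on UNIV" by (intro has_sum_imp_summable[OF E_sum]) auto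
    fix f assume "f \<in> faces \<Omega>"
    then show "B \<Omega> f t summable_on UNIV" using D by (intro has_sum_imp_summable[OF B_sum]) auto
  next
    fix \<D> t assume "\<D> \<subseteq> \<T>" "finite \<D>" "t \<in> I"
    then show "((\<lambda>s. \<Sum>\<Omega>\<in>\<D>. \<Sum>\<^sub>\<infinity>\<alpha>. E \<Omega> s \<alpha>) has_real_derivative
      (\<Sum>\<Omega>\<in>\<D>. \<Sum>f | f \<in> faces \<Omega> \<and> f \<subseteq> frontier (\<Union>\<D>). \<Sum>\<^sub>\<infinity>\<alpha>. B \<Omega> f t \<alpha>)) (at t)" by (rule total)
  qed
qed

end
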